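(* For each $\mathbb{F}\in\{\mathbb{R},\mathbb{C}\}$ and every $n\ge1$, $$C_n^{\det}(C_n^{\det})^*\preceq_{\mathrm{Lt}}C_n^{\mathrm{per}}(C_n^{\mathrm{per}})^*.$$ Moreover, $$|\det G_n|^2\le_{\mathrm{Lt}}|\mathrm{per}\,G_n|^2.$$ Finally, for every $z\in\mathbb{F}^{n+1}$, $$0\le\mathbb{E}\,e^{\mathrm{i}\,\mathrm{Re}\langle z,C_{n+1}^{\mathrm{per}}\rangle}\le\mathbb{E}\,e^{\mathrm{i}\,\mathrm{Re}\langle z,C_{n+1}^{\det}\rangle}$$ (in particular both expectations are real).
   Context: Let $\beta=\dim_{\mathbb{R}}\mathbb{F}$. A standard $\mathbb{F}$-Gaussian scalar has independent $N(0,1/\beta)$ real coordinates. $G_n$ is an $n\times n$ matrix, and $B_n$ an $(n-1)\times n$ matrix, with i.i.d. standard $\mathbb{F}$-Gaussian entries. For $n\ge2$, the permanental and signed determinantal cofactor columns in $\mathbb{F}^n$ are $(C_n^{\mathrm{per}})_j=\mathrm{per}((B_n)_{-j})$ and $(C_n^{\det})_j=(-1)^{j-1}\det((B_n)_{-j})$, $1\le j\le n$, where $(B_n)_{-j}$ is $B_n$ with column $j$ deleted; $C_1^{\mathrm{per}}=C_1^{\det}=(1)$. $\langle z,w\rangle=\sum_j\overline{z_j}w_j$. For nonnegative random variables $U,V$, $U\le_{\mathrm{Lt}}V$ means $\mathbb{E}e^{-sU}\ge\mathbb{E}e^{-sV}$ for all $s\ge0$. For random positive semidefinite Hermitian $\mathbb{F}$-valued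 matrices $M,N$ of the same size, $M\preceq_{\mathrm{Lt}}N$ means $\mathbb{E}e^{-\mathrm{Re}\,\mathrm{tr}(TM)}\ge\mathbb{E}e^{-\mathrm{Re}\,\mathrm{tr}(TN)}$ for every (deterministic) positive semidefinite Hermitian $\mathbb{F}$-matrix $T$ of that size. *)

theory Defs
  imports
    "HOL-Probability.Probability"
    "Jordan_Normal_Form.Schur_Decomposition"
begin

text \<open>
  Matrices and vectors are those of \<^emph>\<open>Jordan_Normal_Form\<close>: their dimensions are natural numbers, and
  rows, columns and entries are numbered from 0. The definitions are overloaded over the scalar type,
  which is meant to be \<^typ>\<open>real\<close> or \<^typ>\<open>complex\<close>. On both types, conjugation is
  \<^const>\<open>conjugate\<close> (the identity on the reals) and the real dimension is \<open>DIM('a)\<close>. The order on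
  the complex numbers is that of \<^theory>\<open>HOL-Library.Complex_Order\<close>: \<open>x \<le> y\<close> says that the imaginary parts agree
  and that \<open>Re x \<le> Re y\<close>; in particular \<open>0 \<le> x\<close> entails that \<open>x\<close> is real.
\<close>

subsection \<open>Linear algebra\<close>

definition re_part :: "'a::{real_normed_field,euclidean_space} \<Rightarrow> real" where
  "re_part x = inner x 1"

lemma re_part_real [simp]: "re_part (x::real) = x"
  and re_part_complex [simp]: "re_part (z::complex) = Re z"
  by (simp_all add: re_part_def inner_complex_def)

definition per :: "'a::comm_ring_1 mat \<Rightarrow> 'a" where
  "per A = (if dim_row A = dim_col A
     then (\<Sum>p \<in> {p. p permutes {0..<dim_row A}}. \<Prod>i = 0..<dim_row A. A $$ (i, p i)) else 0)"

definition delete_col :: "'a mat \<Rightarrow> nat \<Rightarrow> 'a mat" where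
  "delete_col A j = Matrix.mat (dim_row A) (dim_col A - 1)
     (\<lambda>(i, k). A $$ (i, if k < j then k else Suc k))"

definition cofactor_per :: "'a::comm_ring_1 mat \<Rightarrow> 'a Matrix.vec" where
  "cofactor_per B = Matrix.vec (dim_col B) (\<lambda>j. per (delete_col B j))"

text \<open>With columns numbered from 0, the sign \<open>(-1)\<close> to the power \<open>j - 1\<close> becomes \<open>(-1) ^ j\<close>.\<close>

definition cofactor_det :: "'a::comm_ring_1 mat \<Rightarrow> 'a Matrix.vec" where
  "cofactor_det B = Matrix.vec (dim_col B) (\<lambda>j. (-1) ^ j * Determinant.det (delete_col B j))"

text \<open>
  The convention that both columns are \<open>(1)\<close> for \<open>n = 1\<close> needs no separate clause, since the
  permanent and the determinant of the empty matrix are 1.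
\<close>

lemma cofactor_0_1:
  assumes "B \<in> carrier_mat 0 1"
  shows "cofactor_per B = Matrix.vec 1 (\<lambda>_. 1)" and "cofactor_det B = Matrix.vec 1 (\<lambda>_. 1)"
  using assms
  by (auto simp: cofactor_per_def cofactor_det_def per_def Determinant.det_def delete_col_def)

text \<open>The matrix \<open>v v\<^sup>*\<close> for a column \<open>v\<close>.\<close>

definition outer :: "'a::conjugatable_field Matrix.vec \<Rightarrow> 'a mat" where
  "outer v = mat_of_cols (dim_vec v) [v] * mat_adjoint (mat_of_cols (dim_vec v) [v])"

definition mat_trace :: "'a::comm_monoid_add mat \<Rightarrow> 'a" where
  "mat_trace A = (\<Sum>i<dim_row A. A $$ (i, i))"

definition psd_mat :: "nat \<Rightarrow> 'a::conjugatable_ordered_field mat \<Rightarrow> bool" where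
  "psd_mat n A \<longleftrightarrow> A \<in> carrier_mat n n \<and> mat_adjoint A = A \<and>
     (\<forall>v \<in> carrier_vec n. 0 \<le> (A *\<^sub>v v) \<bullet>c v)"

text \<open>Conjugate-linear in the first argument.\<close>

definition herm_inner :: "'a::conjugatable_field Matrix.vec \<Rightarrow> 'a Matrix.vec \<Rightarrow> 'a" where
  "herm_inner z w = Matrix.scalar_prod (conjugate z) w"

subsection \<open>Gaussian matrices\<close>

text \<open>
  \<^const>\<open>Basis\<close> is \<open>{1}\<close> for the reals and \<open>{1, \<i>}\<close> for the complex numbers, so the
  \<open>inner (X \<omega>) b\<close> are the real coordinates. The second parameter of \<^const>\<open>normal_density\<close> is
  the standard deviation.
\<close>

definition std_gaussian_scalar ::
    "'w measure \<Rightarrow> ('w \<Rightarrow> 'a::euclidean_space) \<Rightarrow> bool" where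
  "std_gaussian_scalar M X \<longleftrightarrow>
     prob_space.indep_vars M (\<lambda>_. borel) (\<lambda>b \<omega>. inner (X \<omega>) b) Basis \<and>
     (\<forall>b\<in>Basis. distributed M lborel (\<lambda>\<omega>. inner (X \<omega>) b)
        (\<lambda>x. ennreal (normal_density 0 (1 / sqrt (real DIM('a))) x)))"

definition std_gaussian_matrix ::
    "'w measure \<Rightarrow> nat \<Rightarrow> nat \<Rightarrow> ('w \<Rightarrow> 'a::euclidean_space mat) \<Rightarrow> bool" where
  "std_gaussian_matrix M m n X \<longleftrightarrow>
     (\<forall>\<omega>\<in>space M. X \<omega> \<in> carrier_mat m n) \<and>
     prob_space.indep_vars M (\<lambda>_. borel) (\<lambda>ij \<omega>. X \<omega> $$ ij) ({..<m} \<times> {..<n}) \<and>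
     (\<forall>i<m. \<forall>j<n. std_gaussian_scalar M (\<lambda>\<omega>. X \<omega> $$ (i, j)))"

subsection \<open>Laplace transform orders\<close>

text \<open>
  Both relations include the requirement that their arguments are of the kind the order is meant
  for: nonnegative random variables, respectively random positive semidefinite Hermitian matrices.
\<close>

definition Lt_le :: "'w measure \<Rightarrow> ('w \<Rightarrow> real) \<Rightarrow> ('w \<Rightarrow> real) \<Rightarrow> bool" where
  "Lt_le M U V \<longleftrightarrow>
     U \<in> borel_measurable M \<and> V \<in> borel_measurable M \<and>
     (\<forall>\<omega>\<in>space M. 0 \<le> U \<omega> \<and> 0 \<le> V \<omega>) \<and>
     (\<forall>s\<ge>0. (\<integral>\<omega>. exp (- s * U \<omega>) \<partial>M) \<ge> (\<integral>\<omega>. exp (- s * V \<omega>) \<partial>M))"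

definition random_psd_mat ::
    "'w measure \<Rightarrow> nat \<Rightarrow>
     ('w \<Rightarrow> 'a::{topological_space,conjugatable_ordered_field} mat) \<Rightarrow> bool" where
  "random_psd_mat M n X \<longleftrightarrow>
     (\<forall>\<omega>\<in>space M. psd_mat n (X \<omega>)) \<and>
     (\<forall>i<n. \<forall>j<n. (\<lambda>\<omega>. X \<omega> $$ (i, j)) \<in> borel_measurable M)"

definition Lt_le_mat ::
    "'w measure \<Rightarrow> nat \<Rightarrow>
     ('w \<Rightarrow> 'a::{real_normed_field,euclidean_space,conjugatable_ordered_field} mat) \<Rightarrow>
     ('w \<Rightarrow> 'a mat) \<Rightarrow> bool" where
  "Lt_le_mat M n X Y \<longleftrightarrow>
     random_psd_mat M n X \<and> random_psd_mat M n Y \<and>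
     (\<forall>T. psd_mat n T \<longrightarrow>
        (\<integral>\<omega>. exp (- re_part (mat_trace (T * X \<omega>))) \<partial>M)
          \<ge> (\<integral>\<omega>. exp (- re_part (mat_trace (T * Y \<omega>))) \<partial>M))"

text \<open>The characteristic function of a random vector \<open>C\<close> at \<open>z\<close>.\<close>

definition vec_char ::
    "'w measure \<Rightarrow>
     ('w \<Rightarrow> 'a::{real_normed_field,euclidean_space,conjugatable_ordered_field} Matrix.vec) \<Rightarrow>
     'a Matrix.vec \<Rightarrow> complex" where
  "vec_char M C z = (\<integral>\<omega>. exp (\<i> * complex_of_real (re_part (herm_inner z (C \<omega>)))) \<partial>M)"

end

theory Submission
  imports Defs
begin

text \<open>
  Pairing a border \<open>z\<close> with the cofactor column of \<open>B\<close> is, up to conjugation and a global sign, the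
  Laplace expansion of the permanent or determinant of the square matrix obtained from \<open>B\<close> by appending the
  deterministic row \<open>z\<close>. The third assertion therefore compares, for \<open>\<epsilon> = 1\<close> (permanent) and
  \<open>\<epsilon> = - 1\<close> (determinant), the functions \<open>border_char \<epsilon> n z\<close>, the expectation of
  \<open>exp (\<i> * Re D)\<close> where \<open>D\<close> is the permanent or determinant of \<open>n\<close> Gaussian rows above the row \<open>z\<close>.
  The comparison proceeds by moving the whole mass of \<open>z\<close> into its last entry.

  For \<open>n \<ge> 1\<close> these functions depend only on the moduli of the entries of \<open>z\<close>
  (\<open>border_char_eq_if_norm_eq\<close>), so let \<open>a\<close> and \<open>b\<close> be two real entries. Given all other columns, \<open>Re D\<close> is a
  real bilinear form in the two bordered columns \<open>(x, a)\<close> and \<open>(y, b)\<close>, with \<open>x\<close> and \<open>y\<close> independent Gaussian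
  vectors: alternating for the determinant, symmetric for the permanent. A rotation of the pair \<open>(x, y)\<close>
  preserves its law. An alternating form is invariant under the corresponding rotation of the two bordered
  columns, so replacing \<open>(a, b)\<close> by \<open>(r, 0)\<close> with \<open>r\<^sup>2 = a\<^sup>2 + b\<^sup>2\<close> leaves the conditional expectation
  unchanged. For a symmetric form, rotating by 45 degrees writes \<open>Re D\<close> as half the difference of the values
  of one quadratic form \<open>Q\<close> at two independent arguments, and the conditional expectation as \<open>cnj (F p) * F q\<close>, where
  \<open>F p\<close> (\<open>self_char\<close> below) is the expectation of \<open>exp (\<i> * Q (x, p) / 2)\<close> and
  \<open>p\<^sup>2 + q\<^sup>2 = a\<^sup>2 + b\<^sup>2\<close>. Now \<open>F p * F q\<close> belongs to the
  rotation invariant sum \<open>Q (x, p) + Q (y, q)\<close>, hence depends on \<open>p\<^sup>2 + q\<^sup>2\<close> only. So the modulus of the conditional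
  expectation depends on \<open>r\<close> alone, and at \<open>(r, 0)\<close> the expectation equals its modulus, because there \<open>p = q\<close>.
  Merging two entries thus fixes the determinantal function and can only increase the modulus of the permanental
  one (\<open>border_char_det_merge\<close>, \<open>border_char_per_merge\<close>).

  Once \<open>z\<close> is concentrated in its last entry \<open>\<rho>\<close>, the expansion is \<open>\<rho>\<close> times the permanent or determinant of a
  square Gaussian matrix, whose last row is itself a Gaussian border one dimension lower
  (\<open>border_char_integrate_border\<close>). Induction on \<open>n\<close> gives \<open>Re_border_char_per_le_det\<close>. Both functions are
  nonnegative for \<open>n \<ge> 1\<close>, since integrating a single Gaussian row already gives a real Gaussian exponential.

  The Laplace transform orders follow by averaging over Gaussian borders: a positive semidefinite \<open>T\<close> is a sum of
  terms \<open>w w\<^sup>*\<close>, and the exponential of minus a sum of squared moduli of linear forms in \<open>C\<close> is the mean of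
  characteristic functions of \<open>C\<close> (\<open>laplace_le_if_char_le\<close>). The same averaging with a single scalar treats
  \<open>\<bar>det G\<bar>\<^sup>2\<close> and \<open>\<bar>per G\<bar>\<^sup>2\<close>.
\<close>

section \<open>Scalars that are real or complex\<close>

text \<open>
  The two fields are treated at once. The axioms express conjugation and positivity through the real inner
  product, so that the arguments below rest on the Euclidean structure of the field and the multiplicativity of
  its norm.
\<close>

class real_or_complex = real_normed_field + euclidean_space + conjugatable_ordered_field +
  assumes add_conjugate_scaleR: "x + conjugate x = (2 * inner x 1) *\<^sub>R 1"
    and conjugate_mult_self_scaleR: "conjugate x * x = ((norm x)\<^sup>2) *\<^sub>R 1"
    and inner_one_nonneg: "0 \<le> x \<Longrightarrow> 0 \<le> inner x 1"

instance real :: real_or_complex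
  by standard (auto simp: power2_eq_square)

instance complex :: real_or_complex
proof
  fix x :: complex
  show "x + conjugate x = (2 * inner x 1) *\<^sub>R 1"
    by (simp add: complex_eq_iff inner_complex_def)
  show "conjugate x * x = ((norm x)\<^sup>2) *\<^sub>R 1"
    using complex_norm_square[of x] by (simp add: scaleR_conv_of_real mult.commute)
  show "0 \<le> x \<Longrightarrow> 0 \<le> inner x 1"
    by (simp add: less_eq_complex_def inner_complex_def)
qed

lemma add_conjugate: "x + conjugate x = of_real (2 * re_part (x::'a::real_or_complex))"
  by (simp add: add_conjugate_scaleR of_real_def re_part_def)

lemma conjugate_mult_self: "conjugate x * x = of_real ((norm (x::'a::real_or_complex))\<^sup>2)"
  by (simp add: conjugate_mult_self_scaleR of_real_def)

lemma re_part_add: "re_part (x + y :: 'a::real_or_complex) = re_part x + re_part y"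
  and re_part_diff: "re_part (x - y :: 'a::real_or_complex) = re_part x - re_part y"
  and re_part_minus: "re_part (- x :: 'a::real_or_complex) = - re_part x"
  and re_part_scaleR: "re_part (r *\<^sub>R x :: 'a::real_or_complex) = r * re_part x"
  and re_part_of_real: "re_part (of_real r :: 'a::real_or_complex) = r"
  and re_part_of_real_mult: "re_part (of_real r * x :: 'a::real_or_complex) = r * re_part x"
proof -
  have "(norm (1::'a))\<^sup>2 = inner (1::'a) 1"
    by (rule power2_norm_eq_inner)
  then have one: "inner (1::'a) 1 = 1" by simp
  show "re_part (x + y) = re_part x + re_part y" "re_part (x - y) = re_part x - re_part y"
    "re_part (- x) = - re_part x" "re_part (r *\<^sub>R x) = r * re_part x"
    by (simp_all add: re_part_def inner_add_left inner_diff_left)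
  show "re_part (of_real r :: 'a::real_or_complex) = r"
    by (simp add: re_part_def of_real_def one)
  show "re_part (of_real r * x) = r * re_part x"
    by (simp add: re_part_def flip: scaleR_conv_of_real)
qed

lemma re_part_sum: "re_part (sum f A :: 'a::real_or_complex) = (\<Sum>i\<in>A. re_part (f i))"
  by (simp add: re_part_def inner_sum_left)

lemma conjugate_conv: "conjugate x = of_real (2 * re_part x) - (x::'a::real_or_complex)"
  using add_conjugate[of x] by (simp add: re_part_def algebra_simps)

lemma re_part_conjugate: "re_part (conjugate x :: 'a::real_or_complex) = re_part x"
  by (simp add: conjugate_conv re_part_diff re_part_of_real del: of_real_mult)

lemma norm_conjugate: "norm (conjugate x :: 'a::real_or_complex) = norm x"
proof -
  have "norm (conjugate x * x) = (norm x)\<^sup>2"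
    by (simp add: conjugate_mult_self norm_power)
  then show ?thesis
    by (cases "x = 0") (auto simp: norm_mult power2_eq_square)
qed

text \<open>
  Polarization of the identity \<open>conjugate x * x = norm x ^ 2\<close>. It turns characteristic functions, which are
  stated with the inner product, into expectations of \<open>exp (\<i> * re_part (a * x))\<close>.
\<close>

lemma inner_eq_re_part: "inner x y = re_part (conjugate x * (y::'a::real_or_complex))"
proof -
  have "of_real ((norm (x + y))\<^sup>2) = conjugate (x + y) * (x + y)"
    by (simp add: conjugate_mult_self)
  also have "\<dots> = conjugate x * x + conjugate y * y
      + (conjugate x * y + conjugate (conjugate x * y))"
    by (simp add: conjugate_dist_add conjugate_dist_mul algebra_simps)
  also have "\<dots> = of_real ((norm x)\<^sup>2 + (norm y)\<^sup>2 + 2 * re_part (conjugate x * y))"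
    by (simp add: conjugate_mult_self add_conjugate)
  finally have "(norm (x + y))\<^sup>2 = (norm x)\<^sup>2 + (norm y)\<^sup>2 + 2 * re_part (conjugate x * y)"
    by (simp only: of_real_eq_iff)
  then show ?thesis
    by (simp add: power2_norm_eq_inner inner_add_left inner_add_right inner_commute)
qed

lemma borel_measurable_re_part [measurable]: "re_part \<in> borel_measurable (borel :: 'a::real_or_complex measure)"
  unfolding re_part_def by measurable

lemma borel_measurable_conjugate [measurable]:
  "conjugate \<in> borel_measurable (borel :: 'a::real_or_complex measure)"
proof -
  have "(\<lambda>x::'a. of_real (2 * re_part x) - x) \<in> borel_measurable borel" by measurable
  then show ?thesis by (simp add: conjugate_conv[abs_def] fun_eq_iff cong: measurable_cong)
qed

lemma re_part_nonneg: "0 \<le> x \<Longrightarrow> 0 \<le> re_part (x::'a::real_or_complex)"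
  by (simp add: re_part_def inner_one_nonneg)

section \<open>The standard Gaussian measure and its symmetries\<close>

text \<open>
  The argument for uniqueness of Haar measure, run for Lebesgue measure and its image under the isometry: with
  \<open>f\<close> the indicator of the unit ball, integrating \<open>f (T x) * g (T x + y)\<close> over \<open>x\<close> and \<open>y\<close> in both orders
  produces the integrals of \<open>g\<close> and of \<open>g \<circ> T\<close>, each times the volume of the ball.
\<close>

lemma lborel_distr_isometry:
  fixes T :: "'b::euclidean_space \<Rightarrow> 'b"
  assumes lin: "linear T" and iso: "\<And>x. norm (T x) = norm x"
  shows "distr lborel borel T = lborel"
proof (rule measure_eqI)
  have [measurable]: "T \<in> borel_measurable borel"
    using lin by (intro borel_measurable_continuous_onI linear_continuous_on)
      (simp add: linear_conv_bounded_linear)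
  have shift: "(\<integral>\<^sup>+x. h (a + x) \<partial>lborel) = (\<integral>\<^sup>+x. h x \<partial>lborel)"
    if [measurable]: "h \<in> borel_measurable borel" for h :: "'b \<Rightarrow> ennreal" and a
    by (subst (2) lborel_distr_plus[of a, symmetric]) (simp add: nn_integral_distr)
  have "inj T"
    using linear_injective_0[OF lin] iso by (metis norm_eq_zero)
  then have surj: "surj T"
    by (rule linear_inj_imp_surj[OF lin])
  define f :: "'b \<Rightarrow> ennreal" where "f = indicator (ball 0 1)"
  have [measurable]: "f \<in> borel_measurable borel"
    unfolding f_def by (rule borel_measurable_indicator) simp
  define c where "c = emeasure lborel (ball (0::'b) 1)"
  have "measure lborel (ball (0::'b) 1) > 0"
    by (rule content_ball_pos) simp
  then have c0: "c \<noteq> 0" unfolding c_def by (auto simp: measure_def)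
  have cinf: "c \<noteq> \<infinity>"
    unfolding c_def using emeasure_lborel_ball_finite[of "0::'b" 1] by auto
  have fc: "(\<integral>\<^sup>+x. f x \<partial>lborel) = c"
    by (simp add: f_def c_def)
  have fT: "f (T x) = f x" for x
    by (simp add: f_def iso indicator_def)
  have ball: "(\<integral>\<^sup>+y. f (a - y) \<partial>lborel) = c" for a
  proof -
    have "(\<integral>\<^sup>+y. f (a - y) \<partial>lborel) = (\<integral>\<^sup>+y. f (a - (a + y)) \<partial>lborel)"
      by (rule shift[symmetric]) measurable
    also have "\<dots> = (\<integral>\<^sup>+y. f y \<partial>lborel)"
      by (intro nn_integral_cong) (auto simp: f_def indicator_def)
    also note fc
    finally show ?thesis .
  qed
  have key: "(\<integral>\<^sup>+x. g (T x) \<partial>lborel) = (\<integral>\<^sup>+x. g x \<partial>lborel)"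
    if [measurable]: "g \<in> borel_measurable borel" for g :: "'b \<Rightarrow> ennreal"
  proof -
    have "c * (\<integral>\<^sup>+y. g y \<partial>lborel) = (\<integral>\<^sup>+x. f x \<partial>lborel) * (\<integral>\<^sup>+y. g y \<partial>lborel)"
      by (simp add: fc)
    also have "\<dots> = (\<integral>\<^sup>+x. f (T x) * (\<integral>\<^sup>+y. g y \<partial>lborel) \<partial>lborel)"
      by (simp add: nn_integral_multc fT fc)
    also have "\<dots> = (\<integral>\<^sup>+x. (\<integral>\<^sup>+y. f (T x) * g (T x + y) \<partial>lborel) \<partial>lborel)"
      by (simp add: shift nn_integral_cmult)
    also have "\<dots> = (\<integral>\<^sup>+y. (\<integral>\<^sup>+x. f (T x) * g (T x + y) \<partial>lborel) \<partial>lborel)"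
      by (rule lborel_pair.Fubini'[symmetric]) measurable
    also have "\<dots> = (\<integral>\<^sup>+y. (\<integral>\<^sup>+x. f (T x - y) * g (T x) \<partial>lborel) \<partial>lborel)"
    proof (rule nn_integral_cong)
      fix y
      \<comment> \<open>translating \<open>x\<close> by \<open>w\<close> shifts \<open>T x\<close> by \<open>- y\<close>\<close>
      obtain w where w: "T w = - y" using surj by (metis surjD)
      show "(\<integral>\<^sup>+x. f (T x) * g (T x + y) \<partial>lborel) = (\<integral>\<^sup>+x. f (T x - y) * g (T x) \<partial>lborel)"
        by (subst shift[symmetric, of _ w]) (auto simp: linear_add[OF lin] w)
    qed
    also have "\<dots> = (\<integral>\<^sup>+x. (\<integral>\<^sup>+y. f (T x - y) * g (T x) \<partial>lborel) \<partial>lborel)"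
      by (rule lborel_pair.Fubini') measurable
    also have "\<dots> = c * (\<integral>\<^sup>+x. g (T x) \<partial>lborel)"
      by (simp add: nn_integral_multc nn_integral_cmult ball)
    finally show ?thesis
      using c0 cinf by (simp add: ennreal_mult_cancel_left)
  qed
  fix A assume "A \<in> sets (distr lborel borel T)"
  then have [measurable]: "A \<in> sets borel" by simp
  have "emeasure (distr lborel borel T) A = (\<integral>\<^sup>+x. indicator A x \<partial>distr lborel borel T)"
    by simp
  also have "\<dots> = (\<integral>\<^sup>+x. indicator A (T x) \<partial>lborel)"
    by (rule nn_integral_distr) auto
  also have "\<dots> = emeasure lborel A"
    by (subst key) auto
  finally show "emeasure (distr lborel borel T) A = emeasure lborel A" .
qed simp

text \<open>
  Written in coordinates, since a standard Gaussian scalar is specified by the law of its coordinates; the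
  symmetries are read off from the radial form in \<open>gaussian_radial\<close>.
\<close>

definition gaussian :: "'a::euclidean_space measure" where
  "gaussian = density lborel
     (\<lambda>x. \<Prod>b\<in>Basis. ennreal (normal_density 0 (1 / sqrt (real DIM('a))) (inner x b)))"

lemma gaussian_radial:
  "(gaussian :: 'a::euclidean_space measure) = density lborel
     (\<lambda>x. ennreal ((1 / sqrt (2 * pi / real DIM('a))) ^ DIM('a) * exp (- (real DIM('a) * (norm x)\<^sup>2 / 2))))"
proof -
  have "(\<Prod>b\<in>Basis. ennreal (normal_density 0 (1 / sqrt (real DIM('a))) (inner x b))) =
    ennreal ((1 / sqrt (2 * pi / real DIM('a))) ^ DIM('a) * exp (- (real DIM('a) * (norm x)\<^sup>2 / 2)))" for x :: 'a
  proof -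
    have "(\<Sum>b\<in>Basis. (inner x b)\<^sup>2) = (norm x)\<^sup>2"
      by (simp add: norm_eq_sqrt_inner euclidean_inner[of x x] power2_eq_square sum_nonneg)
    then have "(\<Prod>b\<in>Basis. exp (- (real DIM('a) * (inner x b)\<^sup>2 / 2))) = exp (- (real DIM('a) * (norm x)\<^sup>2 / 2))"
      by (simp flip: exp_sum add: sum_negf sum_divide_distrib[symmetric] sum_distrib_left[symmetric])
    then show ?thesis
      by (subst prod_ennreal) (auto simp: normal_density_def prod.distrib prod_dividef power_divide field_simps)
  qed
  then show ?thesis by (simp add: gaussian_def)
qed

lemma sets_gaussian [simp, measurable_cong]: "sets gaussian = sets borel"
  and space_gaussian [simp]: "space gaussian = UNIV"
  by (simp_all add: gaussian_def)

lemma gaussian_eq_distr_PiM: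
  "(gaussian :: 'a::euclidean_space measure) =
     distr (PiM Basis (\<lambda>_. density lborel (\<lambda>x. ennreal (normal_density 0 (1 / sqrt (real DIM('a))) x))))
       borel (\<lambda>f. \<Sum>b\<in>Basis. f b *\<^sub>R b)"
proof -
  let ?N = "\<lambda>x. ennreal (normal_density 0 (1 / sqrt (real DIM('a))) x)"
  let ?s = "\<lambda>f. \<Sum>b\<in>(Basis::'a set). f b *\<^sub>R b"
  interpret N: prob_space "density lborel ?N"
    by (rule prob_space_normal_density) simp
  interpret L: product_sigma_finite "\<lambda>_::'a. lborel :: real measure" ..
  interpret P: product_sigma_finite "\<lambda>_::'a. density lborel ?N" ..
  have "density (PiM Basis (\<lambda>_. lborel)) (\<lambda>f. \<Prod>b\<in>Basis. ?N (f b))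
      = PiM (Basis::'a set) (\<lambda>_. density lborel ?N)"
  proof (rule P.PiM_eqI)
    show "sets (density (PiM Basis (\<lambda>_. lborel)) (\<lambda>f. \<Prod>b\<in>Basis. ?N (f b))) =
      sets (PiM (Basis::'a set) (\<lambda>_. density lborel ?N))"
      by (simp cong: sets_PiM_cong)
    fix A :: "'a \<Rightarrow> real set" assume "\<And>i. i \<in> Basis \<Longrightarrow> A i \<in> sets (density lborel ?N)"
    then have [measurable]: "\<And>i. i \<in> Basis \<Longrightarrow> A i \<in> sets borel" by simp
    have box: "Pi\<^sub>E Basis A \<in> sets (PiM (Basis::'a set) (\<lambda>_. lborel :: real measure))"
      by (rule sets_PiM_I_finite) auto
    have "emeasure (density (PiM Basis (\<lambda>_. lborel)) (\<lambda>f. \<Prod>b\<in>Basis. ?N (f b))) (Pi\<^sub>E Basis A)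
      = (\<integral>\<^sup>+f. (\<Prod>b\<in>Basis. ?N (f b)) * indicator (Pi\<^sub>E Basis A) f \<partial>PiM Basis (\<lambda>_. lborel))"
      by (rule emeasure_density) (use box in auto)
    also have "\<dots> = (\<integral>\<^sup>+f. (\<Prod>b\<in>Basis. ?N (f b) * indicator (A b) (f b)) \<partial>PiM Basis (\<lambda>_. lborel))"
    proof (rule nn_integral_cong)
      fix f assume f: "f \<in> space (PiM (Basis::'a set) (\<lambda>_. lborel :: real measure))"
      have "indicator (Pi\<^sub>E Basis A) f = (\<Prod>b\<in>Basis. indicator (A b) (f b) :: ennreal)"
      proof (cases "\<forall>b\<in>Basis. f b \<in> A b")
        case True
        then show ?thesis using f by (auto simp: space_PiM PiE_def)
      next
        case False
        then obtain b where b: "b \<in> Basis" "f b \<notin> A b" by auto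
        then have "f \<notin> Pi\<^sub>E Basis A" by auto
        moreover have "(\<Prod>b\<in>Basis. indicator (A b) (f b) :: ennreal) = 0"
          by (rule prod_zero) (use b in \<open>auto intro!: bexI[of _ b]\<close>)
        ultimately show ?thesis by simp
      qed
      then show "(\<Prod>b\<in>Basis. ?N (f b)) * indicator (Pi\<^sub>E Basis A) f = (\<Prod>b\<in>Basis. ?N (f b) * indicator (A b) (f b))"
        by (simp add: prod.distrib)
    qed
    also have "\<dots> = (\<Prod>b\<in>Basis. \<integral>\<^sup>+x. ?N x * indicator (A b) x \<partial>lborel)"
      by (rule L.product_nn_integral_prod) auto
    also have "\<dots> = (\<Prod>b\<in>Basis. emeasure (density lborel ?N) (A b))"
      by (intro prod.cong refl) (simp add: emeasure_density)
    finally show "emeasure (density (PiM Basis (\<lambda>_. lborel)) (\<lambda>f. \<Prod>b\<in>Basis. ?N (f b))) (Pi\<^sub>E Basis A)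
       = (\<Prod>b\<in>Basis. emeasure (density lborel ?N) (A b))" .
  qed simp
  moreover have "gaussian = distr (density (PiM Basis (\<lambda>_. lborel)) (\<lambda>f. \<Prod>b\<in>Basis. ?N (f b))) borel ?s"
  proof -
    have "gaussian = density (distr (PiM Basis (\<lambda>_. lborel)) borel ?s) (\<lambda>x. \<Prod>b\<in>Basis. ?N (inner x b))"
      unfolding gaussian_def by (subst lborel_eq) simp
    also have "\<dots> = distr (density (PiM Basis (\<lambda>_. lborel)) (\<lambda>f. \<Prod>b\<in>Basis. ?N (inner (?s f) b))) borel ?s"
      by (rule density_distr) auto
    also have "(\<lambda>f. \<Prod>b\<in>Basis. ?N (inner (?s f) b)) = (\<lambda>f. \<Prod>b\<in>Basis. ?N (f b))"
      by (intro ext prod.cong) (auto simp: inner_sum_left inner_Basis if_distrib cong: if_cong)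
    finally show ?thesis .
  qed
  ultimately show ?thesis by simp
qed

lemma prob_space_gaussian: "prob_space (gaussian :: 'a::euclidean_space measure)"
  unfolding gaussian_eq_distr_PiM
  by (intro prob_space.prob_space_distr prob_space_PiM prob_space_normal_density) auto

interpretation gaussian: prob_space gaussian
  by (rule prob_space_gaussian)

lemma distr_std_gaussian_scalar:
  fixes X :: "'w \<Rightarrow> 'a::euclidean_space"
  assumes "prob_space M" "std_gaussian_scalar M X"
  shows "X \<in> borel_measurable M" and "distr M borel X = gaussian"
proof -
  interpret prob_space M by fact
  have ind: "indep_vars (\<lambda>_. borel) (\<lambda>b \<omega>. inner (X \<omega>) b) (Basis::'a set)"
    and dis: "\<And>b. b \<in> Basis \<Longrightarrow> distributed M lborel (\<lambda>\<omega>. inner (X \<omega>) b)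
        (\<lambda>x. ennreal (normal_density 0 (1 / sqrt (real DIM('a))) x))"
    using assms(2) unfolding std_gaussian_scalar_def by auto
  have [measurable]: "(\<lambda>\<omega>. inner (X \<omega>) b) \<in> borel_measurable M" if "b \<in> Basis" for b
    using dis[OF that] by (simp add: distributed_def)
  show X [measurable]: "X \<in> borel_measurable M"
    by (subst borel_measurable_euclidean_space) auto
  have law: "distr M borel (\<lambda>\<omega>. inner (X \<omega>) b) =
      density lborel (\<lambda>x. ennreal (normal_density 0 (1 / sqrt (real DIM('a))) x))" if "b \<in> Basis" for b
  proof -
    have "distr M borel (\<lambda>\<omega>. inner (X \<omega>) b) = distr M lborel (\<lambda>\<omega>. inner (X \<omega>) b)"
      by (rule distr_cong) auto
    then show ?thesis using dis[OF that] by (simp add: distributed_def)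
  qed
  have "distr M (PiM Basis (\<lambda>_. borel)) (\<lambda>\<omega>. \<lambda>b\<in>Basis. inner (X \<omega>) b)
      = PiM (Basis::'a set) (\<lambda>b. distr M borel (\<lambda>\<omega>. inner (X \<omega>) b))"
    using ind by (subst (asm) indep_vars_iff_distr_eq_PiM') auto
  also have "\<dots> = PiM (Basis::'a set) (\<lambda>_. density lborel (\<lambda>x. ennreal (normal_density 0 (1 / sqrt (real DIM('a))) x)))"
    by (rule PiM_cong) (auto simp: law)
  finally have "gaussian = distr (distr M (PiM Basis (\<lambda>_. borel)) (\<lambda>\<omega>. \<lambda>b\<in>Basis. inner (X \<omega>) b)) borel
      (\<lambda>f. \<Sum>b\<in>(Basis::'a set). f b *\<^sub>R b)"
    by (simp add: gaussian_eq_distr_PiM)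
  also have "\<dots> = distr M borel ((\<lambda>f. \<Sum>b\<in>(Basis::'a set). f b *\<^sub>R b) \<circ> (\<lambda>\<omega>. \<lambda>b\<in>Basis. inner (X \<omega>) b))"
    by (rule distr_distr) auto
  also have "\<dots> = distr M borel X"
    by (rule distr_cong) (auto simp: euclidean_representation)
  finally show "distr M borel X = gaussian" ..
qed

lemma gaussian_isometry:
  fixes T :: "'a::euclidean_space \<Rightarrow> 'a"
  assumes lin: "linear T" and iso: "\<And>x. norm (T x) = norm x"
  shows "distr gaussian borel T = gaussian"
proof -
  let ?g = "\<lambda>x::'a. ennreal ((1 / sqrt (2 * pi / real DIM('a))) ^ DIM('a) * exp (- (real DIM('a) * (norm x)\<^sup>2 / 2)))"
  have [measurable]: "T \<in> borel_measurable borel"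
    using lin by (intro borel_measurable_continuous_onI linear_continuous_on)
      (simp add: linear_conv_bounded_linear)
  have "gaussian = density (distr lborel borel T) ?g"
    by (simp add: gaussian_radial lborel_distr_isometry[OF lin iso])
  also have "\<dots> = distr (density lborel (\<lambda>x. ?g (T x))) borel T"
    by (rule density_distr) auto
  also have "\<dots> = distr gaussian borel T"
    by (simp add: gaussian_radial iso)
  finally show ?thesis ..
qed

text \<open>
  The joint density of two independent standard Gaussians is a function of \<open>(norm x)\<^sup>2 + (norm y)\<^sup>2\<close>, and the
  rotation is an isometry of the product space.
\<close>

lemma gaussian_pair_rotation:
  fixes c s :: real
  assumes cs: "c\<^sup>2 + s\<^sup>2 = 1"
  shows "distr (gaussian \<Otimes>\<^sub>M gaussian) (borel \<Otimes>\<^sub>M borel)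
      (\<lambda>(x, y). (c *\<^sub>R x + s *\<^sub>R y, c *\<^sub>R y - s *\<^sub>R x))
    = (gaussian \<Otimes>\<^sub>M gaussian :: ('a::euclidean_space \<times> 'a) measure)"
proof -
  let ?g = "\<lambda>x::'a. ennreal ((1 / sqrt (2 * pi / real DIM('a))) ^ DIM('a) * exp (- (real DIM('a) * (norm x)\<^sup>2 / 2)))"
  let ?h = "\<lambda>z::'a\<times>'a. ennreal (((1 / sqrt (2 * pi / real DIM('a))) ^ DIM('a))\<^sup>2 * exp (- (real DIM('a) * (norm z)\<^sup>2 / 2)))"
  let ?R = "\<lambda>(x::'a, y::'a). (c *\<^sub>R x + s *\<^sub>R y, c *\<^sub>R y - s *\<^sub>R x)"
  have gh: "?g x * ?g y = ?h (x, y)" for x y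
    by (simp add: norm_Pair power2_eq_square ring_distribs add_divide_distrib mult_exp_exp
        flip: ennreal_mult)
  have "(gaussian \<Otimes>\<^sub>M gaussian :: ('a \<times> 'a) measure) = density (lborel \<Otimes>\<^sub>M lborel) (\<lambda>(x, y). ?g x * ?g y)"
    unfolding gaussian_radial
    by (rule pair_measure_density)
       (auto intro!: lborel.sigma_finite_measure_axioms prob_space_imp_sigma_finite
          prob_space_gaussian[unfolded gaussian_radial])
  then have dens: "(gaussian \<Otimes>\<^sub>M gaussian :: ('a \<times> 'a) measure) = density lborel ?h"
    by (simp add: gh lborel_prod cond_case_prod_eta[of _ ?h])
  have lin: "linear ?R"
    by (rule linearI) (auto simp: algebra_simps)
  have nrm: "(norm (?R z))\<^sup>2 = (norm z)\<^sup>2" for z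
  proof (cases z)
    case (Pair x y)
    have "(norm (c *\<^sub>R x + s *\<^sub>R y))\<^sup>2 = c\<^sup>2 * (norm x)\<^sup>2 + s\<^sup>2 * (norm y)\<^sup>2 + 2 * c * s * inner x y"
      and "(norm (c *\<^sub>R y - s *\<^sub>R x))\<^sup>2 = c\<^sup>2 * (norm y)\<^sup>2 + s\<^sup>2 * (norm x)\<^sup>2 - 2 * c * s * inner x y"
      by (simp_all only: power2_norm_eq_inner)
         (simp_all add: inner_add_left inner_add_right
          inner_diff_left inner_diff_right inner_commute[of y x] power2_eq_square field_simps)
    then have "(norm (?R z))\<^sup>2 = (c\<^sup>2 + s\<^sup>2) * ((norm x)\<^sup>2 + (norm y)\<^sup>2)"
      by (simp add: Pair norm_Pair distrib_left distrib_right)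
    then show ?thesis by (simp add: Pair norm_Pair cs)
  qed
  have iso: "norm (?R z) = norm z" for z
    by (rule power2_eq_imp_eq[OF nrm norm_ge_zero norm_ge_zero])
  have [measurable]: "?R \<in> borel_measurable borel"
    using lin by (intro borel_measurable_continuous_onI linear_continuous_on)
      (simp add: linear_conv_bounded_linear)
  have "density lborel ?h = density (distr lborel borel ?R) ?h"
    by (simp only: lborel_distr_isometry[OF lin iso])
  also have "\<dots> = distr (density lborel (\<lambda>x. ?h (?R x))) borel ?R"
    by (rule density_distr) auto
  finally have "density lborel ?h = distr (density lborel ?h) borel ?R"
    by (simp only: iso)
  then show ?thesis
    by (simp only: dens borel_prod)
qed

lemma char_normal_density:
  fixes \<sigma> t :: real
  assumes "\<sigma> > 0"
  shows "(\<integral>x. exp (\<i> * of_real (t * x)) \<partial>density lborel (\<lambda>x. ennreal (normal_density 0 \<sigma> x)))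
    = complex_of_real (exp (- (\<sigma>\<^sup>2 * t\<^sup>2 / 2)))"
proof -
  have "(\<integral>x. exp (\<i> * of_real (t * x)) \<partial>density lborel (\<lambda>x. ennreal (normal_density 0 \<sigma> x)))
      = (\<integral>x. normal_density 0 \<sigma> x *\<^sub>R exp (\<i> * of_real (t * x)) \<partial>lborel)"
    by (rule integral_density) (auto simp: normal_density_nonneg)
  also have "\<dots> = \<bar>\<sigma>\<bar> *\<^sub>R (\<integral>x. normal_density 0 \<sigma> (0 + \<sigma> * x) *\<^sub>R exp (\<i> * of_real (t * (0 + \<sigma> * x))) \<partial>lborel)"
    by (rule lborel_integral_real_affine) (use assms in auto)
  also have "\<dots> = (\<integral>x. std_normal_density x *\<^sub>R exp (\<i> * of_real ((t * \<sigma>) * x)) \<partial>lborel)"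
  proof -
    have "\<sigma> *\<^sub>R (normal_density 0 \<sigma> (\<sigma> * x) *\<^sub>R exp (\<i> * of_real (t * (\<sigma> * x))))
        = std_normal_density x *\<^sub>R exp (\<i> * of_real ((t * \<sigma>) * x))" for x
      using assms by (simp add: normal_density_def real_sqrt_mult power_mult_distrib mult_ac)
    then show ?thesis
      using assms by (simp flip: integral_scaleR_right)
  qed
  also have "\<dots> = char std_normal_distribution (t * \<sigma>)"
    unfolding char_def by (subst integral_density) (auto simp: normal_density_nonneg)
  finally show ?thesis
    by (simp add: char_std_normal_distribution power_mult_distrib mult.commute)
qed

lemma gaussian_char:
  fixes a :: "'a::euclidean_space"
  shows "(\<integral>x. exp (\<i> * of_real (inner a x)) \<partial>gaussian)
    = complex_of_real (exp (- ((norm a)\<^sup>2 / (2 * real DIM('a)))))"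
proof -
  let ?D = "density lborel (\<lambda>x. ennreal (normal_density 0 (1 / sqrt (real DIM('a))) x))"
  interpret N: prob_space ?D
    by (rule prob_space_normal_density) simp
  interpret P: product_sigma_finite "\<lambda>_::'a. ?D" ..
  have "(\<integral>x. exp (\<i> * of_real (inner a x)) \<partial>gaussian)
     = (\<integral>f. exp (\<i> * of_real (inner a (\<Sum>b\<in>(Basis::'a set). f b *\<^sub>R b))) \<partial>PiM Basis (\<lambda>_. ?D))"
    unfolding gaussian_eq_distr_PiM by (rule integral_distr) auto
  also have "\<dots> = (\<integral>f. (\<Prod>b\<in>(Basis::'a set). exp (\<i> * of_real (inner a b * f b))) \<partial>PiM Basis (\<lambda>_. ?D))"
    by (intro Bochner_Integration.integral_cong refl)
       (simp add: inner_sum_right sum_distrib_left mult_ac flip: exp_sum)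
  also have "\<dots> = (\<Prod>b\<in>(Basis::'a set). (\<integral>x. exp (\<i> * of_real (inner a b * x)) \<partial>?D))"
    by (rule P.product_integral_prod) (auto intro!: N.integrable_const_bound[where B=1])
  also have "\<dots> = (\<Prod>b\<in>(Basis::'a set). complex_of_real (exp (- ((inner a b)\<^sup>2 / (2 * real DIM('a))))))"
    by (intro prod.cong refl, subst char_normal_density) (auto simp: field_simps)
  also have "\<dots> = complex_of_real (exp (- ((norm a)\<^sup>2 / (2 * real DIM('a)))))"
  proof -
    have "(\<Sum>b\<in>Basis. (inner a b)\<^sup>2) = (norm a)\<^sup>2"
      by (simp add: norm_eq_sqrt_inner euclidean_inner[of a a] power2_eq_square sum_nonneg)
    then show ?thesis
      by (simp flip: exp_sum of_real_prod add: sum_negf sum_divide_distrib[symmetric])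
  qed
  finally show ?thesis .
qed

lemma gaussian_char_linear_form:
  fixes a :: "'i \<Rightarrow> 'a::real_or_complex"
  assumes "finite J"
  shows "(\<integral>g. exp (\<i> * of_real (re_part (\<Sum>j\<in>J. a j * g j))) \<partial>PiM J (\<lambda>_. gaussian))
    = complex_of_real (exp (- ((\<Sum>j\<in>J. (norm (a j))\<^sup>2) / (2 * real DIM('a)))))"
proof -
  interpret P: product_sigma_finite "\<lambda>_::'i. gaussian :: 'a measure" ..
  have "(\<integral>g. exp (\<i> * of_real (re_part (\<Sum>j\<in>J. a j * g j))) \<partial>PiM J (\<lambda>_. gaussian))
    = (\<integral>g. (\<Prod>j\<in>J. exp (\<i> * of_real (inner (conjugate (a j)) (g j)))) \<partial>PiM J (\<lambda>_. gaussian))"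
    by (intro Bochner_Integration.integral_cong refl)
       (simp add: re_part_sum inner_eq_re_part sum_distrib_left assms flip: exp_sum)
  also have "\<dots> = (\<Prod>j\<in>J. (\<integral>x. exp (\<i> * of_real (inner (conjugate (a j)) x)) \<partial>gaussian))"
    using assms by (intro P.product_integral_prod) (auto intro!: gaussian.integrable_const_bound[where B=1])
  also have "\<dots> = complex_of_real (exp (- ((\<Sum>j\<in>J. (norm (a j))\<^sup>2) / (2 * real DIM('a)))))"
    using assms
    by (simp add: gaussian_char norm_conjugate sum_negf sum_divide_distrib flip: exp_sum of_real_prod)
  finally show ?thesis .
qed

section \<open>Product measures and rotations of Gaussian vectors\<close>

lemma prob_space_PiM_gaussian:
  "prob_space (PiM I (\<lambda>_. gaussian :: 'a::euclidean_space measure))"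
  by (intro prob_space_PiM prob_space_gaussian)

lemma distr_PiM_map:
  assumes fin: "finite I" and prob: "\<And>i. i \<in> I \<Longrightarrow> prob_space (N i)"
    and f: "\<And>i. i \<in> I \<Longrightarrow> f i \<in> N i \<rightarrow>\<^sub>M N i"
    and inv: "\<And>i. i \<in> I \<Longrightarrow> distr (N i) (N i) (f i) = N i"
  shows "distr (PiM I N) (PiM I N) (\<lambda>x. \<lambda>i\<in>I. f i (x i)) = PiM I N"
proof -
  define N' where "N' = (\<lambda>i. if i \<in> I then N i else return (count_space UNIV) undefined)"
  interpret P: product_prob_space N'
    by (rule product_prob_spaceI) (auto simp: N'_def intro!: prob_space_return prob)
  have eq: "PiM I N = PiM I N'"
    by (rule PiM_cong) (auto simp: N'_def)
  have [measurable]: "\<And>i. i \<in> I \<Longrightarrow> f i \<in> N' i \<rightarrow>\<^sub>M N' i"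
    using f by (simp add: N'_def)
  show ?thesis unfolding eq
  proof (rule P.PiM_eqI)
    fix A assume A: "\<And>i. i \<in> I \<Longrightarrow> A i \<in> sets (N' i)"
    have "emeasure (distr (PiM I N') (PiM I N') (\<lambda>x. \<lambda>i\<in>I. f i (x i))) (Pi\<^sub>E I A)
        = emeasure (PiM I N') ((\<lambda>x. \<lambda>i\<in>I. f i (x i)) -` Pi\<^sub>E I A \<inter> space (PiM I N'))"
      by (rule emeasure_distr) (use fin A in \<open>auto intro!: sets_PiM_I_finite\<close>)
    also have "(\<lambda>x. \<lambda>i\<in>I. f i (x i)) -` Pi\<^sub>E I A \<inter> space (PiM I N')
        = Pi\<^sub>E I (\<lambda>i. f i -` A i \<inter> space (N' i))"
      by (auto simp: space_PiM PiE_def Pi_def)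
    also have "emeasure (PiM I N') \<dots> = (\<Prod>i\<in>I. emeasure (N' i) (f i -` A i \<inter> space (N' i)))"
      by (rule P.emeasure_PiM) (use fin A in auto)
    also have "\<dots> = (\<Prod>i\<in>I. emeasure (distr (N' i) (N' i) (f i)) (A i))"
      by (intro prod.cong refl emeasure_distr[symmetric]) (use A in auto)
    also have "\<dots> = (\<Prod>i\<in>I. emeasure (N' i) (A i))"
      by (intro prod.cong refl) (use inv in \<open>simp add: N'_def\<close>)
    finally show "emeasure (distr (PiM I N') (PiM I N') (\<lambda>x. \<lambda>i\<in>I. f i (x i))) (Pi\<^sub>E I A)
        = (\<Prod>i\<in>I. emeasure (N' i) (A i))" .
  qed (use fin in auto)
qed

context
  fixes N :: "'a measure" and I :: "'i set" and J :: "'j set"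
  assumes N: "prob_space N" and I: "finite I" and J: "finite J"
begin

lemma measurable_uncurry:
  "(\<lambda>X. \<lambda>(i, j)\<in>I \<times> J. X i j) \<in> PiM I (\<lambda>_. PiM J (\<lambda>_. N)) \<rightarrow>\<^sub>M PiM (I \<times> J) (\<lambda>_. N)"
proof (rule measurable_restrict)
  fix k assume "k \<in> I \<times> J"
  then obtain i j where k: "k = (i, j)" "i \<in> I" "j \<in> J" by auto
  have "(\<lambda>X. X i j) \<in> PiM I (\<lambda>_. PiM J (\<lambda>_. N)) \<rightarrow>\<^sub>M N"
    by (rule measurable_compose[OF measurable_component_singleton[OF k(2)] measurable_component_singleton[OF k(3)]])
  then show "(\<lambda>X. case k of (i, j) \<Rightarrow> X i j) \<in> PiM I (\<lambda>_. PiM J (\<lambda>_. N)) \<rightarrow>\<^sub>M N"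
    by (simp add: k)
qed

text \<open>
  A matrix of independent entries is described by one product over index pairs, by a product of rows or by a product
  of columns. The first form is the law of a Gaussian random matrix; integrating out a row or rotating two columns
  needs the other two.
\<close>

lemma distr_uncurry:
  "distr (PiM I (\<lambda>_. PiM J (\<lambda>_. N))) (PiM (I \<times> J) (\<lambda>_. N)) (\<lambda>X. \<lambda>(i, j)\<in>I \<times> J. X i j)
    = PiM (I \<times> J) (\<lambda>_. N)"
proof -
  interpret N: prob_space N by (rule N)
  interpret PN: product_prob_space "\<lambda>_::'i \<times> 'j. N" "I \<times> J" ..
  interpret PJ: product_prob_space "\<lambda>_::'j. N" J ..
  interpret M: prob_space "PiM J (\<lambda>_. N)" by (intro prob_space_PiM N)
  interpret PM: product_prob_space "\<lambda>_::'i. PiM J (\<lambda>_. N)" I ..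
  let ?f = "\<lambda>X. \<lambda>(i, j)\<in>I \<times> J. X i j"
  show ?thesis
  proof (rule PN.PiM_eqI)
    fix A assume A: "\<And>k. k \<in> I \<times> J \<Longrightarrow> A k \<in> sets N"
    have box: "Pi\<^sub>E J (\<lambda>j. A (i, j)) \<in> sets (PiM J (\<lambda>_. N))" if "i \<in> I" for i
      using that J A by (intro sets_PiM_I_finite) auto
    have "emeasure (distr (PiM I (\<lambda>_. PiM J (\<lambda>_. N))) (PiM (I \<times> J) (\<lambda>_. N)) ?f) (Pi\<^sub>E (I \<times> J) A)
       = emeasure (PiM I (\<lambda>_. PiM J (\<lambda>_. N))) (?f -` Pi\<^sub>E (I \<times> J) A \<inter> space (PiM I (\<lambda>_. PiM J (\<lambda>_. N))))"
      by (rule emeasure_distr[OF measurable_uncurry]) (use I J A in \<open>auto intro!: sets_PiM_I_finite\<close>)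
    also have "?f -` Pi\<^sub>E (I \<times> J) A \<inter> space (PiM I (\<lambda>_. PiM J (\<lambda>_. N))) = Pi\<^sub>E I (\<lambda>i. Pi\<^sub>E J (\<lambda>j. A (i, j)))"
    proof -
      have sub: "x \<in> space N" if "x \<in> A (i, j)" "i \<in> I" "j \<in> J" for x i j
        using A[of "(i, j)"] sets.sets_into_space that by blast
      show ?thesis
      proof (intro equalityI subsetI)
        fix X assume X: "X \<in> ?f -` Pi\<^sub>E (I \<times> J) A \<inter> space (PiM I (\<lambda>_. PiM J (\<lambda>_. N)))"
        then have "?f X (i, j) \<in> A (i, j)" if "i \<in> I" "j \<in> J" for i j
          using that by (intro PiE_mem[of "?f X" "I \<times> J" A]) auto
        with X show "X \<in> Pi\<^sub>E I (\<lambda>i. Pi\<^sub>E J (\<lambda>j. A (i, j)))"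
          by (auto simp: space_PiM PiE_iff)
      next
        fix X assume "X \<in> Pi\<^sub>E I (\<lambda>i. Pi\<^sub>E J (\<lambda>j. A (i, j)))"
        then show "X \<in> ?f -` Pi\<^sub>E (I \<times> J) A \<inter> space (PiM I (\<lambda>_. PiM J (\<lambda>_. N)))"
          by (auto simp: space_PiM PiE_iff intro: sub)
      qed
    qed
    also have "emeasure (PiM I (\<lambda>_. PiM J (\<lambda>_. N))) \<dots> = (\<Prod>i\<in>I. emeasure (PiM J (\<lambda>_. N)) (Pi\<^sub>E J (\<lambda>j. A (i, j))))"
      by (rule PM.emeasure_PiM) (use I box in auto)
    also have "\<dots> = (\<Prod>i\<in>I. \<Prod>j\<in>J. emeasure N (A (i, j)))"
      by (intro prod.cong refl PJ.emeasure_PiM) (use J A in auto)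
    also have "\<dots> = (\<Prod>k\<in>I \<times> J. emeasure N (A k))"
      by (simp add: prod.cartesian_product)
    finally show "emeasure (distr (PiM I (\<lambda>_. PiM J (\<lambda>_. N))) (PiM (I \<times> J) (\<lambda>_. N)) ?f) (Pi\<^sub>E (I \<times> J) A)
       = (\<Prod>k\<in>I \<times> J. emeasure N (A k))" .
  qed (use I J in auto)
qed

end

lemma distr_uncurry_swap:
  assumes N: "prob_space N" and I: "finite I" and J: "finite J"
  shows "(\<lambda>Y. \<lambda>(i, j)\<in>I \<times> J. Y j i) \<in> PiM J (\<lambda>_. PiM I (\<lambda>_. N)) \<rightarrow>\<^sub>M PiM (I \<times> J) (\<lambda>_. N)" (is ?m)
    and "distr (PiM J (\<lambda>_. PiM I (\<lambda>_. N))) (PiM (I \<times> J) (\<lambda>_. N)) (\<lambda>Y. \<lambda>(i, j)\<in>I \<times> J. Y j i)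
    = PiM (I \<times> J) (\<lambda>_. N)" (is ?d)
proof -
  interpret N: prob_space N by (rule N)
  interpret PN: product_prob_space "\<lambda>_::'b \<times> 'c. N" "I \<times> J" ..
  interpret PN': product_prob_space "\<lambda>_::'c \<times> 'b. N" "J \<times> I" ..
  let ?s = "\<lambda>w. \<lambda>k\<in>I \<times> J. w (prod.swap k)"
  have s: "?s \<in> PiM (J \<times> I) (\<lambda>_. N) \<rightarrow>\<^sub>M PiM (I \<times> J) (\<lambda>_. N)"
    by (rule measurable_restrict, rule measurable_component_singleton) auto
  have comp: "?s \<circ> (\<lambda>X. \<lambda>(j, i)\<in>J \<times> I. X j i) = (\<lambda>Y. \<lambda>(i, j)\<in>I \<times> J. Y j i)"
    by (auto simp: fun_eq_iff)
  show ?m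
    using measurable_comp[OF measurable_uncurry[OF N J I] s] by (simp only: comp)
  have "distr (PiM (J \<times> I) (\<lambda>_. N)) (PiM (I \<times> J) (\<lambda>_. N)) ?s = PiM (I \<times> J) (\<lambda>_. N)"
    by (rule PN'.distr_reorder) (use I J in auto)
  then have "PiM (I \<times> J) (\<lambda>_. N) = distr (distr (PiM J (\<lambda>_. PiM I (\<lambda>_. N))) (PiM (J \<times> I) (\<lambda>_. N))
      (\<lambda>X. \<lambda>(j, i)\<in>J \<times> I. X j i)) (PiM (I \<times> J) (\<lambda>_. N)) ?s"
    by (simp add: distr_uncurry[OF N J I])
  also have "\<dots> = distr (PiM J (\<lambda>_. PiM I (\<lambda>_. N))) (PiM (I \<times> J) (\<lambda>_. N)) (\<lambda>Y. \<lambda>(i, j)\<in>I \<times> J. Y j i)"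
    by (subst distr_distr[OF s measurable_uncurry[OF N J I]]) (simp only: comp)
  finally show ?d ..
qed

lemma integral_PiM_rows:
  fixes f :: "_ \<Rightarrow> complex"
  assumes N: "prob_space N" and IJ: "finite I" "finite J"
    and f: "f \<in> borel_measurable (PiM (I \<times> J) (\<lambda>_. N))"
  shows "integral\<^sup>L (PiM (I \<times> J) (\<lambda>_. N)) f
    = (\<integral>X. f (\<lambda>(i, j)\<in>I \<times> J. X i j) \<partial>PiM I (\<lambda>_. PiM J (\<lambda>_. N)))"
  using integral_distr[OF measurable_uncurry[OF N IJ] f] by (simp only: distr_uncurry[OF N IJ])

lemma integral_PiM_cols:
  fixes f :: "_ \<Rightarrow> complex"
  assumes N: "prob_space N" and IJ: "finite I" "finite J"
    and f: "f \<in> borel_measurable (PiM (I \<times> J) (\<lambda>_. N))"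
  shows "integral\<^sup>L (PiM (I \<times> J) (\<lambda>_. N)) f
    = (\<integral>Y. f (\<lambda>(i, j)\<in>I \<times> J. Y j i) \<partial>PiM J (\<lambda>_. PiM I (\<lambda>_. N)))"
  using integral_distr[OF distr_uncurry_swap(1)[OF N IJ] f]
  by (simp only: distr_uncurry_swap(2)[OF N IJ])

lemma distr_pair_PiM_bool:
  assumes N: "prob_space N"
  shows "(\<lambda>z b. if b then snd z else fst z) \<in> N \<Otimes>\<^sub>M N \<rightarrow>\<^sub>M PiM UNIV (\<lambda>_::bool. N)" (is ?m)
    and "distr (N \<Otimes>\<^sub>M N) (PiM UNIV (\<lambda>_::bool. N)) (\<lambda>z b. if b then snd z else fst z)
      = PiM UNIV (\<lambda>_. N)" (is ?d)
proof -
  interpret N: prob_space N by (rule N)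
  interpret P: product_prob_space "\<lambda>_::bool. N" UNIV ..
  have "(\<lambda>z. \<lambda>b\<in>UNIV. if b then snd z else fst z) \<in> N \<Otimes>\<^sub>M N \<rightarrow>\<^sub>M PiM UNIV (\<lambda>_::bool. N)"
    by (rule measurable_restrict) (auto split: if_splits)
  then show m: ?m by (simp only: restrict_UNIV)
  show ?d
  proof (rule P.PiM_eqI)
    fix A :: "bool \<Rightarrow> 'a set" assume "\<And>i. i \<in> UNIV \<Longrightarrow> A i \<in> sets N"
    then have A: "A b \<in> sets N" for b by simp
    have "emeasure (distr (N \<Otimes>\<^sub>M N) (PiM UNIV (\<lambda>_::bool. N)) (\<lambda>z b. if b then snd z else fst z)) (Pi\<^sub>E UNIV A)
      = emeasure (N \<Otimes>\<^sub>M N) ((\<lambda>z b. if b then snd z else fst z) -` Pi\<^sub>E UNIV A \<inter> space (N \<Otimes>\<^sub>M N))"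
      by (rule emeasure_distr[OF m]) (use A in \<open>auto intro!: sets_PiM_I_finite\<close>)
    also have "(\<lambda>z b. if b then snd z else fst z) -` Pi\<^sub>E UNIV A \<inter> space (N \<Otimes>\<^sub>M N) = A False \<times> A True"
      using A[THEN sets.sets_into_space] by (auto simp: space_pair_measure PiE_iff split: if_splits)
    also have "emeasure (N \<Otimes>\<^sub>M N) \<dots> = emeasure N (A False) * emeasure N (A True)"
      by (rule N.emeasure_pair_measure_Times) (use A in auto)
    finally show "emeasure (distr (N \<Otimes>\<^sub>M N) (PiM UNIV (\<lambda>_::bool. N)) (\<lambda>z b. if b then snd z else fst z)) (Pi\<^sub>E UNIV A)
      = (\<Prod>b\<in>UNIV. emeasure N (A b))"
      by (simp add: UNIV_bool)
  qed auto
qed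

text \<open>
  A family of independent pairs is the same as a pair of independent families. Both are images of the product
  over \<open>I \<times> bool\<close>, where boxes of single entries determine the measure.
\<close>

lemma distr_unzip:
  assumes N: "prob_space N" and I: "finite I"
  shows "distr (PiM I (\<lambda>_. N \<Otimes>\<^sub>M N)) (PiM I (\<lambda>_. N) \<Otimes>\<^sub>M PiM I (\<lambda>_. N))
      (\<lambda>h. (\<lambda>i\<in>I. fst (h i), \<lambda>i\<in>I. snd (h i))) = PiM I (\<lambda>_. N) \<Otimes>\<^sub>M PiM I (\<lambda>_. N)"
proof -
  interpret N: prob_space N by (rule N)
  let ?V = "PiM I (\<lambda>_. N)"
  let ?W = "PiM (I \<times> (UNIV::bool set)) (\<lambda>_. N)"
  let ?B = "PiM (UNIV::bool set) (\<lambda>_. N)"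
  have V: "prob_space ?V" by (intro prob_space_PiM N)
  have NN: "prob_space (N \<Otimes>\<^sub>M N)" by (rule prob_space_pair[OF N N])
  have B: "prob_space ?B" by (intro prob_space_PiM N)
  let ?e = "\<lambda>z b. if b then snd z else fst z"
  let ?un = "\<lambda>w::'b \<times> bool \<Rightarrow> 'a. (\<lambda>i\<in>I. w (i, False), \<lambda>i\<in>I. w (i, True))"
  let ?c = "\<lambda>Y. \<lambda>(i, b)\<in>I \<times> (UNIV::bool set). Y b i"
  let ?r = "\<lambda>X. \<lambda>(i, b)\<in>I \<times> (UNIV::bool set). X i b"
  have un: "?un \<in> ?W \<rightarrow>\<^sub>M ?V \<Otimes>\<^sub>M ?V"
    by (intro measurable_Pair measurable_restrict measurable_component_singleton) auto
  have e: "?e \<in> ?V \<Otimes>\<^sub>M ?V \<rightarrow>\<^sub>M PiM UNIV (\<lambda>_::bool. ?V)"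
    and e_d: "distr (?V \<Otimes>\<^sub>M ?V) (PiM UNIV (\<lambda>_::bool. ?V)) ?e = PiM UNIV (\<lambda>_::bool. ?V)"
    using distr_pair_PiM_bool[OF V] by auto
  have c: "?c \<in> PiM UNIV (\<lambda>_::bool. ?V) \<rightarrow>\<^sub>M ?W"
    and c_d: "distr (PiM UNIV (\<lambda>_::bool. ?V)) ?W ?c = ?W"
    using distr_uncurry_swap[OF N I, of "UNIV::bool set"] by auto
  have W: "distr ?W (?V \<Otimes>\<^sub>M ?V) ?un = ?V \<Otimes>\<^sub>M ?V"
  proof -
    have "distr ?W (?V \<Otimes>\<^sub>M ?V) ?un = distr (?V \<Otimes>\<^sub>M ?V) (?V \<Otimes>\<^sub>M ?V) (?un \<circ> (?c \<circ> ?e))"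
      by (subst distr_distr[symmetric, OF un measurable_comp[OF e c]])
         (simp only: distr_distr[symmetric, OF c e] e_d c_d)
    also have "\<dots> = distr (?V \<Otimes>\<^sub>M ?V) (?V \<Otimes>\<^sub>M ?V) (\<lambda>z. z)"
      by (rule distr_cong)
         (auto simp: space_pair_measure space_PiM PiE_def extensional_def fun_eq_iff)
    finally show ?thesis by (simp add: distr_id)
  qed
  have e': "?e \<in> N \<Otimes>\<^sub>M N \<rightarrow>\<^sub>M ?B" and e'_d: "distr (N \<Otimes>\<^sub>M N) ?B ?e = ?B"
    using distr_pair_PiM_bool[OF N] by auto
  have r: "?r \<in> PiM I (\<lambda>_. ?B) \<rightarrow>\<^sub>M ?W" and r_d: "distr (PiM I (\<lambda>_. ?B)) ?W ?r = ?W"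
    using measurable_uncurry[OF N I, of "UNIV::bool set"] distr_uncurry[OF N I, of "UNIV::bool set"] by auto
  have k_d: "distr (PiM I (\<lambda>_. N \<Otimes>\<^sub>M N)) (PiM I (\<lambda>_. ?B)) (compose I ?e) = PiM I (\<lambda>_. ?B)"
    using distr_PiM_finite_prob_space'[of I "\<lambda>_. N \<Otimes>\<^sub>M N" "\<lambda>_. ?B" ?e] I NN B e' e'_d by simp
  have k: "compose I ?e \<in> PiM I (\<lambda>_. N \<Otimes>\<^sub>M N) \<rightarrow>\<^sub>M PiM I (\<lambda>_. ?B)"
    unfolding compose_def
  proof (rule measurable_restrict)
    fix i assume "i \<in> I"
    then have "(\<lambda>h. h i) \<in> PiM I (\<lambda>_. N \<Otimes>\<^sub>M N) \<rightarrow>\<^sub>M N \<Otimes>\<^sub>M N"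
      by (rule measurable_component_singleton)
    from measurable_compose[OF this e'] show "(\<lambda>h. ?e (h i)) \<in> PiM I (\<lambda>_. N \<Otimes>\<^sub>M N) \<rightarrow>\<^sub>M ?B" .
  qed
  have "?V \<Otimes>\<^sub>M ?V = distr (PiM I (\<lambda>_. N \<Otimes>\<^sub>M N)) (?V \<Otimes>\<^sub>M ?V) (?un \<circ> (?r \<circ> compose I ?e))"
    by (subst distr_distr[symmetric, OF un measurable_comp[OF k r]])
       (simp only: distr_distr[symmetric, OF r k] k_d r_d W)
  also have "\<dots> = distr (PiM I (\<lambda>_. N \<Otimes>\<^sub>M N)) (?V \<Otimes>\<^sub>M ?V) (\<lambda>h. (\<lambda>i\<in>I. fst (h i), \<lambda>i\<in>I. snd (h i)))"
    by (rule distr_cong) (auto simp: compose_def fun_eq_iff)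
  finally show ?thesis ..
qed

lemma gaussian_vectors_rotation:
  fixes c s :: real
  assumes I: "finite I" and cs: "c\<^sup>2 + s\<^sup>2 = 1"
  defines "V \<equiv> PiM I (\<lambda>_. gaussian :: 'a::euclidean_space measure)"
  shows "distr (V \<Otimes>\<^sub>M V) (V \<Otimes>\<^sub>M V)
      (\<lambda>(x, y). (\<lambda>i\<in>I. c *\<^sub>R x i + s *\<^sub>R y i, \<lambda>i\<in>I. c *\<^sub>R y i - s *\<^sub>R x i)) = V \<Otimes>\<^sub>M V"
proof -
  let ?N = "gaussian :: 'a measure"
  let ?U = "\<lambda>h. (\<lambda>i\<in>I. fst (h i), \<lambda>i\<in>I. snd (h i))"
  let ?R = "\<lambda>(x::'a, y::'a). (c *\<^sub>R x + s *\<^sub>R y, c *\<^sub>R y - s *\<^sub>R x)"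
  let ?RR = "\<lambda>(x, y). (\<lambda>i\<in>I. c *\<^sub>R x i + s *\<^sub>R y i, \<lambda>i\<in>I. c *\<^sub>R y i - s *\<^sub>R x i)"
  have NN: "prob_space (?N \<Otimes>\<^sub>M ?N)" by (intro prob_space_pair prob_space_gaussian)
  have U: "?U \<in> PiM I (\<lambda>_. ?N \<Otimes>\<^sub>M ?N) \<rightarrow>\<^sub>M V \<Otimes>\<^sub>M V"
    unfolding V_def by (intro measurable_Pair measurable_restrict) auto
  have U_d: "distr (PiM I (\<lambda>_. ?N \<Otimes>\<^sub>M ?N)) (V \<Otimes>\<^sub>M V) ?U = V \<Otimes>\<^sub>M V"
    unfolding V_def by (rule distr_unzip[OF prob_space_gaussian I])
  have R: "?R \<in> ?N \<Otimes>\<^sub>M ?N \<rightarrow>\<^sub>M ?N \<Otimes>\<^sub>M ?N"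
    by measurable
  have "distr (?N \<Otimes>\<^sub>M ?N) (?N \<Otimes>\<^sub>M ?N) ?R = distr (?N \<Otimes>\<^sub>M ?N) (borel \<Otimes>\<^sub>M borel) ?R"
    by (rule distr_cong) (auto intro!: sets_pair_measure_cong)
  then have R_d: "distr (?N \<Otimes>\<^sub>M ?N) (?N \<Otimes>\<^sub>M ?N) ?R = ?N \<Otimes>\<^sub>M ?N"
    by (simp add: gaussian_pair_rotation[OF cs])
  let ?k = "\<lambda>x. \<lambda>i\<in>I. ?R (x i)"
  have k: "?k \<in> PiM I (\<lambda>_. ?N \<Otimes>\<^sub>M ?N) \<rightarrow>\<^sub>M PiM I (\<lambda>_. ?N \<Otimes>\<^sub>M ?N)"
  proof (rule measurable_restrict)
    fix i assume "i \<in> I"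
    then have "(\<lambda>h. h i) \<in> PiM I (\<lambda>_. ?N \<Otimes>\<^sub>M ?N) \<rightarrow>\<^sub>M ?N \<Otimes>\<^sub>M ?N"
      by (rule measurable_component_singleton)
    from measurable_compose[OF this R]
    show "(\<lambda>h. ?R (h i)) \<in> PiM I (\<lambda>_. ?N \<Otimes>\<^sub>M ?N) \<rightarrow>\<^sub>M ?N \<Otimes>\<^sub>M ?N" .
  qed
  have k_d: "distr (PiM I (\<lambda>_. ?N \<Otimes>\<^sub>M ?N)) (PiM I (\<lambda>_. ?N \<Otimes>\<^sub>M ?N)) ?k = PiM I (\<lambda>_. ?N \<Otimes>\<^sub>M ?N)"
    by (rule distr_PiM_map) (use I NN R R_d in auto)
  have RR: "?RR \<in> V \<Otimes>\<^sub>M V \<rightarrow>\<^sub>M V \<Otimes>\<^sub>M V"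
    unfolding V_def case_prod_beta by (intro measurable_Pair measurable_restrict) auto
  have "distr (V \<Otimes>\<^sub>M V) (V \<Otimes>\<^sub>M V) ?RR = distr (PiM I (\<lambda>_. ?N \<Otimes>\<^sub>M ?N)) (V \<Otimes>\<^sub>M V) (?RR \<circ> ?U)"
    by (subst U_d[symmetric], subst distr_distr[OF RR U]) simp
  also have "\<dots> = distr (PiM I (\<lambda>_. ?N \<Otimes>\<^sub>M ?N)) (V \<Otimes>\<^sub>M V) (?U \<circ> ?k)"
    by (rule distr_cong) (auto simp: case_prod_beta fun_eq_iff)
  also have "\<dots> = distr (distr (PiM I (\<lambda>_. ?N \<Otimes>\<^sub>M ?N)) (PiM I (\<lambda>_. ?N \<Otimes>\<^sub>M ?N)) ?k) (V \<Otimes>\<^sub>M V) ?U"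
    by (rule distr_distr[OF U k, symmetric])
  finally show ?thesis by (simp only: k_d U_d)
qed

lemma gaussian_family_phase:
  fixes u :: "'i \<Rightarrow> 'a::{real_normed_field,euclidean_space}"
  assumes K: "finite K" and u: "\<And>k. k \<in> K \<Longrightarrow> norm (u k) = 1"
  shows "distr (PiM K (\<lambda>_. gaussian)) (PiM K (\<lambda>_. gaussian)) (\<lambda>x. \<lambda>k\<in>K. u k * x k)
    = PiM K (\<lambda>_. gaussian)"
proof (rule distr_PiM_map[OF K prob_space_gaussian])
  fix k assume k: "k \<in> K"
  show "(*) (u k) \<in> gaussian \<rightarrow>\<^sub>M gaussian" by measurable
  have "distr gaussian gaussian ((*) (u k)) = distr gaussian borel ((*) (u k))"
    by (rule distr_cong) auto
  also have "\<dots> = gaussian"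
    by (rule gaussian_isometry) (auto simp: norm_mult u[OF k] linear_times)
  finally show "distr gaussian gaussian ((*) (u k)) = gaussian" .
qed

section \<open>Permanents and determinants as one family\<close>

text \<open>
  The permanent for \<open>\<epsilon> = 1\<close> and the determinant for \<open>\<epsilon> = - 1\<close>. Functions in place of matrices make the
  replacement of a row or column, and the passage to the leading square block, immediate.
\<close>

definition signed_per :: "'a::comm_ring_1 \<Rightarrow> nat \<Rightarrow> (nat \<Rightarrow> nat \<Rightarrow> 'a) \<Rightarrow> 'a" where
  "signed_per \<epsilon> n A = (\<Sum>p | p permutes {..<n}. (if evenperm p then 1 else \<epsilon>) * (\<Prod>i<n. A i (p i)))"

lemma finite_permutes_lessThan [simp]: "finite {p. p permutes {..<n::nat}}"
  by (rule finite_permutations) simp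

lemma permutes_lessThan_less: "p permutes {..<n} \<Longrightarrow> i < n \<Longrightarrow> p i < (n::nat)"
  using permutes_in_image[of p "{..<n}" i] by simp

lemma signed_per_cong:
  assumes "\<And>i j. i < n \<Longrightarrow> j < n \<Longrightarrow> A i j = B i j"
  shows "signed_per \<epsilon> n A = signed_per \<epsilon> n B"
  unfolding signed_per_def
  by (intro sum.cong refl arg_cong2[where f="(*)"] prod.cong) (auto simp: assms permutes_lessThan_less)

lemma borel_measurable_signed_per:
  fixes A :: "'w \<Rightarrow> nat \<Rightarrow> nat \<Rightarrow> 'a::{real_normed_field,euclidean_space}"
  assumes "\<And>i j. i < n \<Longrightarrow> j < n \<Longrightarrow> (\<lambda>\<omega>. A \<omega> i j) \<in> borel_measurable M"
  shows "(\<lambda>\<omega>. signed_per \<epsilon> n (A \<omega>)) \<in> borel_measurable M"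
  unfolding signed_per_def
  by (intro borel_measurable_sum borel_measurable_times borel_measurable_const borel_measurable_prod)
     (auto simp: assms permutes_lessThan_less)

lemma signed_per_scale:
  "signed_per \<epsilon> n (\<lambda>i j. c i * d j * A i j) = (\<Prod>i<n. c i) * (\<Prod>j<n. d j) * signed_per \<epsilon> n A"
proof -
  have "(\<Prod>i<n. c i * d (p i) * A i (p i)) = (\<Prod>i<n. c i) * (\<Prod>j<n. d j) * (\<Prod>i<n. A i (p i))"
    if "p permutes {..<n}" for p
    using prod.permute[OF that, of d] by (simp add: prod.distrib o_def)
  then show ?thesis
    unfolding signed_per_def sum_distrib_left by (intro sum.cong refl) (simp add: mult_ac)
qed

lemma signed_per_row_linear:
  fixes \<epsilon> :: "'a::comm_ring_1"
  assumes "i < n"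
  obtains K where "\<And>r. signed_per \<epsilon> n (A(i := r)) = (\<Sum>j<n. K j * r j)"
proof
  fix r
  let ?s = "\<lambda>p. if evenperm p then 1 else \<epsilon>"
  let ?P = "{p. p permutes {..<n}}"
  have "signed_per \<epsilon> n (A(i := r)) = (\<Sum>p\<in>?P. ?s p * (\<Prod>k\<in>{..<n} - {i}. A k (p k)) * r (p i))"
    unfolding signed_per_def using assms
    by (intro sum.cong refl) (simp add: prod.remove[of "{..<n}" i] mult_ac)
  also have "\<dots> = (\<Sum>j<n. \<Sum>p | p \<in> ?P \<and> p i = j. ?s p * (\<Prod>k\<in>{..<n} - {i}. A k (p k)) * r (p i))"
    by (rule sum.group[symmetric]) (use assms in \<open>auto simp: permutes_lessThan_less\<close>)
  also have "\<dots> = (\<Sum>j<n. (\<Sum>p | p \<in> ?P \<and> p i = j. ?s p * (\<Prod>k\<in>{..<n} - {i}. A k (p k))) * r j)"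
    by (simp add: sum_distrib_right)
  finally show "signed_per \<epsilon> n (A(i := r))
    = (\<Sum>j<n. (\<Sum>p | p \<in> ?P \<and> p i = j. ?s p * (\<Prod>k\<in>{..<n} - {i}. A k (p k))) * r j)" .
qed

lemma signed_per_col_linear:
  fixes \<epsilon> :: "'a::comm_ring_1"
  assumes "j < n"
  obtains K where "\<And>v. signed_per \<epsilon> n (\<lambda>i k. if k = j then v i else A i k) = (\<Sum>i<n. K i * v i)"
proof
  fix v
  let ?s = "\<lambda>p. if evenperm p then 1 else \<epsilon>"
  let ?P = "{p. p permutes {..<n}}"
  have "signed_per \<epsilon> n (\<lambda>i k. if k = j then v i else A i k)
      = (\<Sum>p\<in>?P. ?s p * (\<Prod>k\<in>{..<n} - {inv_into UNIV p j}. A k (p k)) * v (inv_into UNIV p j))"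
    unfolding signed_per_def
  proof (intro sum.cong refl)
    fix p assume p: "p \<in> ?P"
    then have p': "p permutes {..<n}" by simp
    have "inv_into UNIV p j < n"
      using permutes_lessThan_less[OF permutes_inv[OF p'] assms] .
    moreover have "p (inv_into UNIV p j) = j" "\<And>k. p k = j \<longleftrightarrow> k = inv_into UNIV p j"
      using permutes_inverses[OF p'] by auto
    ultimately show "?s p * (\<Prod>i<n. if p i = j then v i else A i (p i))
       = ?s p * (\<Prod>k\<in>{..<n} - {inv_into UNIV p j}. A k (p k)) * v (inv_into UNIV p j)"
      by (simp add: prod.remove[of "{..<n}" "inv_into UNIV p j"] mult_ac)
  qed
  also have "\<dots> = (\<Sum>i<n. \<Sum>p | p \<in> ?P \<and> inv_into UNIV p j = i. ?s p * (\<Prod>k\<in>{..<n} - {inv_into UNIV p j}. A k (p k)) * v (inv_into UNIV p j))"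
    by (rule sum.group[symmetric]) (use assms in \<open>auto simp: permutes_lessThan_less permutes_inv\<close>)
  also have "\<dots> = (\<Sum>i<n. (\<Sum>p | p \<in> ?P \<and> inv_into UNIV p j = i. ?s p * (\<Prod>k\<in>{..<n} - {i}. A k (p k))) * v i)"
    by (simp add: sum_distrib_right)
  finally show "signed_per \<epsilon> n (\<lambda>i k. if k = j then v i else A i k)
    = (\<Sum>i<n. (\<Sum>p | p \<in> ?P \<and> inv_into UNIV p j = i. ?s p * (\<Prod>k\<in>{..<n} - {i}. A k (p k))) * v i)" .
qed

lemma signed_per_swap_cols:
  fixes \<epsilon> :: "'a::comm_ring_1"
  assumes eps: "\<epsilon> * \<epsilon> = 1" and jk: "j < n" "k < n" "j \<noteq> k"
  shows "signed_per \<epsilon> n (\<lambda>i l. A i (Transposition.transpose j k l)) = \<epsilon> * signed_per \<epsilon> n A"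
proof -
  let ?t = "Transposition.transpose j k"
  let ?s = "\<lambda>p. if evenperm p then 1 else \<epsilon>"
  let ?P = "{p. p permutes {..<n}}"
  have t: "?t permutes {..<n}" using jk by (intro permutes_swap_id) auto
  have chi: "?s p = \<epsilon> * ?s (?t \<circ> p)" if "p permutes {..<n}" for p
  proof -
    have "permutation p" "permutation ?t"
      using that permutation_permutes[of p] by (auto simp: permutation_swap_id)
    then have "evenperm (?t \<circ> p) \<longleftrightarrow> \<not> evenperm p"
      using jk(3) by (simp add: evenperm_comp evenperm_swap)
    then show ?thesis using eps by simp
  qed
  have "signed_per \<epsilon> n (\<lambda>i l. A i (?t l)) = (\<Sum>p\<in>?P. \<epsilon> * (?s (?t \<circ> p) * (\<Prod>i<n. A i ((?t \<circ> p) i))))"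
    unfolding signed_per_def
  proof (intro sum.cong refl)
    fix p assume "p \<in> ?P"
    then have p: "p permutes {..<n}" by simp
    show "?s p * (\<Prod>i<n. A i (?t (p i))) = \<epsilon> * (?s (?t \<circ> p) * (\<Prod>i<n. A i ((?t \<circ> p) i)))"
      unfolding chi[OF p] by (simp only: o_apply mult.assoc)
  qed
  also have "\<dots> = \<epsilon> * (\<Sum>p\<in>?P. ?s (?t \<circ> p) * (\<Prod>i<n. A i ((?t \<circ> p) i)))"
    by (simp only: sum_distrib_left)
  also have "(\<Sum>p\<in>?P. ?s (?t \<circ> p) * (\<Prod>i<n. A i ((?t \<circ> p) i))) = signed_per \<epsilon> n A"
    unfolding signed_per_def
  proof (rule sum.reindex_bij_betw[where h="(\<circ>) ?t"])
    show "bij_betw ((\<circ>) ?t) ?P ?P"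
      by (rule bij_betw_byWitness[where f'="(\<circ>) ?t"])
         (auto simp: fun_eq_iff intro: permutes_compose[OF _ t])
  qed
  finally show ?thesis .
qed

text \<open>
  If the last row is supported on the last entry, only permutations fixing the last index contribute, and these
  are the permutations of the smaller index set, with the same parity.
\<close>

lemma signed_per_last_row:
  assumes "\<And>k. k < n \<Longrightarrow> A n k = 0"
  shows "signed_per \<epsilon> (Suc n) A = A n n * signed_per \<epsilon> n A"
proof -
  let ?s = "\<lambda>p. if evenperm p then 1 else \<epsilon>"
  have "signed_per \<epsilon> (Suc n) A = (\<Sum>p | p permutes {..<n}. ?s p * (\<Prod>i<Suc n. A i (p i)))"
    unfolding signed_per_def
  proof (rule sum.mono_neutral_right)
    show "{p. p permutes {..<n}} \<subseteq> {p. p permutes {..<Suc n}}"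
      by (auto intro: permutes_subset)
    show "\<forall>p\<in>{p. p permutes {..<Suc n}} - {p. p permutes {..<n}}. ?s p * (\<Prod>i<Suc n. A i (p i)) = 0"
    proof
      fix p assume p: "p \<in> {p. p permutes {..<Suc n}} - {p. p permutes {..<n}}"
      have "p n \<noteq> n"
      proof
        assume "p n = n"
        then have "p permutes {..<n}"
          using p permutes_superset[of p "{..<Suc n}" "{..<n}"] by (auto simp: less_Suc_eq)
        with p show False by simp
      qed
      with p have "p n < n" using permutes_lessThan_less[of p "Suc n" n] by auto
      then show "?s p * (\<Prod>i<Suc n. A i (p i)) = 0" by (simp add: assms)
    qed
  qed simp
  also have "\<dots> = A n n * signed_per \<epsilon> n A"
    unfolding signed_per_def sum_distrib_left
  proof (intro sum.cong refl)
    fix p assume "p \<in> {p. p permutes {..<n}}"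
    then have "p n = n" by (simp add: permutes_not_in)
    then show "?s p * (\<Prod>i<Suc n. A i (p i)) = A n n * (?s p * (\<Prod>i<n. A i (p i)))"
      by (simp add: mult.left_commute[of _ "A n n"] mult.commute[of _ "A n n"] split del: if_split)
  qed
  finally show ?thesis .
qed

text \<open>
  The increasing enumeration of the naturals other than \<open>j\<close>, which numbers the columns left after column
  \<open>j\<close> is deleted.
\<close>

definition skip_index :: "nat \<Rightarrow> nat \<Rightarrow> nat" where
  "skip_index j k = (if k < j then k else Suc k)"

text \<open>
  The permutations of \<open>{..n}\<close> that send \<open>n\<close> to \<open>j\<close> are the permutations of \<open>{..<n}\<close> followed by the cycle that
  moves \<open>n\<close> to \<open>j\<close> and shifts the indices from \<open>j\<close> onwards.
\<close>

lemma signed_per_one_laplace: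
  fixes A :: "nat \<Rightarrow> nat \<Rightarrow> 'a::comm_ring_1"
  shows "signed_per 1 (Suc n) A = (\<Sum>j\<le>n. A n j * signed_per 1 n (\<lambda>i k. A i (skip_index j k)))"
proof -
  let ?P = "{p. p permutes {..<Suc n}}"
  let ?Q = "{q. q permutes {..<n}}"
  define c where "c j k = (if k < n then skip_index j k else if k = n then j else k)" for j k
  have c_perm: "c j permutes {..<Suc n}" if "j \<le> n" for j
  proof (rule bij_imp_permutes)
    have "inj_on (c j) {..<Suc n}" 
      by (auto simp: inj_on_def c_def skip_index_def split: if_splits)
    moreover have "c j ` {..<Suc n} \<subseteq> {..<Suc n}"
      using that by (auto simp: c_def skip_index_def)
    ultimately show "bij_betw (c j) {..<Suc n} {..<Suc n}"
      using endo_inj_surj[of "{..<Suc n}" "c j"] by (simp add: bij_betw_def)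
  qed (auto simp: c_def)
  have "signed_per 1 (Suc n) A = (\<Sum>p\<in>?P. \<Prod>i<Suc n. A i (p i))"
    by (simp add: signed_per_def)
  also have "\<dots> = (\<Sum>j\<le>n. \<Sum>p | p \<in> ?P \<and> p n = j. \<Prod>i<Suc n. A i (p i))"
    by (rule sum.group[symmetric])
       (auto dest: permutes_lessThan_less[of _ "Suc n" n])
  also have "\<dots> = (\<Sum>j\<le>n. \<Sum>q\<in>?Q. \<Prod>i<Suc n. A i ((c j \<circ> q) i))"
  proof (rule sum.cong[OF refl])
    fix j assume "j \<in> {..n}"
    then have c: "c j permutes {..<Suc n}" by (simp add: c_perm)
    have cn: "c j n = j" by (simp add: c_def)
    have "bij_betw ((\<circ>) (c j)) ?Q {p. p \<in> ?P \<and> p n = j}"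
    proof (rule bij_betw_byWitness[where f'="(\<circ>) (inv_into UNIV (c j))"])
      show "\<forall>q\<in>?Q. inv_into UNIV (c j) \<circ> (c j \<circ> q) = q" "\<forall>p\<in>{p. p \<in> ?P \<and> p n = j}. c j \<circ> (inv_into UNIV (c j) \<circ> p) = p"
        using permutes_inverses[OF c] by (auto simp: fun_eq_iff)
      show "(\<circ>) (c j) ` ?Q \<subseteq> {p. p \<in> ?P \<and> p n = j}"
        using permutes_compose[OF _ c] permutes_subset[of _ "{..<n}" "{..<Suc n}"]
        by (auto simp: cn permutes_not_in)
      show "(\<circ>) (inv_into UNIV (c j)) ` {p. p \<in> ?P \<and> p n = j} \<subseteq> ?Q"
      proof (rule image_subsetI)
        fix p assume p: "p \<in> {p. p \<in> ?P \<and> p n = j}"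
        have "inv_into UNIV (c j) j = n" using permutes_inverses(2)[OF c, of n] cn by simp
        then have "(inv_into UNIV (c j) \<circ> p) n = n" using p by simp
        moreover have "inv_into UNIV (c j) \<circ> p permutes {..<Suc n}"
          using p permutes_compose[OF _ permutes_inv[OF c]] by auto
        ultimately have "inv_into UNIV (c j) \<circ> p permutes {..<n}"
          using permutes_superset[of "inv_into UNIV (c j) \<circ> p" "{..<Suc n}" "{..<n}"] by (auto simp: less_Suc_eq)
        then show "inv_into UNIV (c j) \<circ> p \<in> ?Q" by simp
      qed
    qed
    then show "(\<Sum>p | p \<in> ?P \<and> p n = j. \<Prod>i<Suc n. A i (p i)) = (\<Sum>q\<in>?Q. \<Prod>i<Suc n. A i ((c j \<circ> q) i))"
      by (rule sum.reindex_bij_betw[symmetric])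
  qed
  also have "\<dots> = (\<Sum>j\<le>n. A n j * signed_per 1 n (\<lambda>i k. A i (skip_index j k)))"
  proof (intro sum.cong refl)
    fix j
    have "(\<Prod>i<Suc n. A i ((c j \<circ> q) i)) = A n j * (\<Prod>i<n. A i (skip_index j (q i)))" if "q \<in> ?Q" for q
      using that permutes_lessThan_less[of q n] by (auto simp: c_def permutes_not_in mult.commute intro!: prod.cong arg_cong2[where f="(*)"])
    then show "(\<Sum>q\<in>?Q. \<Prod>i<Suc n. A i ((c j \<circ> q) i)) = A n j * signed_per 1 n (\<lambda>i k. A i (skip_index j k))"
      by (simp add: signed_per_def sum_distrib_left)
  qed
  finally show ?thesis .
qed

lemma per_eq_signed_per:
  assumes "A \<in> carrier_mat n n"
  shows "per A = signed_per 1 n (\<lambda>i j. A $$ (i, j))"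
  using assms by (simp add: per_def signed_per_def atLeast0LessThan)

lemma det_eq_signed_per:
  assumes "A \<in> carrier_mat n n"
  shows "Determinant.det A = signed_per (- 1) n (\<lambda>i j. A $$ (i, j))"
  using assms unfolding det_def'[OF assms] signed_per_def atLeast0LessThan
  by (intro sum.cong refl) (simp add: sign_def)

lemma delete_col_carrier:
  "B \<in> carrier_mat n (Suc n) \<Longrightarrow> delete_col B j \<in> carrier_mat n n"
  by (auto simp: delete_col_def)

lemma signed_per_bordered_cofactor_per:
  fixes B :: "'a::comm_ring_1 mat"
  assumes B: "B \<in> carrier_mat n (Suc n)"
  shows "signed_per 1 (Suc n) (\<lambda>i j. if i < n then B $$ (i, j) else w j) = (\<Sum>j\<le>n. w j * cofactor_per B $ j)"
proof -
  have "signed_per 1 n (\<lambda>i k. B $$ (i, skip_index j k)) = cofactor_per B $ j" if "j \<le> n" for j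
  proof -
    have "cofactor_per B $ j = per (delete_col B j)"
      using that B by (simp add: cofactor_per_def)
    also have "\<dots> = signed_per 1 n (\<lambda>i k. delete_col B j $$ (i, k))"
      by (rule per_eq_signed_per[OF delete_col_carrier[OF B]])
    also have "\<dots> = signed_per 1 n (\<lambda>i k. B $$ (i, skip_index j k))"
      by (rule signed_per_cong) (use B in \<open>simp add: delete_col_def skip_index_def\<close>)
    finally show ?thesis ..
  qed
  moreover have "signed_per 1 n (\<lambda>i k. if i < n then B $$ (i, skip_index j k) else w (skip_index j k))
      = signed_per 1 n (\<lambda>i k. B $$ (i, skip_index j k))" for j
    by (rule signed_per_cong) simp
  ultimately show ?thesis
    by (simp add: signed_per_one_laplace)
qed

text \<open>
  The border is the last row, whereas the signs of the cofactor column start with \<open>+\<close> at the first entry; the two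
  conventions differ by the sign of the corner entry.
\<close>

lemma signed_per_bordered_cofactor_det:
  fixes B :: "'a::comm_ring_1 mat"
  assumes B: "B \<in> carrier_mat n (Suc n)"
  shows "signed_per (- 1) (Suc n) (\<lambda>i j. if i < n then B $$ (i, j) else w j)
    = (- 1) ^ n * (\<Sum>j\<le>n. w j * cofactor_det B $ j)"
proof -
  define A where "A = Matrix.mat (Suc n) (Suc n) (\<lambda>(i, j). if i < n then B $$ (i, j) else w j)"
  have A: "A \<in> carrier_mat (Suc n) (Suc n)" by (simp add: A_def)
  have "signed_per (- 1) (Suc n) (\<lambda>i j. if i < n then B $$ (i, j) else w j) = Determinant.det A"
    unfolding det_eq_signed_per[OF A] by (rule signed_per_cong) (simp add: A_def)
  also have "\<dots> = (\<Sum>j<Suc n. A $$ (n, j) * Determinant.cofactor A n j)"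
    by (rule laplace_expansion_row[OF A]) simp
  also have "\<dots> = (\<Sum>j<Suc n. (- 1) ^ n * (w j * cofactor_det B $ j))"
  proof (intro sum.cong refl)
    fix j assume j: "j \<in> {..<Suc n}"
    have "mat_delete A n j = delete_col B j"
      using B j by (intro eq_matI) (auto simp: mat_delete_def A_def delete_col_def)
    then show "A $$ (n, j) * Determinant.cofactor A n j = (- 1) ^ n * (w j * cofactor_det B $ j)"
      using j B by (simp add: Determinant.cofactor_def cofactor_det_def A_def power_add mult_ac)
  qed
  finally show ?thesis
    by (simp add: lessThan_Suc_atMost sum_distrib_left)
qed

section \<open>Characteristic functions of bilinear forms in two bordered columns\<close>

lemma integrable_exp_i:
  assumes "prob_space M" "f \<in> borel_measurable M"
  shows "integrable M (\<lambda>x. exp (\<i> * complex_of_real (f x)))"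
proof -
  interpret prob_space M by fact
  note assms(2)[measurable]
  show ?thesis
    by (rule integrable_const_bound[where B=1]) auto
qed

text \<open>
  A column of \<open>n\<close> Gaussian entries with the real entry \<open>s\<close> of the border below it.
\<close>

definition border_col :: "nat \<Rightarrow> real \<Rightarrow> (nat \<Rightarrow> 'a) \<Rightarrow> nat \<Rightarrow> 'a::real_or_complex" where
  "border_col n s x i = (if i < n then x i else of_real s)"

text \<open>
  The situation after conditioning on all but two columns: \<open>D\<close> is the real part of the expansion as a function
  of the two remaining bordered columns. It is symmetric (\<open>\<delta> = 1\<close>) for the permanent and alternating
  (\<open>\<delta> = - 1\<close>) for the determinant.
\<close>

locale gaussian_column_form =
  fixes n :: nat and D :: "(nat \<Rightarrow> 'a::real_or_complex) \<Rightarrow> (nat \<Rightarrow> 'a) \<Rightarrow> real" and \<delta> :: real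
  assumes D_lin: "\<And>a b c c' d. D (\<lambda>i. a *\<^sub>R c i + b *\<^sub>R c' i) d = a * D c d + b * D c' d"
    and D_sym: "\<And>c d. D c d = \<delta> * D d c"
    and D_cong: "\<And>c c' d d'. (\<And>i. i \<le> n \<Longrightarrow> c i = c' i) \<Longrightarrow> (\<And>i. i \<le> n \<Longrightarrow> d i = d' i) \<Longrightarrow> D c d = D c' d'"
    and D_meas: "\<And>s t. (\<lambda>z. D (border_col n s (fst z)) (border_col n t (snd z))) \<in> borel_measurable
        (PiM {..<n} (\<lambda>_. gaussian) \<Otimes>\<^sub>M PiM {..<n} (\<lambda>_. gaussian))"
begin

definition V :: "(nat \<Rightarrow> 'a) measure" where "V = PiM {..<n} (\<lambda>_. gaussian)"

definition pair_char :: "real \<Rightarrow> real \<Rightarrow> complex" where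
  "pair_char s t = (\<integral>z. exp (\<i> * of_real (D (border_col n s (fst z)) (border_col n t (snd z)))) \<partial>(V \<Otimes>\<^sub>M V))"

definition self_char :: "real \<Rightarrow> complex" where
  "self_char s = (\<integral>x. exp (\<i> * of_real (D (border_col n s x) (border_col n s x) / 2)) \<partial>V)"

definition rot :: "real \<Rightarrow> real \<Rightarrow> (nat \<Rightarrow> 'a) \<times> (nat \<Rightarrow> 'a) \<Rightarrow> (nat \<Rightarrow> 'a) \<times> (nat \<Rightarrow> 'a)" where
  "rot c s = (\<lambda>(x, y). (\<lambda>i\<in>{..<n}. c *\<^sub>R x i + s *\<^sub>R y i, \<lambda>i\<in>{..<n}. c *\<^sub>R y i - s *\<^sub>R x i))"

lemma prob_space_V: "prob_space V"
  unfolding V_def by (rule prob_space_PiM_gaussian)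

lemma prob_space_VV: "prob_space (V \<Otimes>\<^sub>M V)"
  by (intro prob_space_pair prob_space_V)

lemma D_lin2: "D d (\<lambda>i. a *\<^sub>R c i + b *\<^sub>R c' i) = a * D d c + b * D d c'"
  by (subst (1 2 3) D_sym) (simp add: D_lin algebra_simps)

lemma meas_D [measurable]:
  "(\<lambda>z. D (border_col n s (fst z)) (border_col n t (snd z))) \<in> borel_measurable (V \<Otimes>\<^sub>M V)"
  unfolding V_def by (rule D_meas)

lemma meas_D_diag [measurable]: "(\<lambda>x. D (border_col n s x) (border_col n s x)) \<in> borel_measurable V"
proof -
  have "(\<lambda>x. (x, x)) \<in> V \<rightarrow>\<^sub>M V \<Otimes>\<^sub>M V" by measurable
  from measurable_compose[OF this meas_D[of s s]] show ?thesis by simp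
qed

lemma integral_rot:
  fixes f :: "_ \<Rightarrow> complex"
  assumes "c\<^sup>2 + s\<^sup>2 = 1" and f: "f \<in> borel_measurable (V \<Otimes>\<^sub>M V)"
  shows "(\<integral>z. f (rot c s z) \<partial>(V \<Otimes>\<^sub>M V)) = (\<integral>z. f z \<partial>(V \<Otimes>\<^sub>M V))"
proof -
  have R: "rot c s \<in> V \<Otimes>\<^sub>M V \<rightarrow>\<^sub>M V \<Otimes>\<^sub>M V"
    unfolding V_def rot_def case_prod_beta by (intro measurable_Pair measurable_restrict) auto
  have "distr (V \<Otimes>\<^sub>M V) (V \<Otimes>\<^sub>M V) (rot c s) = V \<Otimes>\<^sub>M V"
    unfolding V_def rot_def by (rule gaussian_vectors_rotation[OF _ assms(1)]) simp
  then show ?thesis using integral_distr[OF R f] by simp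
qed

lemma border_col_rot:
  assumes "i \<le> n"
  shows "border_col n (c * a + s * b) (fst (rot c s z)) i = c *\<^sub>R border_col n a (fst z) i + s *\<^sub>R border_col n b (snd z) i"
    and "border_col n (c * b - s * a) (snd (rot c s z)) i = c *\<^sub>R border_col n b (snd z) i + (- s) *\<^sub>R border_col n a (fst z) i"
  using assms by (auto simp: border_col_def rot_def case_prod_beta scaleR_conv_of_real)

text \<open>
  The rotation acts on the bordered columns as a whole, borders \<open>a\<close> and \<open>b\<close> included. As these are real, some
  rotation annihilates one of them.
\<close>

lemma D_rot:
  "D (border_col n (c * a + s * b) (fst (rot c s z))) (border_col n (c * b - s * a) (snd (rot c s z))) =
    c\<^sup>2 * D (border_col n a (fst z)) (border_col n b (snd z)) - s\<^sup>2 * D (border_col n b (snd z)) (border_col n a (fst z))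
    + c * s * (D (border_col n b (snd z)) (border_col n b (snd z)) - D (border_col n a (fst z)) (border_col n a (fst z)))"
proof -
  let ?A = "border_col n a (fst z)" and ?B = "border_col n b (snd z)"
  have "D (border_col n (c * a + s * b) (fst (rot c s z))) (border_col n (c * b - s * a) (snd (rot c s z)))
    = D (\<lambda>i. c *\<^sub>R ?A i + s *\<^sub>R ?B i) (\<lambda>i. c *\<^sub>R ?B i + (- s) *\<^sub>R ?A i)"
    by (intro D_cong border_col_rot)
  also have "\<dots> = c\<^sup>2 * D ?A ?B - s\<^sup>2 * D ?B ?A + c * s * (D ?B ?B - D ?A ?A)"
    unfolding D_lin D_lin2 by (simp add: power2_eq_square algebra_simps)
  finally show ?thesis .
qed

lemma D_rot_diag:
  assumes cs: "c\<^sup>2 + s\<^sup>2 = 1"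
  shows "D (border_col n (c * a + s * b) (fst (rot c s z))) (border_col n (c * a + s * b) (fst (rot c s z)))
     + D (border_col n (c * b - s * a) (snd (rot c s z))) (border_col n (c * b - s * a) (snd (rot c s z)))
     = D (border_col n a (fst z)) (border_col n a (fst z)) + D (border_col n b (snd z)) (border_col n b (snd z))"
proof -
  let ?A = "border_col n a (fst z)" and ?B = "border_col n b (snd z)"
  have 1: "D (border_col n (c * a + s * b) (fst (rot c s z))) (border_col n (c * a + s * b) (fst (rot c s z)))
    = D (\<lambda>i. c *\<^sub>R ?A i + s *\<^sub>R ?B i) (\<lambda>i. c *\<^sub>R ?A i + s *\<^sub>R ?B i)"
    by (intro D_cong border_col_rot)
  have 2: "D (border_col n (c * b - s * a) (snd (rot c s z))) (border_col n (c * b - s * a) (snd (rot c s z)))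
    = D (\<lambda>i. c *\<^sub>R ?B i + (- s) *\<^sub>R ?A i) (\<lambda>i. c *\<^sub>R ?B i + (- s) *\<^sub>R ?A i)"
    by (intro D_cong border_col_rot)
  have "D (\<lambda>i. c *\<^sub>R ?A i + s *\<^sub>R ?B i) (\<lambda>i. c *\<^sub>R ?A i + s *\<^sub>R ?B i)
    + D (\<lambda>i. c *\<^sub>R ?B i + (- s) *\<^sub>R ?A i) (\<lambda>i. c *\<^sub>R ?B i + (- s) *\<^sub>R ?A i)
    = (c\<^sup>2 + s\<^sup>2) * (D ?A ?A + D ?B ?B)"
    unfolding D_lin D_lin2 by (simp add: power2_eq_square algebra_simps)
  then show ?thesis unfolding 1 2 cs by simp
qed

lemma normalized_pair:
  fixes a b :: real
  assumes "r = sqrt (a\<^sup>2 + b\<^sup>2)"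
  obtains c s where "c\<^sup>2 + s\<^sup>2 = 1" "c * a + s * b = r" "c * b - s * a = 0"
proof (cases "r = 0")
  case True
  then have "a = 0" "b = 0" using assms by (auto simp: sum_power2_eq_zero_iff)
  then show ?thesis using True that[of 1 0] by simp
next
  case False
  have r2: "a\<^sup>2 + b\<^sup>2 = r\<^sup>2" by (simp add: assms)
  have "(a / r)\<^sup>2 + (b / r)\<^sup>2 = (a\<^sup>2 + b\<^sup>2) / r\<^sup>2" "(a / r) * a + (b / r) * b = (a\<^sup>2 + b\<^sup>2) / r"
    by (simp_all add: power_divide add_divide_distrib power2_eq_square)
  then have "(a / r)\<^sup>2 + (b / r)\<^sup>2 = 1" "(a / r) * a + (b / r) * b = r" "(a / r) * b - (b / r) * a = 0"
    using False by (simp_all only: r2) (simp_all add: power2_eq_square)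
  then show ?thesis by (rule that)
qed

text \<open>
  An alternating form in two columns is multiplied by the determinant of any linear map that mixes the
  columns, hence is preserved by rotations.
\<close>

lemma pair_char_antisymmetric:
  assumes "\<delta> = - 1" and r: "r = sqrt (a\<^sup>2 + b\<^sup>2)"
  shows "pair_char a b = pair_char r 0"
proof -
  obtain c s where cs: "c\<^sup>2 + s\<^sup>2 = 1" "c * a + s * b = r" "c * b - s * a = 0"
    by (rule normalized_pair[OF r])
  have diag: "D d d = 0" for d using D_sym[of d d] assms(1) by simp
  have "pair_char r 0 = (\<integral>z. exp (\<i> * of_real (D (border_col n r (fst (rot c s z))) (border_col n 0 (snd (rot c s z))))) \<partial>(V \<Otimes>\<^sub>M V))"
    unfolding pair_char_def by (rule integral_rot[OF cs(1), symmetric]) measurable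
  also have "\<dots> = pair_char a b"
    unfolding pair_char_def
  proof (intro Bochner_Integration.integral_cong refl)
    fix z :: "(nat \<Rightarrow> 'a) \<times> (nat \<Rightarrow> 'a)"
    let ?A = "border_col n a (fst z)" and ?B = "border_col n b (snd z)"
    have "D (border_col n r (fst (rot c s z))) (border_col n 0 (snd (rot c s z))) = (c\<^sup>2 + s\<^sup>2) * D ?A ?B"
      using D_rot[of c a s b z, unfolded cs] D_sym[of ?B ?A] assms(1)
      by (simp add: diag distrib_right)
    then show "exp (\<i> * complex_of_real (D (border_col n r (fst (rot c s z))) (border_col n 0 (snd (rot c s z)))))
       = exp (\<i> * complex_of_real (D ?A ?B))" by (simp add: cs)
  qed
  finally show ?thesis ..
qed

lemma integral_pair_times:
  fixes f g :: "_ \<Rightarrow> complex"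
  assumes "integrable V f" "integrable V g"
  shows "(\<integral>z. f (fst z) * g (snd z) \<partial>(V \<Otimes>\<^sub>M V)) = (\<integral>x. f x \<partial>V) * (\<integral>x. g x \<partial>V)"
proof -
  interpret prob_space V by (rule prob_space_V)
  interpret pair_sigma_finite V V ..
  have "integrable (V \<Otimes>\<^sub>M V) (\<lambda>z. f (fst z) * g (snd z))"
  proof (rule Fubini_integrable)
    show "(\<lambda>z. f (fst z) * g (snd z)) \<in> borel_measurable (V \<Otimes>\<^sub>M V)"
      using assms[THEN borel_measurable_integrable] by measurable
  qed (use assms in \<open>auto simp: norm_mult\<close>)
  from integral_fst'[OF this] show ?thesis using assms by simp
qed

lemma integrable_self_char:
  "integrable V (\<lambda>x. exp (\<i> * complex_of_real (D (border_col n s x) (border_col n s x) / 2)))"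
  by (intro integrable_exp_i prob_space_V) measurable

text \<open>
  By polarization a symmetric form is half the difference of two values of its quadratic form, evaluated at columns
  that are independent after a rotation by 45 degrees.
\<close>

lemma pair_char_symmetric_factor:
  assumes "\<delta> = 1"
  shows "pair_char a b = cnj (self_char ((a - b) / sqrt 2)) * self_char ((a + b) / sqrt 2)"
proof -
  \<comment> \<open>cosine and sine of 45 degrees; the rotation takes borders \<open>(p, q)\<close> to \<open>(a, b)\<close>\<close>
  define c where "c = 1 / sqrt 2"
  define p q where "p = (a - b) / sqrt 2" and "q = (a + b) / sqrt 2"
  have cc: "c\<^sup>2 + c\<^sup>2 = 1" "c * c = 1 / 2" by (simp_all add: c_def power_divide)
  have ab: "c * p + c * q = a" "c * q - c * p = b"
    by (simp_all add: c_def p_def q_def field_simps)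
  have "pair_char a b = (\<integral>z. exp (\<i> * of_real (D (border_col n a (fst (rot c c z))) (border_col n b (snd (rot c c z))))) \<partial>(V \<Otimes>\<^sub>M V))"
    unfolding pair_char_def by (rule integral_rot[OF cc(1), symmetric]) measurable
  also have "\<dots> = (\<integral>z. cnj (exp (\<i> * of_real (D (border_col n p (fst z)) (border_col n p (fst z)) / 2)))
       * exp (\<i> * of_real (D (border_col n q (snd z)) (border_col n q (snd z)) / 2)) \<partial>(V \<Otimes>\<^sub>M V))"
  proof (intro Bochner_Integration.integral_cong refl)
    fix z :: "(nat \<Rightarrow> 'a) \<times> (nat \<Rightarrow> 'a)"
    let ?A = "border_col n p (fst z)" and ?B = "border_col n q (snd z)"
    have "D (border_col n a (fst (rot c c z))) (border_col n b (snd (rot c c z))) = - (D ?A ?A / 2) + D ?B ?B / 2"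
      using D_rot[of c p c q z] D_sym[of ?B ?A] assms by (simp add: ab cc)
    then show "exp (\<i> * complex_of_real (D (border_col n a (fst (rot c c z))) (border_col n b (snd (rot c c z)))))
      = cnj (exp (\<i> * of_real (D ?A ?A / 2))) * exp (\<i> * of_real (D ?B ?B / 2))"
      by (simp only:) (simp add: exp_cnj exp_add[symmetric] algebra_simps)
  qed
  also have "\<dots> = (\<integral>x. cnj (exp (\<i> * of_real (D (border_col n p x) (border_col n p x) / 2))) \<partial>V) * self_char q"
    unfolding self_char_def using integrable_self_char integrable_self_char[THEN integrable_cnj]
    by (intro integral_pair_times)
  also have "(\<integral>x. cnj (exp (\<i> * of_real (D (border_col n p x) (border_col n p x) / 2))) \<partial>V) = cnj (self_char p)"
    unfolding self_char_def by (rule Bochner_Integration.integral_cnj)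
  finally show ?thesis by (simp add: p_def q_def)
qed

text \<open>
  The product is the expectation of \<open>exp (\<i> * (D C C + D E E) / 2)\<close> for independent bordered columns
  \<open>C\<close> and \<open>E\<close>. This sum is invariant under rotations, which may turn the borders \<open>(a, b)\<close> into \<open>(r, 0)\<close>.
\<close>

lemma self_char_mult:
  assumes r: "r = sqrt (a\<^sup>2 + b\<^sup>2)"
  shows "self_char a * self_char b = self_char r * self_char 0"
proof -
  obtain c s where cs: "c\<^sup>2 + s\<^sup>2 = 1" "c * a + s * b = r" "c * b - s * a = 0"
    by (rule normalized_pair[OF r])
  have FF: "self_char p * self_char q = (\<integral>z. exp (\<i> * of_real ((D (border_col n p (fst z)) (border_col n p (fst z))
      + D (border_col n q (snd z)) (border_col n q (snd z))) / 2)) \<partial>(V \<Otimes>\<^sub>M V))" for p q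
    unfolding self_char_def by (subst integral_pair_times[OF integrable_self_char integrable_self_char, symmetric])
      (intro Bochner_Integration.integral_cong refl,
       simp add: exp_add[symmetric] ring_distribs add_divide_distrib)
  have "self_char r * self_char 0 = (\<integral>z. exp (\<i> * of_real ((D (border_col n r (fst (rot c s z))) (border_col n r (fst (rot c s z)))
      + D (border_col n 0 (snd (rot c s z))) (border_col n 0 (snd (rot c s z)))) / 2)) \<partial>(V \<Otimes>\<^sub>M V))"
    unfolding FF by (rule integral_rot[OF cs(1), symmetric]) measurable
  also have "\<dots> = self_char a * self_char b"
    unfolding FF using D_rot_diag[OF cs(1), of a b] by (simp add: cs)
  finally show ?thesis ..
qed

text \<open>
  The factors of \<open>pair_char a b\<close> and of \<open>pair_char r 0\<close> have borders with the same sum of squares, so the moduli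
  agree by \<open>self_char_mult\<close>; and \<open>pair_char r 0\<close> is a product \<open>cnj w * w\<close>.
\<close>

lemma pair_char_symmetric:
  assumes "\<delta> = 1" and r: "r = sqrt (a\<^sup>2 + b\<^sup>2)"
  shows "pair_char r 0 = of_real (norm (pair_char a b))"
proof -
  have 1: "sqrt (((a - b) / sqrt 2)\<^sup>2 + ((a + b) / sqrt 2)\<^sup>2) = r"
    by (simp add: r power_divide power2_eq_square field_simps)
  have 2: "sqrt ((r / sqrt 2)\<^sup>2 + (r / sqrt 2)\<^sup>2) = r"
    by (simp add: r power_divide)
  have "norm (pair_char a b) = norm (self_char ((a - b) / sqrt 2) * self_char ((a + b) / sqrt 2))"
    by (simp add: pair_char_symmetric_factor[OF assms(1)] norm_mult)
  also have "\<dots> = norm (self_char (r / sqrt 2) * self_char (r / sqrt 2))"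
    by (subst self_char_mult[OF 1[symmetric]], subst self_char_mult[OF 2[symmetric]]) (rule refl)
  also have "\<dots> = (norm (self_char (r / sqrt 2)))\<^sup>2"
    by (simp add: norm_mult power2_eq_square)
  finally show ?thesis
    using complex_norm_square[of "self_char (r / sqrt 2)"]
    by (simp add: pair_char_symmetric_factor[OF assms(1)] mult.commute)
qed

end

section \<open>Characteristic functions of bordered Gaussian matrices\<close>

definition bordered :: "nat \<Rightarrow> (nat \<times> nat \<Rightarrow> 'a) \<Rightarrow> (nat \<Rightarrow> 'a) \<Rightarrow> nat \<Rightarrow> nat \<Rightarrow> 'a" where
  "bordered n x z i j = (if i < n then x (i, j) else z j)"

text \<open>
  The central object: the characteristic function at \<open>z\<close>, up to conjugation and sign, of the permanental or
  determinantal cofactor column of an \<open>n \<times> (n + 1)\<close> Gaussian matrix.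
\<close>

definition border_char :: "'a \<Rightarrow> nat \<Rightarrow> (nat \<Rightarrow> 'a::real_or_complex) \<Rightarrow> complex" where
  "border_char \<epsilon> n z = (\<integral>x. exp (\<i> * of_real (re_part (signed_per \<epsilon> (Suc n) (bordered n x z))))
     \<partial>PiM ({..<n} \<times> {..n}) (\<lambda>_. gaussian))"

lemma borel_measurable_re_signed_per:
  fixes A :: "'w \<Rightarrow> nat \<Rightarrow> nat \<Rightarrow> 'a::real_or_complex"
  assumes "\<And>i j. i < n \<Longrightarrow> j < n \<Longrightarrow> (\<lambda>\<omega>. A \<omega> i j) \<in> borel_measurable M"
  shows "(\<lambda>\<omega>. re_part (signed_per \<epsilon> n (A \<omega>))) \<in> borel_measurable M"
  by (rule measurable_compose[OF borel_measurable_signed_per[OF assms] borel_measurable_re_part])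

lemma measurable_gaussian_component:
  "i \<in> I \<Longrightarrow> (\<lambda>x. x i) \<in> borel_measurable (PiM I (\<lambda>_. gaussian :: 'a::euclidean_space measure))"
  using measurable_component_singleton[of i I "\<lambda>_. gaussian :: 'a measure"]
  by (simp cong: measurable_cong_sets)

lemma measurable_gaussian_component2:
  assumes "i \<in> I" "j \<in> J"
  shows "(\<lambda>X. X i j) \<in> borel_measurable (PiM I (\<lambda>_. PiM J (\<lambda>_. gaussian :: 'a::euclidean_space measure)))"
  by (rule measurable_compose[OF measurable_component_singleton[OF assms(1)] measurable_gaussian_component[OF assms(2)]])

lemma measurable_bordered:
  fixes z :: "nat \<Rightarrow> 'a::real_or_complex"
  shows "(\<lambda>x. re_part (signed_per \<epsilon> (Suc n) (bordered n x z))) \<in> borel_measurable (PiM ({..<n} \<times> {..n}) (\<lambda>_. gaussian))"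
proof (rule borel_measurable_re_signed_per)
  fix i j assume "i < Suc n" "j < Suc n"
  then show "(\<lambda>x. bordered n x z i j) \<in> borel_measurable (PiM ({..<n} \<times> {..n}) (\<lambda>_. gaussian))"
    by (cases "i < n") (auto simp: bordered_def intro!: measurable_gaussian_component)
qed

lemma border_char_rows:
  "border_char \<epsilon> n z = (\<integral>X. exp (\<i> * of_real (re_part (signed_per \<epsilon> (Suc n) (\<lambda>i j. if i < n then X i j else z j))))
     \<partial>PiM {..<n} (\<lambda>_. PiM {..n} (\<lambda>_. gaussian)))"
proof -
  let ?t = "\<lambda>X. \<lambda>(i, j)\<in>{..<n} \<times> {..n}. X i j"
  have "border_char \<epsilon> n z = (\<integral>X. exp (\<i> * of_real (re_part (signed_per \<epsilon> (Suc n) (bordered n (?t X) z))))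
     \<partial>PiM {..<n} (\<lambda>_. PiM {..n} (\<lambda>_. gaussian)))"
    unfolding border_char_def
    by (rule integral_PiM_rows[OF prob_space_gaussian])
       (use measurable_bordered[of \<epsilon> n z] in measurable)
  also have "\<dots> = (\<integral>X. exp (\<i> * of_real (re_part (signed_per \<epsilon> (Suc n) (\<lambda>i j. if i < n then X i j else z j))))
     \<partial>PiM {..<n} (\<lambda>_. PiM {..n} (\<lambda>_. gaussian)))"
    by (intro Bochner_Integration.integral_cong refl arg_cong[where f="\<lambda>w. exp (\<i> * of_real (re_part w))"] signed_per_cong)
       (simp add: bordered_def)
  finally show ?thesis .
qed

lemma border_char_cols:
  "border_char \<epsilon> n z = (\<integral>Y. exp (\<i> * of_real (re_part (signed_per \<epsilon> (Suc n) (\<lambda>i j. if i < n then Y j i else z j))))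
     \<partial>PiM {..n} (\<lambda>_. PiM {..<n} (\<lambda>_. gaussian)))"
proof -
  let ?t = "\<lambda>Y. \<lambda>(i, j)\<in>{..<n} \<times> {..n}. Y j i"
  have "border_char \<epsilon> n z = (\<integral>Y. exp (\<i> * of_real (re_part (signed_per \<epsilon> (Suc n) (bordered n (?t Y) z))))
     \<partial>PiM {..n} (\<lambda>_. PiM {..<n} (\<lambda>_. gaussian)))"
    unfolding border_char_def
    by (rule integral_PiM_cols[OF prob_space_gaussian])
       (use measurable_bordered[of \<epsilon> n z] in measurable)
  also have "\<dots> = (\<integral>Y. exp (\<i> * of_real (re_part (signed_per \<epsilon> (Suc n) (\<lambda>i j. if i < n then Y j i else z j))))
     \<partial>PiM {..n} (\<lambda>_. PiM {..<n} (\<lambda>_. gaussian)))"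
    by (intro Bochner_Integration.integral_cong refl arg_cong[where f="\<lambda>w. exp (\<i> * of_real (re_part w))"] signed_per_cong)
       (simp add: bordered_def)
  finally show ?thesis .
qed

lemma border_char_cong:
  assumes "\<And>j. j \<le> n \<Longrightarrow> z j = z' j"
  shows "border_char \<epsilon> n z = border_char \<epsilon> n z'"
  unfolding border_char_def
  by (intro Bochner_Integration.integral_cong refl arg_cong[where f="\<lambda>w. exp (\<i> * of_real (re_part w))"] signed_per_cong)
     (simp add: bordered_def assms)

text \<open>
  Multiplying the bordered columns by unit scalars changes the expansion by the product \<open>C\<close> of these scalars, and
  this product can be undone in one Gaussian row. The Gaussian entries absorb all these factors.
\<close>

lemma border_char_eq_if_norm_eq:
  fixes z z' :: "nat \<Rightarrow> 'a::real_or_complex"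
  assumes n: "n \<ge> 1" and norm: "\<And>j. j \<le> n \<Longrightarrow> norm (z j) = norm (z' j)"
  shows "border_char \<epsilon> n z = border_char \<epsilon> n z'"
proof -
  define e where "e j = (if z' j = 0 then 1 else z j / z' j)" for j
  have e: "norm (e j) = 1" "z j = e j * z' j" if "j \<le> n" for j
    using norm[OF that] by (auto simp: e_def norm_divide)
  define C where "C = (\<Prod>j<Suc n. e j)"
  \<comment> \<open>row 0 is a Gaussian row because \<open>n \<ge> 1\<close>\<close>
  define c where "c i = (if i = 0 then C else 1)" for i :: nat
  define d where "d j = inverse (e j)" for j
  define u where "u = (\<lambda>(i, j). c i * d j)"
  have normC: "norm C = 1"
    unfolding C_def prod_norm[symmetric] by (rule prod.neutral) (simp add: e)
  have u: "norm (u k) = 1" if "k \<in> {..<n} \<times> {..n}" for k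
    using that by (auto simp: u_def c_def d_def norm_mult norm_inverse e normC)
  let ?M = "PiM ({..<n} \<times> {..n}) (\<lambda>_. gaussian :: 'a measure)"
  let ?t = "\<lambda>x. \<lambda>k\<in>{..<n} \<times> {..n}. u k * x k"
  have t: "?t \<in> ?M \<rightarrow>\<^sub>M ?M"
    by (rule measurable_restrict) measurable
  have "border_char \<epsilon> n z' = (\<integral>x. exp (\<i> * of_real (re_part (signed_per \<epsilon> (Suc n) (bordered n (?t x) z')))) \<partial>?M)"
  proof -
    have "(\<lambda>x. exp (\<i> * of_real (re_part (signed_per \<epsilon> (Suc n) (bordered n x z'))))) \<in> borel_measurable ?M"
      using measurable_bordered[of \<epsilon> n z'] by measurable
    from integral_distr[OF t this] show ?thesis
      by (simp only: border_char_def gaussian_family_phase[OF finite_cartesian_product u] finite_lessThan finite_atMost)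
  qed
  also have "\<dots> = border_char \<epsilon> n z"
    unfolding border_char_def
  proof (intro Bochner_Integration.integral_cong refl)
    fix x
    have "signed_per \<epsilon> (Suc n) (bordered n (?t x) z') = signed_per \<epsilon> (Suc n) (\<lambda>i j. c i * d j * bordered n x z i j)"
    proof (rule signed_per_cong)
      fix i j assume "i < Suc n" "j < Suc n"
      moreover from this have "e j \<noteq> 0" using e(1)[of j] by auto
      ultimately show "bordered n (?t x) z' i j = c i * d j * bordered n x z i j"
        using n by (auto simp: bordered_def u_def c_def d_def e(2))
    qed
    also have "\<dots> = (\<Prod>i<Suc n. c i) * (\<Prod>j<Suc n. d j) * signed_per \<epsilon> (Suc n) (bordered n x z)"
      by (rule signed_per_scale)
    also have "(\<Prod>i<Suc n. c i) = C"
      by (simp add: c_def)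
    also have "(\<Prod>j<Suc n. d j) = inverse C"
      unfolding C_def d_def by (rule prod_inversef[unfolded o_def])
    also have "C * inverse C = 1" using normC by (metis norm_zero right_inverse zero_neq_one)
    finally show "exp (\<i> * of_real (re_part (signed_per \<epsilon> (Suc n) (bordered n (?t x) z'))))
      = exp (\<i> * of_real (re_part (signed_per \<epsilon> (Suc n) (bordered n x z))))" by (simp only: mult_1)
  qed
  finally show ?thesis ..
qed

text \<open>
  Conditionally on the other rows the expansion is a linear form in the last Gaussian row, and the characteristic
  function of a Gaussian row is a real exponential.
\<close>

lemma border_char_nonneg:
  fixes z :: "nat \<Rightarrow> 'a::real_or_complex"
  assumes "n \<ge> 1"
  obtains r where "r \<ge> 0" "border_char \<epsilon> n z = of_real r"
proof -
  obtain m where n: "n = Suc m" using assms by (cases n) auto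
  let ?R = "PiM {..n} (\<lambda>_. gaussian :: 'a measure)"
  let ?f = "\<lambda>X. exp (\<i> * of_real (re_part (signed_per \<epsilon> (Suc n) (\<lambda>i j. if i < n then X i j else z j))))"
  interpret R: prob_space ?R by (rule prob_space_PiM_gaussian)
  interpret P: product_sigma_finite "\<lambda>_::nat. ?R" ..
  have "border_char \<epsilon> n z = integral\<^sup>L (PiM (insert m {..<m}) (\<lambda>_. ?R)) ?f"
    unfolding border_char_rows n by (simp add: lessThan_Suc)
  also have "\<dots> = (\<integral>X. (\<integral>g. ?f (X(m := g)) \<partial>?R) \<partial>PiM {..<m} (\<lambda>_. ?R))"
  proof (rule P.product_integral_insert)
    show "integrable (PiM (insert m {..<m}) (\<lambda>_. ?R)) ?f"
    proof (intro integrable_exp_i prob_space_PiM prob_space_gaussian borel_measurable_re_signed_per)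
      fix i j assume "i < Suc n" "j < Suc n"
      then show "(\<lambda>X. if i < n then X i j else z j) \<in> borel_measurable (PiM (insert m {..<m}) (\<lambda>_. ?R))"
        by (cases "i < n") (auto intro!: measurable_gaussian_component2 simp: n)
    qed
  qed auto
  finally have eq: "border_char \<epsilon> n z = (\<integral>X. (\<integral>g. ?f (X(m := g)) \<partial>?R) \<partial>PiM {..<m} (\<lambda>_. ?R))" .
  have "\<exists>r\<ge>0. (\<integral>g. ?f (X(m := g)) \<partial>?R) = complex_of_real r" for X
  proof -
    let ?A = "\<lambda>i j. if i < n then X i j else z j"
    have "m < Suc n" by (simp add: n)
    from signed_per_row_linear[OF this, of \<epsilon> ?A]
    obtain K where K: "\<And>r. signed_per \<epsilon> (Suc n) (?A(m := r)) = (\<Sum>j<Suc n. K j * r j)" by blast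
    have "(\<lambda>i j. if i < n then (X(m := g)) i j else z j) = ?A(m := g)" for g
      by (auto simp: fun_eq_iff n)
    then have "(\<integral>g. ?f (X(m := g)) \<partial>?R) = (\<integral>g. exp (\<i> * of_real (re_part (\<Sum>j\<le>n. K j * g j))) \<partial>?R)"
      by (simp only: K lessThan_Suc_atMost)
    also have "\<dots> = complex_of_real (exp (- ((\<Sum>j\<le>n. (norm (K j))\<^sup>2) / (2 * real DIM('a)))))"
      by (rule gaussian_char_linear_form) simp
    finally show ?thesis by (meson exp_ge_zero)
  qed
  then obtain h where h: "\<And>X. h X \<ge> 0" "\<And>X. (\<integral>g. ?f (X(m := g)) \<partial>?R) = complex_of_real (h X)"
    by metis
  have "border_char \<epsilon> n z = of_real (\<integral>X. h X \<partial>PiM {..<m} (\<lambda>_. ?R))"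
    unfolding eq h(2) by simp
  moreover have "(\<integral>X. h X \<partial>PiM {..<m} (\<lambda>_. ?R)) \<ge> 0"
    by (rule Bochner_Integration.integral_nonneg) (rule h)
  ultimately show ?thesis using that by blast
qed

definition column_form ::
  "'a \<Rightarrow> nat \<Rightarrow> nat \<Rightarrow> (nat \<Rightarrow> nat \<Rightarrow> 'a::real_or_complex) \<Rightarrow> (nat \<Rightarrow> 'a) \<Rightarrow> (nat \<Rightarrow> 'a) \<Rightarrow> (nat \<Rightarrow> 'a) \<Rightarrow> real" where
  "column_form \<epsilon> n j Y z c d = re_part (signed_per \<epsilon> (Suc n)
     (\<lambda>i k. if k = n then c i else if k = j then d i else if i < n then Y k i else z k))"

lemma gaussian_column_form:
  fixes z :: "nat \<Rightarrow> 'a::real_or_complex"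
  assumes j: "j < n" and delta: "\<delta> * \<delta> = 1"
  shows "gaussian_column_form n (column_form (of_real \<delta>) n j Y z) \<delta>"
proof
  fix a b :: real and c c' d :: "nat \<Rightarrow> 'a"
  let ?A = "\<lambda>i k. if k = j then d i else if i < n then Y k i else z k"
  have "n < Suc n" by simp
  from signed_per_col_linear[OF this, of "of_real \<delta>" ?A]
  obtain K where K: "\<And>v. signed_per (of_real \<delta>) (Suc n) (\<lambda>i k. if k = n then v i else ?A i k) = (\<Sum>i<Suc n. K i * v i)"
    by blast
  show "column_form (of_real \<delta>) n j Y z (\<lambda>i. a *\<^sub>R c i + b *\<^sub>R c' i) d
     = a * column_form (of_real \<delta>) n j Y z c d + b * column_form (of_real \<delta>) n j Y z c' d"
    unfolding column_form_def K
    by (simp only: distrib_left sum.distrib mult_scaleR_right scaleR_sum_right[symmetric] re_part_add re_part_scaleR)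
next
  fix c d :: "nat \<Rightarrow> 'a"
  have "signed_per (of_real \<delta>) (Suc n) (\<lambda>i k. if k = n then c i else if k = j then d i else if i < n then Y k i else z k)
     = signed_per (of_real \<delta>) (Suc n) (\<lambda>i k. (\<lambda>i k. if k = n then d i else if k = j then c i else if i < n then Y k i else z k)
          i (Transposition.transpose j n k))"
    using j by (intro arg_cong[where f="signed_per (of_real \<delta>) (Suc n)"] ext) (auto simp: Transposition.transpose_def)
  also have "\<dots> = of_real \<delta> * signed_per (of_real \<delta>) (Suc n) (\<lambda>i k. if k = n then d i else if k = j then c i else if i < n then Y k i else z k)"
    using j delta by (intro signed_per_swap_cols) (auto simp flip: of_real_mult)
  finally show "column_form (of_real \<delta>) n j Y z c d = \<delta> * column_form (of_real \<delta>) n j Y z d c"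
    by (simp add: column_form_def re_part_of_real_mult)
next
  fix c c' d d' :: "nat \<Rightarrow> 'a"
  assume "\<And>i. i \<le> n \<Longrightarrow> c i = c' i" "\<And>i. i \<le> n \<Longrightarrow> d i = d' i"
  then show "column_form (of_real \<delta>) n j Y z c d = column_form (of_real \<delta>) n j Y z c' d'"
    unfolding column_form_def by (intro arg_cong[where f=re_part] signed_per_cong) auto
next
  fix s t :: real
  let ?VV = "PiM {..<n} (\<lambda>_. gaussian :: 'a measure) \<Otimes>\<^sub>M PiM {..<n} (\<lambda>_. gaussian)"
  have comp: "(\<lambda>p. border_col n s (fst p) i) \<in> borel_measurable ?VV" "(\<lambda>p. border_col n t (snd p) i) \<in> borel_measurable ?VV" for i
  proof -
    have "(\<lambda>p. fst p i) \<in> borel_measurable ?VV" "(\<lambda>p. snd p i) \<in> borel_measurable ?VV" if "i < n"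
      using measurable_gaussian_component[of i "{..<n}"] that
      by (auto intro: measurable_compose[OF measurable_fst] measurable_compose[OF measurable_snd])
    then show "(\<lambda>p. border_col n s (fst p) i) \<in> borel_measurable ?VV" "(\<lambda>p. border_col n t (snd p) i) \<in> borel_measurable ?VV"
      by (cases "i < n"; simp add: border_col_def)+
  qed
  show "(\<lambda>p. column_form (of_real \<delta>) n j Y z (border_col n s (fst p)) (border_col n t (snd p))) \<in> borel_measurable ?VV"
    unfolding column_form_def
  proof (rule borel_measurable_re_signed_per)
    fix i k
    show "(\<lambda>p. if k = n then border_col n s (fst p) i else if k = j then border_col n t (snd p) i else if i < n then Y k i else z k)
      \<in> borel_measurable ?VV"
      using comp by (cases "k = n"; cases "k = j") auto
  qed
qed

text \<open>
  Conditioning on all columns other than \<open>j\<close> and the last.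
\<close>

lemma border_char_eq_integral_pair_char:
  fixes z :: "nat \<Rightarrow> 'a::real_or_complex"
  assumes j: "j < n" and delta: "\<delta> * \<delta> = 1" and z: "z n = of_real a" "z j = of_real b"
  shows "border_char (of_real \<delta>) n z = (\<integral>Y. gaussian_column_form.pair_char n (column_form (of_real \<delta>) n j Y z) a b
     \<partial>PiM ({..n} - {j, n}) (\<lambda>_. PiM {..<n} (\<lambda>_. gaussian)))"
proof -
  let ?V = "PiM {..<n} (\<lambda>_. gaussian :: 'a measure)"
  let ?K = "{..n} - {j, n}"
  let ?f = "\<lambda>Y. exp (\<i> * of_real (re_part (signed_per (of_real \<delta>) (Suc n) (\<lambda>i k. if i < n then Y k i else z k))))"
  interpret V: prob_space ?V by (rule prob_space_PiM_gaussian)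
  interpret P: product_sigma_finite "\<lambda>_::nat. ?V" ..
  interpret pair_sigma_finite ?V ?V ..
  have ins: "insert j (insert n ?K) = {..n}" using j by auto
  have meas: "?f \<in> borel_measurable (PiM {..n} (\<lambda>_. ?V))" and int: "integrable (PiM {..n} (\<lambda>_. ?V)) ?f"
  proof -
    have "(\<lambda>Y. re_part (signed_per (of_real \<delta>) (Suc n) (\<lambda>i k. if i < n then Y k i else z k))) \<in> borel_measurable (PiM {..n} (\<lambda>_. ?V))"
    proof (rule borel_measurable_re_signed_per)
      fix i k assume "i < Suc n" "k < Suc n"
      then show "(\<lambda>Y. if i < n then Y k i else z k) \<in> borel_measurable (PiM {..n} (\<lambda>_. ?V))"
        by (cases "i < n") (auto intro!: measurable_gaussian_component2)
    qed
    then show "integrable (PiM {..n} (\<lambda>_. ?V)) ?f"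
      by (intro integrable_exp_i prob_space_PiM prob_space_gaussian)
    then show "?f \<in> borel_measurable (PiM {..n} (\<lambda>_. ?V))" by simp
  qed
  have "border_char (of_real \<delta>) n z = integral\<^sup>L (PiM (insert j (insert n ?K)) (\<lambda>_. ?V)) ?f"
    unfolding border_char_cols ins ..
  also have "\<dots> = (\<integral>X. (\<integral>y. ?f (X(j := y)) \<partial>?V) \<partial>PiM (insert n ?K) (\<lambda>_. ?V))"
    by (rule P.product_integral_insert) (use j int in \<open>auto simp: ins\<close>)
  also have "\<dots> = (\<integral>Y. (\<integral>x. (\<integral>y. ?f (Y(n := x, j := y)) \<partial>?V) \<partial>?V) \<partial>PiM ?K (\<lambda>_. ?V))"
  proof (rule P.product_integral_insert)
    have "(\<lambda>p. (fst p)(j := snd p)) \<in> PiM (insert n ?K) (\<lambda>_. ?V) \<Otimes>\<^sub>M ?V \<rightarrow>\<^sub>M PiM (insert j (insert n ?K)) (\<lambda>_. ?V)"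
      using measurable_add_dim[of j "insert n ?K" "\<lambda>_. ?V"] by (simp add: case_prod_beta)
    then have "(\<lambda>p. (fst p)(j := snd p)) \<in> PiM (insert n ?K) (\<lambda>_. ?V) \<Otimes>\<^sub>M ?V \<rightarrow>\<^sub>M PiM {..n} (\<lambda>_. ?V)"
      by (simp only: ins)
    from measurable_compose[OF this meas]
    have "(\<lambda>(X, y). ?f (X(j := y))) \<in> borel_measurable (PiM (insert n ?K) (\<lambda>_. ?V) \<Otimes>\<^sub>M ?V)"
      unfolding case_prod_unfold .
    then have m: "(\<lambda>X. \<integral>y. ?f (X(j := y)) \<partial>?V) \<in> borel_measurable (PiM (insert n ?K) (\<lambda>_. ?V))"
      by (rule V.borel_measurable_lebesgue_integral)
    interpret PK: prob_space "PiM (insert n ?K) (\<lambda>_. ?V)"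
      by (intro prob_space_PiM prob_space_gaussian)
    show "integrable (PiM (insert n ?K) (\<lambda>_. ?V)) (\<lambda>X. \<integral>y. ?f (X(j := y)) \<partial>?V)"
    proof (rule PK.integrable_const_bound[where B=1, OF _ m])
      have "norm (\<integral>y. ?f (X(j := y)) \<partial>?V) \<le> (\<integral>y. norm (?f (X(j := y))) \<partial>?V)" for X
        by (rule integral_norm_bound)
      then show "AE X in PiM (insert n ?K) (\<lambda>_. ?V). norm (\<integral>y. ?f (X(j := y)) \<partial>?V) \<le> 1"
        by (simp add: V.prob_space)
    qed
  qed auto
  also have "\<dots> = (\<integral>Y. gaussian_column_form.pair_char n (column_form (of_real \<delta>) n j Y z) a b \<partial>PiM ?K (\<lambda>_. ?V))"
  proof (intro Bochner_Integration.integral_cong refl)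
    fix Y
    interpret Q: gaussian_column_form n "column_form (of_real \<delta>) n j Y z" \<delta>
      by (rule gaussian_column_form[OF j delta])
    let ?D = "column_form (of_real \<delta>) n j Y z"
    have "integrable (?V \<Otimes>\<^sub>M ?V) (\<lambda>p. exp (\<i> * of_real (?D (border_col n a (fst p)) (border_col n b (snd p)))))"
      using Q.prob_space_VV Q.meas_D unfolding Q.V_def by (rule integrable_exp_i)
    from integral_fst'[OF this]
    have "Q.pair_char a b = (\<integral>x. (\<integral>y. exp (\<i> * of_real (?D (border_col n a x) (border_col n b y))) \<partial>?V) \<partial>?V)"
      unfolding Q.pair_char_def Q.V_def by simp
    also have "\<dots> = (\<integral>x. (\<integral>y. ?f (Y(n := x, j := y)) \<partial>?V) \<partial>?V)"
      using j unfolding column_form_def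
      by (intro Bochner_Integration.integral_cong refl arg_cong[where f="\<lambda>w. exp (\<i> * of_real (re_part w))"] signed_per_cong)
         (auto simp: border_col_def z)
    finally show "(\<integral>x. (\<integral>y. ?f (Y(n := x, j := y)) \<partial>?V) \<partial>?V) = Q.pair_char a b" ..
  qed
  finally show ?thesis .
qed

lemma column_form_update:
  "j < n \<Longrightarrow> column_form \<epsilon> n j Y (z(n := u, j := v)) = column_form \<epsilon> n j Y z"
  unfolding column_form_def
  by (intro ext arg_cong[where f=re_part] signed_per_cong) auto

lemma border_char_det_merge:
  fixes z :: "nat \<Rightarrow> 'a::real_or_complex"
  assumes j: "j < n" and z: "z n = of_real a" "z j = of_real b" and r: "r = sqrt (a\<^sup>2 + b\<^sup>2)"
  shows "border_char (- 1) n z = border_char (- 1) n (z(n := of_real r, j := 0))"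
proof -
  have "border_char (of_real (- 1)) n z = border_char (of_real (- 1)) n (z(n := of_real r, j := 0))"
  proof -
    have "border_char (of_real (- 1)) n z = (\<integral>Y. gaussian_column_form.pair_char n (column_form (of_real (- 1)) n j Y z) a b
       \<partial>PiM ({..n} - {j, n}) (\<lambda>_. PiM {..<n} (\<lambda>_. gaussian)))"
      by (rule border_char_eq_integral_pair_char[OF j _ z]) simp
    also have "\<dots> = (\<integral>Y. gaussian_column_form.pair_char n (column_form (of_real (- 1)) n j Y (z(n := of_real r, j := 0))) r 0
       \<partial>PiM ({..n} - {j, n}) (\<lambda>_. PiM {..<n} (\<lambda>_. gaussian)))"
      unfolding column_form_update[OF j]
      by (intro Bochner_Integration.integral_cong refl
          gaussian_column_form.pair_char_antisymmetric[OF gaussian_column_form[OF j] refl r]) simp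
    also have "\<dots> = border_char (of_real (- 1)) n (z(n := of_real r, j := 0))"
      by (rule border_char_eq_integral_pair_char[OF j, symmetric]) (use j in simp_all)
    finally show ?thesis .
  qed
  then show ?thesis by simp
qed

lemma border_char_per_merge:
  fixes z :: "nat \<Rightarrow> 'a::real_or_complex"
  assumes j: "j < n" and z: "z n = of_real a" "z j = of_real b" and r: "r = sqrt (a\<^sup>2 + b\<^sup>2)"
  shows "norm (border_char 1 n z) \<le> Re (border_char 1 n (z(n := of_real r, j := 0)))"
proof -
  let ?M = "PiM ({..n} - {j, n}) (\<lambda>_. PiM {..<n} (\<lambda>_. gaussian :: 'a measure))"
  let ?E = "\<lambda>Y. gaussian_column_form.pair_char n (column_form (of_real 1) n j Y z)"
  have "border_char (of_real 1) n (z(n := of_real r, j := 0)) = (\<integral>Y. ?E Y r 0 \<partial>?M)"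
    using j by (simp add: border_char_eq_integral_pair_char[OF j, of 1 _ r 0] column_form_update del: of_real_1)
  also have "\<dots> = (\<integral>Y. complex_of_real (norm (?E Y a b)) \<partial>?M)"
    by (intro Bochner_Integration.integral_cong refl
        gaussian_column_form.pair_char_symmetric[OF gaussian_column_form[OF j] refl r]) simp
  also have "\<dots> = complex_of_real (\<integral>Y. norm (?E Y a b) \<partial>?M)"
    by simp
  finally have "Re (border_char 1 n (z(n := of_real r, j := 0))) = (\<integral>Y. norm (?E Y a b) \<partial>?M)"
    by simp
  moreover have "border_char (of_real 1) n z = (\<integral>Y. ?E Y a b \<partial>?M)"
    by (rule border_char_eq_integral_pair_char[OF j _ z]) simp
  ultimately show ?thesis
    using integral_norm_bound[of ?M "\<lambda>Y. ?E Y a b"] by simp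
qed

text \<open>
  After replacing the entries by their moduli, the entries \<open>0, \<dots>, n - 1\<close> are merged one after the other into
  the last one.
\<close>

lemma border_char_concentrate:
  fixes z :: "nat \<Rightarrow> 'a::real_or_complex"
  assumes n: "n \<ge> 1"
  obtains \<rho> :: real where
    "norm (border_char 1 n z) \<le> Re (border_char 1 n (\<lambda>k. if k = n then of_real \<rho> else 0 :: 'a))"
    "border_char (- 1) n z = border_char (- 1) n (\<lambda>k. if k = n then of_real \<rho> else 0 :: 'a)"
proof -
  have step: "\<exists>w. (\<forall>k<m. w k = 0) \<and> norm (border_char 1 n z) \<le> norm (border_char 1 n (\<lambda>k. of_real (w k) :: 'a))
      \<and> (m > 0 \<longrightarrow> norm (border_char 1 n z) \<le> Re (border_char 1 n (\<lambda>k. of_real (w k) :: 'a)))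
      \<and> border_char (- 1) n z = border_char (- 1) n (\<lambda>k. of_real (w k) :: 'a)" if "m \<le> n" for m
    using that
  proof (induction m)
    case 0
    have "border_char \<epsilon> n z = border_char \<epsilon> n (\<lambda>k. of_real (norm (z k)))" for \<epsilon>
      by (rule border_char_eq_if_norm_eq[OF n]) simp
    then show ?case by (intro exI[of _ "\<lambda>k. norm (z k)"]) auto
  next
    case (Suc m)
    then obtain w where w: "\<forall>k<m. w k = 0" "norm (border_char 1 n z) \<le> norm (border_char 1 n (\<lambda>k. of_real (w k) :: 'a))"
      "border_char (- 1) n z = border_char (- 1) n (\<lambda>k. of_real (w k) :: 'a)" by auto
    define r where "r = sqrt ((w n)\<^sup>2 + (w m)\<^sup>2)"
    have m: "m < n" using Suc by simp
    have upd: "(\<lambda>k. of_real (w k) :: 'a)(n := of_real r, m := 0) = (\<lambda>k. of_real ((w(n := r, m := 0)) k))"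
      by (auto simp: fun_eq_iff)
    have "norm (border_char 1 n z) \<le> Re (border_char 1 n (\<lambda>k. of_real ((w(n := r, m := 0)) k) :: 'a))"
      using w(2) border_char_per_merge[OF m, of "\<lambda>k. of_real (w k) :: 'a", OF refl refl r_def] unfolding upd by (rule order_trans)
    moreover have "border_char (- 1) n z = border_char (- 1) n (\<lambda>k. of_real ((w(n := r, m := 0)) k) :: 'a)"
      using w(3) border_char_det_merge[OF m, of "\<lambda>k. of_real (w k) :: 'a", OF refl refl r_def] unfolding upd by simp
    ultimately show ?case
      using w(1) m complex_Re_le_cmod order_trans
      by (intro exI[of _ "w(n := r, m := 0)"]) (auto simp: less_Suc_eq intro: order_trans[OF _ complex_Re_le_cmod])
  qed
  obtain w where w: "\<forall>k<n. w k = 0" "norm (border_char 1 n z) \<le> Re (border_char 1 n (\<lambda>k. of_real (w k) :: 'a))"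
      "border_char (- 1) n z = border_char (- 1) n (\<lambda>k. of_real (w k) :: 'a)" using step[of n] n by auto
  have "border_char \<epsilon> n (\<lambda>k. of_real (w k)) = border_char \<epsilon> n (\<lambda>k. if k = n then of_real (w n) else 0)" for \<epsilon> :: 'a
    by (rule border_char_cong) (use w(1) in auto)
  with w(2,3) show ?thesis by (intro that[of "w n"]) simp_all
qed

lemma border_char_last_coordinate:
  fixes \<rho> :: "'a::real_or_complex"
  shows "border_char \<epsilon> n (\<lambda>k. if k = n then \<rho> else 0) = (\<integral>x. exp (\<i> * of_real (re_part (\<rho> * signed_per \<epsilon> n (\<lambda>i j. x (i, j)))))
     \<partial>PiM ({..<n} \<times> {..<n}) (\<lambda>_. gaussian))"
proof -
  let ?M = "PiM ({..<n} \<times> {..n}) (\<lambda>_. gaussian :: 'a measure)"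
  let ?N = "PiM ({..<n} \<times> {..<n}) (\<lambda>_. gaussian :: 'a measure)"
  let ?f = "\<lambda>x. exp (\<i> * of_real (re_part (\<rho> * signed_per \<epsilon> n (\<lambda>i j. x (i, j)))))"
  interpret P: product_prob_space "\<lambda>_::nat \<times> nat. gaussian :: 'a measure" "{..<n} \<times> {..n}" ..
  have [measurable]: "(\<lambda>x. signed_per \<epsilon> n (\<lambda>i j. x (i, j))) \<in> borel_measurable ?N"
    by (intro borel_measurable_signed_per measurable_gaussian_component) auto
  have "integral\<^sup>L ?N ?f = integral\<^sup>L (distr ?M ?N (\<lambda>x. restrict x ({..<n} \<times> {..<n}))) ?f"
    by (subst P.distr_restrict[of _ "{..<n} \<times> {..n}"]) auto
  also have "\<dots> = (\<integral>x. ?f (restrict x ({..<n} \<times> {..<n})) \<partial>?M)"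
    by (rule integral_distr) (auto intro!: measurable_restrict_subset)
  also have "\<dots> = border_char \<epsilon> n (\<lambda>k. if k = n then \<rho> else 0)"
    unfolding border_char_def
  proof (intro Bochner_Integration.integral_cong refl arg_cong[where f="\<lambda>w. exp (\<i> * of_real (re_part w))"])
    fix x
    have "signed_per \<epsilon> n (\<lambda>i j. restrict x ({..<n} \<times> {..<n}) (i, j)) = signed_per \<epsilon> n (bordered n x (\<lambda>k. if k = n then \<rho> else 0))"
      by (rule signed_per_cong) (simp add: bordered_def)
    then show "\<rho> * signed_per \<epsilon> n (\<lambda>i j. restrict x ({..<n} \<times> {..<n}) (i, j))
        = signed_per \<epsilon> (Suc n) (bordered n x (\<lambda>k. if k = n then \<rho> else 0))"
      by (subst signed_per_last_row) (auto simp: bordered_def)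
  qed
  finally show ?thesis ..
qed

text \<open>
  A border supported on its last entry leaves \<open>\<rho>\<close> times the expansion of a square Gaussian matrix. Its last row,
  multiplied by \<open>\<rho>\<close>, serves as a random border for the remaining rows.
\<close>

lemma border_char_integrate_border:
  fixes \<rho> :: "'a::real_or_complex"
  shows "integrable (PiM {..n} (\<lambda>_. gaussian)) (\<lambda>g. border_char \<epsilon> n (\<lambda>j. \<rho> * g j))" (is ?I)
    and "(\<integral>g. border_char \<epsilon> n (\<lambda>j. \<rho> * g j) \<partial>PiM {..n} (\<lambda>_. gaussian)) =
      border_char \<epsilon> (Suc n) (\<lambda>k. if k = Suc n then \<rho> else 0)" (is ?E)
proof -
  let ?R = "PiM {..n} (\<lambda>_. gaussian :: 'a measure)"
  let ?B = "PiM {..<n} (\<lambda>_. ?R)"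
  let ?h = "\<lambda>X g. exp (\<i> * of_real (re_part (signed_per \<epsilon> (Suc n) (\<lambda>i j. if i < n then X i j else \<rho> * g j))))"
  let ?f = "\<lambda>x. exp (\<i> * of_real (re_part (\<rho> * signed_per \<epsilon> (Suc n) (\<lambda>i j. x (i, j)))))"
  interpret R: prob_space ?R by (rule prob_space_PiM_gaussian)
  interpret B: prob_space ?B by (intro prob_space_PiM prob_space_gaussian)
  interpret P: product_sigma_finite "\<lambda>_::nat. ?R" ..
  interpret pair_sigma_finite ?B ?R ..
  have int: "integrable (?B \<Otimes>\<^sub>M ?R) (case_prod ?h)"
    unfolding case_prod_unfold
  proof (intro integrable_exp_i prob_space_pair B.prob_space_axioms R.prob_space_axioms borel_measurable_re_signed_per)
    fix i j assume "i < Suc n" "j < Suc n"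
    then show "(\<lambda>p. if i < n then fst p i j else \<rho> * snd p j) \<in> borel_measurable (?B \<Otimes>\<^sub>M ?R)"
      by (cases "i < n")
         (auto intro!: measurable_compose[OF measurable_fst measurable_gaussian_component2] borel_measurable_times
          measurable_compose[OF measurable_snd measurable_gaussian_component])
  qed
  show ?I using integrable_snd[OF int] by (simp add: border_char_rows)
  have scale: "signed_per \<epsilon> (Suc n) (\<lambda>i j. if i < n then X i j else \<rho> * g j) = \<rho> * signed_per \<epsilon> (Suc n) (X(n := g))" for X g
  proof -
    have "signed_per \<epsilon> (Suc n) (\<lambda>i j. if i < n then X i j else \<rho> * g j)
      = signed_per \<epsilon> (Suc n) (\<lambda>i j. (if i < n then 1 else \<rho>) * 1 * (X(n := g)) i j)"
      by (rule signed_per_cong) auto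
    also have "\<dots> = (\<Prod>i<Suc n. if i < n then 1 else \<rho>) * (\<Prod>j<Suc n. 1) * signed_per \<epsilon> (Suc n) (X(n := g))"
      by (rule signed_per_scale)
    finally show ?thesis by (simp del: fun_upd_apply)
  qed
  have meas: "(\<lambda>x. re_part (\<rho> * signed_per \<epsilon> (Suc n) (\<lambda>i j. x (i, j)))) \<in> borel_measurable (PiM ({..<Suc n} \<times> {..n}) (\<lambda>_. gaussian))"
    by (intro measurable_compose[OF _ borel_measurable_re_part] borel_measurable_times borel_measurable_const
        borel_measurable_signed_per measurable_gaussian_component) auto
  have meas2: "(\<lambda>X. re_part (\<rho> * signed_per \<epsilon> (Suc n) X)) \<in> borel_measurable (PiM (insert n {..<n}) (\<lambda>_. ?R))"
    by (intro measurable_compose[OF _ borel_measurable_re_part] borel_measurable_times borel_measurable_const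
        borel_measurable_signed_per measurable_gaussian_component2) auto
  have "border_char \<epsilon> (Suc n) (\<lambda>k. if k = Suc n then \<rho> else 0) = integral\<^sup>L (PiM ({..<Suc n} \<times> {..n}) (\<lambda>_. gaussian)) ?f"
    by (simp add: border_char_last_coordinate lessThan_Suc_atMost)
  also have "\<dots> = (\<integral>X. ?f (\<lambda>(i, j)\<in>{..<Suc n} \<times> {..n}. X i j) \<partial>PiM {..<Suc n} (\<lambda>_. ?R))"
    by (rule integral_PiM_rows[OF prob_space_gaussian]) (use meas in measurable)
  also have "\<dots> = (\<integral>X. exp (\<i> * of_real (re_part (\<rho> * signed_per \<epsilon> (Suc n) X))) \<partial>PiM (insert n {..<n}) (\<lambda>_. ?R))"
    unfolding lessThan_Suc
    by (intro Bochner_Integration.integral_cong refl arg_cong[where f="\<lambda>w. exp (\<i> * of_real (re_part (\<rho> * w)))"] signed_per_cong)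
       auto
  also have "\<dots> = (\<integral>X. (\<integral>g. exp (\<i> * of_real (re_part (\<rho> * signed_per \<epsilon> (Suc n) (X(n := g))))) \<partial>?R) \<partial>?B)"
    by (rule P.product_integral_insert)
       (auto intro!: integrable_exp_i prob_space_PiM prob_space_gaussian meas2)
  also have "\<dots> = (\<integral>X. (\<integral>g. ?h X g \<partial>?R) \<partial>?B)"
    by (simp only: scale)
  also have "\<dots> = (\<integral>g. (\<integral>X. ?h X g \<partial>?B) \<partial>?R)"
    by (rule Fubini_integral[OF int, symmetric])
  finally show ?E by (simp add: border_char_rows)
qed

text \<open>
  Real parts are compared because for \<open>n = 0\<close> both functions equal \<open>exp (\<i> * re_part (z 0))\<close>, which need
  not be real.
\<close>

theorem Re_border_char_per_le_det:
  fixes z :: "nat \<Rightarrow> 'a::real_or_complex"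
  shows "Re (border_char 1 n z) \<le> Re (border_char (- 1) n z)"
proof (induction n arbitrary: z)
  case 0
  have "signed_per \<epsilon> (Suc 0) A = A 0 0" for \<epsilon> :: 'a and A
    by (subst signed_per_last_row) (simp_all add: signed_per_def)
  then show ?case by (simp add: border_char_def)
next
  case (Suc n)
  obtain \<rho> :: real where \<rho>: "norm (border_char 1 (Suc n) z) \<le> Re (border_char 1 (Suc n) (\<lambda>k. if k = Suc n then of_real \<rho> else 0 :: 'a))"
    "border_char (- 1) (Suc n) z = border_char (- 1) (Suc n) (\<lambda>k. if k = Suc n then of_real \<rho> else 0 :: 'a)"
    by (rule border_char_concentrate[of "Suc n" z]) auto
  let ?R = "PiM {..n} (\<lambda>_. gaussian :: 'a measure)"
  have Re: "Re (border_char \<epsilon> (Suc n) (\<lambda>k. if k = Suc n then of_real \<rho> else 0)) = (\<integral>g. Re (border_char \<epsilon> n (\<lambda>j. of_real \<rho> * g j)) \<partial>?R)"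
    and int: "integrable ?R (\<lambda>g. Re (border_char \<epsilon> n (\<lambda>j. of_real \<rho> * g j)))" for \<epsilon> :: 'a
    unfolding border_char_integrate_border(2)[symmetric]
    by (rule integral_Re[OF border_char_integrate_border(1), symmetric], rule integrable_Re[OF border_char_integrate_border(1)])
  have "Re (border_char 1 (Suc n) z) \<le> norm (border_char 1 (Suc n) z)"
    by (rule complex_Re_le_cmod)
  also note \<rho>(1)
  also have "Re (border_char 1 (Suc n) (\<lambda>k. if k = Suc n then of_real \<rho> else 0 :: 'a)) \<le> Re (border_char (- 1) (Suc n) z)"
    unfolding \<rho>(2) Re by (intro integral_mono int Suc.IH)
  finally show ?case .
qed

section \<open>Gaussian random matrices\<close>

lemma std_gaussian_matrix_entry_measurable:
  fixes X :: "'w \<Rightarrow> 'a::euclidean_space mat"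
  assumes "prob_space M" "std_gaussian_matrix M m n X" "i < m" "j < n"
  shows "(\<lambda>\<omega>. X \<omega> $$ (i, j)) \<in> borel_measurable M"
  using assms distr_std_gaussian_scalar(1)[OF assms(1), of "\<lambda>\<omega>. X \<omega> $$ (i, j)"]
  by (simp add: std_gaussian_matrix_def)

lemma distr_std_gaussian_matrix:
  fixes X :: "'w \<Rightarrow> 'a::euclidean_space mat"
  assumes M: "prob_space M" and X: "std_gaussian_matrix M m n X"
  shows "(\<lambda>\<omega>. \<lambda>k\<in>{..<m} \<times> {..<n}. X \<omega> $$ k) \<in> M \<rightarrow>\<^sub>M PiM ({..<m} \<times> {..<n}) (\<lambda>_. gaussian)" (is "?X \<in> _")
    and "distr M (PiM ({..<m} \<times> {..<n}) (\<lambda>_. gaussian)) (\<lambda>\<omega>. \<lambda>k\<in>{..<m} \<times> {..<n}. X \<omega> $$ k)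
      = PiM ({..<m} \<times> {..<n}) (\<lambda>_. gaussian)"
proof -
  interpret prob_space M by fact
  let ?I = "{..<m} \<times> {..<n}"
  interpret P: product_prob_space "\<lambda>_::nat \<times> nat. gaussian :: 'a measure" ?I ..
  have comp: "(\<lambda>\<omega>. X \<omega> $$ k) \<in> borel_measurable M" if "k \<in> ?I" for k
    using that std_gaussian_matrix_entry_measurable[OF M X] by (cases k) auto
  have law: "distr M borel (\<lambda>\<omega>. X \<omega> $$ k) = gaussian" if "k \<in> ?I" for k
    using that X distr_std_gaussian_scalar(2)[OF M] by (cases k) (auto simp: std_gaussian_matrix_def)
  show meas: "?X \<in> M \<rightarrow>\<^sub>M PiM ?I (\<lambda>_. gaussian)"
  proof (rule measurable_restrict)
    fix k assume "k \<in> ?I"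
    from comp[OF this] show "(\<lambda>\<omega>. X \<omega> $$ k) \<in> M \<rightarrow>\<^sub>M gaussian"
      by (simp cong: measurable_cong_sets)
  qed
  show "distr M (PiM ?I (\<lambda>_. gaussian)) ?X = PiM ?I (\<lambda>_. gaussian)"
  proof (cases "?I = {}")
    case True
    show ?thesis
    proof (rule P.PiM_eqI)
      fix A :: "nat \<times> nat \<Rightarrow> 'a set"
      have "emeasure (distr M (PiM ?I (\<lambda>_. gaussian)) ?X) (Pi\<^sub>E ?I A) = emeasure M (?X -` Pi\<^sub>E ?I A \<inter> space M)"
        by (rule emeasure_distr[OF meas], rule sets_PiM_I_finite) (auto simp: True)
      also have "?X -` Pi\<^sub>E ?I A \<inter> space M = space M"
        unfolding True by auto
      finally show "emeasure (distr M (PiM ?I (\<lambda>_. gaussian)) ?X) (Pi\<^sub>E ?I A) = (\<Prod>k\<in>?I. emeasure gaussian (A k))"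
        by (simp only: True prod.empty emeasure_space_1)
    qed auto
  next
    case False
    have "distr M (PiM ?I (\<lambda>_. gaussian)) ?X = distr M (PiM ?I (\<lambda>_. borel)) ?X"
      by (rule distr_cong) (auto intro!: sets_PiM_cong)
    also have "\<dots> = PiM ?I (\<lambda>k. distr M borel (\<lambda>\<omega>. X \<omega> $$ k))"
      using X comp unfolding std_gaussian_matrix_def
      by (subst (asm) indep_vars_iff_distr_eq_PiM'[OF False]) auto
    also have "\<dots> = PiM ?I (\<lambda>_. gaussian)"
      by (rule PiM_cong) (auto simp: law)
    finally show ?thesis .
  qed
qed

lemma integral_std_gaussian_matrix:
  fixes X :: "'w \<Rightarrow> 'a::euclidean_space mat" and f :: "_ \<Rightarrow> complex"
  assumes M: "prob_space M" and X: "std_gaussian_matrix M m n X"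
    and f: "f \<in> borel_measurable (PiM ({..<m} \<times> {..<n}) (\<lambda>_. gaussian))"
  shows "(\<integral>\<omega>. f (\<lambda>k\<in>{..<m} \<times> {..<n}. X \<omega> $$ k) \<partial>M) = integral\<^sup>L (PiM ({..<m} \<times> {..<n}) (\<lambda>_. gaussian)) f"
  using integral_distr[OF distr_std_gaussian_matrix(1)[OF M X] f] distr_std_gaussian_matrix(2)[OF M X]
  by simp

lemma std_gaussian_matrix_carrier:
  "std_gaussian_matrix M m n X \<Longrightarrow> \<omega> \<in> space M \<Longrightarrow> X \<omega> \<in> carrier_mat m n"
  by (simp add: std_gaussian_matrix_def)

lemma border_char_std_gaussian_matrix:
  fixes B :: "'w \<Rightarrow> 'a::real_or_complex mat"
  assumes M: "prob_space M" and B: "std_gaussian_matrix M n (Suc n) B"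
  shows "(\<integral>\<omega>. exp (\<i> * of_real (re_part (signed_per \<epsilon> (Suc n) (\<lambda>i j. if i < n then B \<omega> $$ (i, j) else w j)))) \<partial>M)
    = border_char \<epsilon> n w"
proof -
  let ?I = "{..<n} \<times> {..<Suc n}"
  let ?f = "\<lambda>x. exp (\<i> * of_real (re_part (signed_per \<epsilon> (Suc n) (bordered n x w))))"
  have "?f \<in> borel_measurable (PiM ?I (\<lambda>_. gaussian))"
    using measurable_bordered[of \<epsilon> n w] unfolding lessThan_Suc_atMost by measurable
  from integral_std_gaussian_matrix[OF M B this]
  have "border_char \<epsilon> n w = (\<integral>\<omega>. ?f (\<lambda>k\<in>?I. B \<omega> $$ k) \<partial>M)"
    by (simp add: border_char_def lessThan_Suc_atMost)
  also have "\<dots> = (\<integral>\<omega>. exp (\<i> * of_real (re_part (signed_per \<epsilon> (Suc n) (\<lambda>i j. if i < n then B \<omega> $$ (i, j) else w j)))) \<partial>M)"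
    by (intro Bochner_Integration.integral_cong refl arg_cong[where f="\<lambda>w. exp (\<i> * of_real (re_part w))"] signed_per_cong)
       (auto simp: bordered_def)
  finally show ?thesis ..
qed

lemma char_cofactor_per:
  fixes B :: "'w \<Rightarrow> 'a::real_or_complex mat"
  assumes M: "prob_space M" and B: "std_gaussian_matrix M n (Suc n) B"
  shows "(\<integral>\<omega>. exp (\<i> * of_real (re_part (\<Sum>j\<le>n. w j * cofactor_per (B \<omega>) $ j))) \<partial>M) = border_char 1 n w"
  unfolding border_char_std_gaussian_matrix[OF M B, symmetric]
  by (rule Bochner_Integration.integral_cong[OF refl])
     (simp add: signed_per_bordered_cofactor_per[OF std_gaussian_matrix_carrier[OF B]])

text \<open>
  The sign between the two Laplace expansions is moved into the border, where only moduli matter as soon as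
  \<open>n \<ge> 1\<close>; for \<open>n = 0\<close> the sign is \<open>1\<close>.
\<close>

lemma char_cofactor_det:
  fixes B :: "'w \<Rightarrow> 'a::real_or_complex mat"
  assumes M: "prob_space M" and B: "std_gaussian_matrix M n (Suc n) B"
  shows "(\<integral>\<omega>. exp (\<i> * of_real (re_part (\<Sum>j\<le>n. w j * cofactor_det (B \<omega>) $ j))) \<partial>M) = border_char (- 1) n w"
proof -
  have "(\<integral>\<omega>. exp (\<i> * of_real (re_part (\<Sum>j\<le>n. w j * cofactor_det (B \<omega>) $ j))) \<partial>M) = border_char (- 1) n (\<lambda>j. (- 1) ^ n * w j)"
    unfolding border_char_std_gaussian_matrix[OF M B, symmetric]
  proof (intro Bochner_Integration.integral_cong refl arg_cong[where f="\<lambda>w. exp (\<i> * of_real (re_part w))"])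
    fix \<omega> assume "\<omega> \<in> space M"
    have "(\<Sum>j\<le>n. w j * cofactor_det (B \<omega>) $ j) = (- 1) ^ n * (\<Sum>j\<le>n. (- 1) ^ n * w j * cofactor_det (B \<omega>) $ j)"
      by (simp add: sum_distrib_left mult.assoc[symmetric] power_mult_distrib[symmetric])
    also have "\<dots> = signed_per (- 1) (Suc n) (\<lambda>i j. if i < n then B \<omega> $$ (i, j) else (- 1) ^ n * w j)"
      by (rule signed_per_bordered_cofactor_det[OF std_gaussian_matrix_carrier[OF B \<open>\<omega> \<in> space M\<close>], symmetric])
    finally show "(\<Sum>j\<le>n. w j * cofactor_det (B \<omega>) $ j)
      = signed_per (- 1) (Suc n) (\<lambda>i j. if i < n then B \<omega> $$ (i, j) else (- 1) ^ n * w j)" .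
  qed
  also have "\<dots> = border_char (- 1) n w"
  proof (cases "n = 0")
    case False
    then show ?thesis by (intro border_char_eq_if_norm_eq) (auto simp: norm_mult norm_power)
  qed simp
  finally show ?thesis .
qed

lemma vec_char_eq:
  fixes C :: "'w \<Rightarrow> 'a::real_or_complex Matrix.vec"
  assumes "z \<in> carrier_vec (Suc n)" "\<And>\<omega>. \<omega> \<in> space M \<Longrightarrow> C \<omega> \<in> carrier_vec (Suc n)"
  shows "vec_char M C z = (\<integral>\<omega>. exp (\<i> * of_real (re_part (\<Sum>j\<le>n. conjugate (z $ j) * C \<omega> $ j))) \<partial>M)"
  unfolding vec_char_def
proof (intro Bochner_Integration.integral_cong refl arg_cong[where f="\<lambda>w. exp (\<i> * of_real (re_part w))"])
  fix \<omega> assume "\<omega> \<in> space M"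
  from assms(2)[OF this] have dim: "dim_vec (C \<omega>) = Suc n" by simp
  show "herm_inner z (C \<omega>) = (\<Sum>j\<le>n. conjugate (z $ j) * C \<omega> $ j)"
    unfolding herm_inner_def scalar_prod_def dim atLeast0LessThan lessThan_Suc_atMost[symmetric]
    using assms(1) by (intro sum.cong refl) simp
qed

lemma cofactor_carrier:
  assumes "B \<in> carrier_mat m n"
  shows "cofactor_per B \<in> carrier_vec n" "cofactor_det B \<in> carrier_vec n"
  using assms by (auto simp: cofactor_per_def cofactor_det_def)

theorem vec_char_cofactor_le:
  fixes B :: "'w \<Rightarrow> 'a::real_or_complex mat"
  assumes M: "prob_space M" and n: "n \<ge> 1" and B: "std_gaussian_matrix M n (n + 1) B"
    and z: "z \<in> carrier_vec (n + 1)"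
  shows "0 \<le> vec_char M (\<lambda>\<omega>. cofactor_per (B \<omega>)) z \<and>
    vec_char M (\<lambda>\<omega>. cofactor_per (B \<omega>)) z \<le> vec_char M (\<lambda>\<omega>. cofactor_det (B \<omega>)) z"
proof -
  have B': "std_gaussian_matrix M n (Suc n) B" and z': "z \<in> carrier_vec (Suc n)"
    using B z by simp_all
  note carrier = cofactor_carrier[OF std_gaussian_matrix_carrier[OF B']]
  have per: "vec_char M (\<lambda>\<omega>. cofactor_per (B \<omega>)) z = border_char 1 n (\<lambda>j. conjugate (z $ j))"
    using carrier by (simp add: vec_char_eq[OF z'] char_cofactor_per[OF M B'])
  have det: "vec_char M (\<lambda>\<omega>. cofactor_det (B \<omega>)) z = border_char (- 1) n (\<lambda>j. conjugate (z $ j))"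
    using carrier by (simp add: vec_char_eq[OF z'] char_cofactor_det[OF M B'])
  obtain r where r: "r \<ge> 0" "border_char 1 n (\<lambda>j. conjugate (z $ j)) = of_real r"
    by (rule border_char_nonneg[OF n])
  obtain s where s: "s \<ge> 0" "border_char (- 1) n (\<lambda>j. conjugate (z $ j)) = of_real s"
    by (rule border_char_nonneg[OF n])
  have "r \<le> s"
    using Re_border_char_per_le_det[of n "\<lambda>j. conjugate (z $ j)"] r(2) s(2) by simp
  then show ?thesis
    using r s by (simp add: per det less_eq_complex_def)
qed

section \<open>From characteristic functions to Laplace transforms\<close>

text \<open>
  The Gaussian exponential of the linear forms \<open>\<Sum>j<N. v k j * Y \<omega> j\<close> is itself a characteristic function, of an
  auxiliary Gaussian vector \<open>g\<close>. Exchanging the two expectations gives an average of characteristic functions of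
  \<open>Y\<close>. The factor \<open>sqrt (2 * DIM('a))\<close> compensates the variance \<open>1 / DIM('a)\<close> of the real coordinates.
\<close>

lemma laplace_gaussian_randomization:
  fixes Y :: "'w \<Rightarrow> nat \<Rightarrow> 'a::real_or_complex" and v :: "nat \<Rightarrow> nat \<Rightarrow> 'a" and N K :: nat
  assumes M: "prob_space M" and Y: "\<And>j. j < N \<Longrightarrow> (\<lambda>\<omega>. Y \<omega> j) \<in> borel_measurable M"
  defines "I \<equiv> \<lambda>g. \<integral>\<omega>. exp (\<i> * of_real (re_part
      (\<Sum>j<N. (of_real (sqrt (2 * real DIM('a))) * (\<Sum>k<K. g k * v k j)) * Y \<omega> j))) \<partial>M"
  shows "integrable (PiM {..<K} (\<lambda>_. gaussian)) I"
    and "(\<integral>g. I g \<partial>PiM {..<K} (\<lambda>_. gaussian))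
      = of_real (\<integral>\<omega>. exp (- (\<Sum>k<K. (norm (\<Sum>j<N. v k j * Y \<omega> j))\<^sup>2)) \<partial>M)"
proof -
  let ?G = "PiM {..<K} (\<lambda>_. gaussian :: 'a measure)"
  let ?c = "of_real (sqrt (2 * real DIM('a))) :: 'a"
  let ?h = "\<lambda>\<omega> g. exp (\<i> * of_real (re_part (\<Sum>j<N. (?c * (\<Sum>k<K. g k * v k j)) * Y \<omega> j)))"
  interpret M: prob_space M by (rule M)
  interpret G: prob_space ?G by (rule prob_space_PiM_gaussian)
  interpret pair_sigma_finite M ?G ..
  have int: "integrable (M \<Otimes>\<^sub>M ?G) (case_prod ?h)"
    unfolding case_prod_unfold
  proof (intro integrable_exp_i prob_space_pair M prob_space_PiM_gaussian)
    have "(\<lambda>p. \<Sum>j<N. (?c * (\<Sum>k<K. snd p k * v k j)) * Y (fst p) j) \<in> borel_measurable (M \<Otimes>\<^sub>M ?G)"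
    proof (intro borel_measurable_sum borel_measurable_times borel_measurable_const)
      show "(\<lambda>p. snd p k) \<in> borel_measurable (M \<Otimes>\<^sub>M ?G)" if "k \<in> {..<K}" for k
        by (rule measurable_compose[OF measurable_snd measurable_gaussian_component[OF that]])
      show "(\<lambda>p. Y (fst p) j) \<in> borel_measurable (M \<Otimes>\<^sub>M ?G)" if "j \<in> {..<N}" for j
        using that by (intro measurable_compose[OF measurable_fst Y]) simp
    qed
    from measurable_compose[OF this borel_measurable_re_part]
    show "(\<lambda>p. re_part (\<Sum>j<N. (?c * (\<Sum>k<K. snd p k * v k j)) * Y (fst p) j)) \<in> borel_measurable (M \<Otimes>\<^sub>M ?G)" .
  qed
  show "integrable ?G I"
    unfolding I_def using integrable_snd[OF int] by simp
  have "(\<integral>g. I g \<partial>?G) = (\<integral>\<omega>. (\<integral>g. ?h \<omega> g \<partial>?G) \<partial>M)"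
    unfolding I_def by (rule Fubini_integral[OF int])
  also have "\<dots> = (\<integral>\<omega>. complex_of_real (exp (- (\<Sum>k<K. (norm (\<Sum>j<N. v k j * Y \<omega> j))\<^sup>2))) \<partial>M)"
  proof (rule Bochner_Integration.integral_cong[OF refl])
    fix \<omega>
    let ?a = "\<lambda>k. ?c * (\<Sum>j<N. v k j * Y \<omega> j)"
    have "(\<Sum>j<N. (?c * (\<Sum>k<K. g k * v k j)) * Y \<omega> j) = (\<Sum>k<K. ?a k * g k)" for g
    proof -
      have "(\<Sum>j<N. (?c * (\<Sum>k<K. g k * v k j)) * Y \<omega> j) = (\<Sum>j<N. \<Sum>k<K. ?c * g k * v k j * Y \<omega> j)"
        by (simp add: sum_distrib_left sum_distrib_right mult.assoc)
      also have "\<dots> = (\<Sum>k<K. \<Sum>j<N. ?c * g k * v k j * Y \<omega> j)"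
        by (rule sum.swap)
      also have "\<dots> = (\<Sum>k<K. ?a k * g k)"
        by (simp add: sum_distrib_left sum_distrib_right mult_ac)
      finally show ?thesis .
    qed
    then have "(\<integral>g. ?h \<omega> g \<partial>?G) = (\<integral>g. exp (\<i> * of_real (re_part (\<Sum>k<K. ?a k * g k))) \<partial>?G)"
      by simp
    also have "\<dots> = complex_of_real (exp (- ((\<Sum>k<K. (norm (?a k))\<^sup>2) / (2 * real DIM('a)))))"
      by (rule gaussian_char_linear_form) simp
    also have "(\<Sum>k<K. (norm (?a k))\<^sup>2) = 2 * real DIM('a) * (\<Sum>k<K. (norm (\<Sum>j<N. v k j * Y \<omega> j))\<^sup>2)"
    proof -
      have "(norm (?a k))\<^sup>2 = 2 * real DIM('a) * (norm (\<Sum>j<N. v k j * Y \<omega> j))\<^sup>2" for k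
        by (simp only: norm_mult power_mult_distrib) simp
      then show ?thesis by (simp only: sum_distrib_left)
    qed
    finally show "(\<integral>g. ?h \<omega> g \<partial>?G) = complex_of_real (exp (- (\<Sum>k<K. (norm (\<Sum>j<N. v k j * Y \<omega> j))\<^sup>2)))"
      by simp
  qed
  finally show "(\<integral>g. I g \<partial>?G) = of_real (\<integral>\<omega>. exp (- (\<Sum>k<K. (norm (\<Sum>j<N. v k j * Y \<omega> j))\<^sup>2)) \<partial>M)"
    by simp
qed

lemma laplace_le_if_char_le:
  fixes Y Z :: "'w \<Rightarrow> nat \<Rightarrow> 'a::real_or_complex" and v :: "nat \<Rightarrow> nat \<Rightarrow> 'a"
  assumes M: "prob_space M"
    and Y: "\<And>j. j < N \<Longrightarrow> (\<lambda>\<omega>. Y \<omega> j) \<in> borel_measurable M"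
    and Z: "\<And>j. j < N \<Longrightarrow> (\<lambda>\<omega>. Z \<omega> j) \<in> borel_measurable M"
    and le: "\<And>u. Re (\<integral>\<omega>. exp (\<i> * of_real (re_part (\<Sum>j<N. u j * Z \<omega> j))) \<partial>M)
      \<le> Re (\<integral>\<omega>. exp (\<i> * of_real (re_part (\<Sum>j<N. u j * Y \<omega> j))) \<partial>M)"
  shows "(\<integral>\<omega>. exp (- (\<Sum>k<K. (norm (\<Sum>j<N. v k j * Z \<omega> j))\<^sup>2)) \<partial>M)
    \<le> (\<integral>\<omega>. exp (- (\<Sum>k<K. (norm (\<Sum>j<N. v k j * Y \<omega> j))\<^sup>2)) \<partial>M)"
proof -
  let ?G = "PiM {..<K} (\<lambda>_. gaussian :: 'a measure)"
  let ?I = "\<lambda>Y g. \<integral>\<omega>. exp (\<i> * of_real (re_part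
      (\<Sum>j<N. (of_real (sqrt (2 * real DIM('a))) * (\<Sum>k<K. g k * v k j)) * Y \<omega> j))) \<partial>M"
  have Re: "(\<integral>\<omega>. exp (- (\<Sum>k<K. (norm (\<Sum>j<N. v k j * Y \<omega> j))\<^sup>2)) \<partial>M) = (\<integral>g. Re (?I Y g) \<partial>?G)"
    and int: "integrable ?G (\<lambda>g. Re (?I Y g))"
    if Y: "\<And>j. j < N \<Longrightarrow> (\<lambda>\<omega>. Y \<omega> j) \<in> borel_measurable M" for Y
  proof -
    note rand = laplace_gaussian_randomization[where Y=Y and N=N and K=K and v=v, OF M Y]
    show "integrable ?G (\<lambda>g. Re (?I Y g))"
      by (rule integrable_Re[OF rand(1)])
    have "(\<integral>g. Re (?I Y g) \<partial>?G) = Re (\<integral>g. ?I Y g \<partial>?G)"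
      by (rule integral_Re[OF rand(1)])
    then show "(\<integral>\<omega>. exp (- (\<Sum>k<K. (norm (\<Sum>j<N. v k j * Y \<omega> j))\<^sup>2)) \<partial>M) = (\<integral>g. Re (?I Y g) \<partial>?G)"
      by (simp only: rand(2) Re_complex_of_real)
  qed
  show ?thesis
  proof -
    have "(\<integral>\<omega>. exp (- (\<Sum>k<K. (norm (\<Sum>j<N. v k j * Z \<omega> j))\<^sup>2)) \<partial>M) = (\<integral>g. Re (?I Z g) \<partial>?G)"
      by (rule Re[OF Z])
    also have "\<dots> \<le> (\<integral>g. Re (?I Y g) \<partial>?G)"
      by (intro integral_mono int[OF Y] int[OF Z] le)
    also have "\<dots> = (\<integral>\<omega>. exp (- (\<Sum>k<K. (norm (\<Sum>j<N. v k j * Y \<omega> j))\<^sup>2)) \<partial>M)"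
      by (rule Re[OF Y, symmetric])
    finally show ?thesis .
  qed
qed

text \<open>
  Here the averaging uses a single Gaussian scalar: a multiple of \<open>per G\<close> or \<open>det G\<close> is an expansion with border
  supported on the last entry.
\<close>

theorem Lt_le_det_per:
  fixes G :: "'w \<Rightarrow> 'a::real_or_complex mat"
  assumes M: "prob_space M" and G: "std_gaussian_matrix M n n G"
  shows "Lt_le M (\<lambda>\<omega>. (norm (Determinant.det (G \<omega>)))\<^sup>2) (\<lambda>\<omega>. (norm (per (G \<omega>)))\<^sup>2)"
proof -
  let ?signed_per = "\<lambda>\<epsilon> \<omega>. signed_per \<epsilon> n (\<lambda>i j. G \<omega> $$ (i, j))"
  have meas: "?signed_per \<epsilon> \<in> borel_measurable M" for \<epsilon>
    by (intro borel_measurable_signed_per std_gaussian_matrix_entry_measurable[OF M G])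
  note carrier = std_gaussian_matrix_carrier[OF G]
  have char: "(\<integral>\<omega>. exp (\<i> * of_real (re_part (u * ?signed_per \<epsilon> \<omega>))) \<partial>M) = border_char \<epsilon> n (\<lambda>k. if k = n then u else 0)" for u \<epsilon>
  proof -
    let ?f = "\<lambda>x. exp (\<i> * of_real (re_part (u * signed_per \<epsilon> n (\<lambda>i j. x (i, j)))))"
    have [measurable]: "(\<lambda>x. signed_per \<epsilon> n (\<lambda>i j. x (i, j))) \<in> borel_measurable (PiM ({..<n} \<times> {..<n}) (\<lambda>_. gaussian))"
      by (intro borel_measurable_signed_per measurable_gaussian_component) auto
    have "?f \<in> borel_measurable (PiM ({..<n} \<times> {..<n}) (\<lambda>_. gaussian))" by measurable
    from integral_std_gaussian_matrix[OF M G this]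
    have "border_char \<epsilon> n (\<lambda>k. if k = n then u else 0) = (\<integral>\<omega>. ?f (\<lambda>k\<in>{..<n} \<times> {..<n}. G \<omega> $$ k) \<partial>M)"
      by (simp add: border_char_last_coordinate)
    also have "\<dots> = (\<integral>\<omega>. exp (\<i> * of_real (re_part (u * ?signed_per \<epsilon> \<omega>))) \<partial>M)"
      by (intro Bochner_Integration.integral_cong refl arg_cong[where f="\<lambda>w. exp (\<i> * of_real (re_part (u * w)))"] signed_per_cong)
         auto
    finally show ?thesis ..
  qed
  have le: "(\<integral>\<omega>. exp (- s * (norm (?signed_per 1 \<omega>))\<^sup>2) \<partial>M) \<le> (\<integral>\<omega>. exp (- s * (norm (?signed_per (- 1) \<omega>))\<^sup>2) \<partial>M)" if "s \<ge> 0" for s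
  proof -
    have "(\<integral>\<omega>. exp (- (\<Sum>k<1::nat. (norm (\<Sum>j<1::nat. of_real (sqrt s) * ?signed_per 1 \<omega>))\<^sup>2)) \<partial>M)
      \<le> (\<integral>\<omega>. exp (- (\<Sum>k<1::nat. (norm (\<Sum>j<1::nat. of_real (sqrt s) * ?signed_per (- 1) \<omega>))\<^sup>2)) \<partial>M)"
      by (rule laplace_le_if_char_le[OF M]) (simp_all add: meas char Re_border_char_per_le_det)
    then show ?thesis
      using that by (simp add: norm_mult power_mult_distrib)
  qed
  have det: "Determinant.det (G \<omega>) = ?signed_per (- 1) \<omega>" and per: "per (G \<omega>) = ?signed_per 1 \<omega>" if "\<omega> \<in> space M" for \<omega>
    using det_eq_signed_per[OF carrier[OF that]] per_eq_signed_per[OF carrier[OF that]] by auto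
  have [measurable]: "(\<lambda>\<omega>. Determinant.det (G \<omega>)) \<in> borel_measurable M" "(\<lambda>\<omega>. per (G \<omega>)) \<in> borel_measurable M"
    using meas by (simp_all add: det per cong: measurable_cong)
  show ?thesis
    unfolding Lt_le_def
    using le by (simp add: det per cong: Bochner_Integration.integral_cong)
qed

section \<open>Positive semidefinite forms as sums of squares\<close>

definition quad_form :: "nat \<Rightarrow> (nat \<Rightarrow> nat \<Rightarrow> 'a::real_or_complex) \<Rightarrow> (nat \<Rightarrow> 'a) \<Rightarrow> real" where
  "quad_form n T v = re_part (\<Sum>i<n. \<Sum>j<n. conjugate (v i) * T i j * v j)"

lemma quad_form_Suc:
  fixes T :: "nat \<Rightarrow> nat \<Rightarrow> 'a::real_or_complex"
  assumes herm: "\<And>i j. i \<le> n \<Longrightarrow> j \<le> n \<Longrightarrow> T j i = conjugate (T i j)"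
  shows "quad_form (Suc n) T v = quad_form n T v + 2 * re_part (conjugate (v n) * (\<Sum>j<n. T n j * v j))
    + re_part (T n n) * (norm (v n))\<^sup>2"
proof -
  let ?b = "\<Sum>j<n. T n j * v j"
  have "(\<Sum>i<n. conjugate (v i) * T i n * v n) = conjugate ?b * v n"
    unfolding sum_conjugate[OF finite_lessThan] sum_distrib_right
    by (intro sum.cong refl) (simp add: herm[of n] conjugate_dist_mul mult_ac)
  also have "\<dots> = conjugate (conjugate (v n) * ?b)"
    by (simp add: conjugate_dist_mul mult.commute)
  finally have 1: "re_part (\<Sum>i<n. conjugate (v i) * T i n * v n) = re_part (conjugate (v n) * ?b)"
    by (simp only: re_part_conjugate)
  have 2: "re_part (\<Sum>j<n. conjugate (v n) * T n j * v j) = re_part (conjugate (v n) * ?b)"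
    by (simp add: sum_distrib_left mult.assoc)
  have eq: "conjugate (v n) * T n n * v n = of_real ((norm (v n))\<^sup>2) * T n n"
    by (simp only: conjugate_mult_self[symmetric] mult_ac)
  have 3: "re_part (conjugate (v n) * T n n * v n) = re_part (T n n) * (norm (v n))\<^sup>2"
    unfolding eq re_part_of_real_mult by (rule mult.commute)
  show ?thesis
    unfolding quad_form_def by (simp only: sum.lessThan_Suc sum.distrib re_part_add 1 2 3)
qed

lemma quad_form_cong:
  "(\<And>i. i < n \<Longrightarrow> v i = v' i) \<Longrightarrow> quad_form n T v = quad_form n T v'"
  unfolding quad_form_def by (intro arg_cong[where f=re_part] sum.cong refl) simp

lemma norm_add_square:
  "(norm (x + y))\<^sup>2 = (norm x)\<^sup>2 + (norm y)\<^sup>2 + 2 * re_part (conjugate x * (y::'a::real_or_complex))"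
  unfolding power2_norm_eq_inner inner_eq_re_part[symmetric] inner_add_left inner_add_right inner_commute[of y x]
  by simp

text \<open>
  Lagrange's reduction (the Cholesky factorization): if the last diagonal entry \<open>t\<close> is positive, completing the square
  in the last variable leaves a positive semidefinite form in the others; if \<open>t = 0\<close>, the last row vanishes.
\<close>

lemma quad_form_sum_of_squares:
  fixes T :: "nat \<Rightarrow> nat \<Rightarrow> 'a::real_or_complex"
  assumes "\<And>i j. i < n \<Longrightarrow> j < n \<Longrightarrow> T j i = conjugate (T i j)"
    and "\<And>v. 0 \<le> quad_form n T v"
  shows "\<exists>w. \<forall>v. quad_form n T v = (\<Sum>k<n. (norm (\<Sum>j<n. w k j * v j))\<^sup>2)"
  using assms
proof (induction n arbitrary: T)
  case 0
  show ?case by (simp add: quad_form_def re_part_def)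
next
  case (Suc n)
  define t where "t = re_part (T n n)"
  define b where "b v = (\<Sum>j<n. T n j * v j)" for v
  have herm: "T j i = conjugate (T i j)" if "i \<le> n" "j \<le> n" for i j
    by (rule Suc.prems(1)) (use that in auto)
  have Q: "quad_form (Suc n) T v = quad_form n T v + 2 * re_part (conjugate (v n) * b v) + t * (norm (v n))\<^sup>2" for v
    unfolding t_def b_def by (rule quad_form_Suc[OF herm])
  have upd: "quad_form n T (v(n := x)) = quad_form n T v" "b (v(n := x)) = b v" for v x
    by (rule quad_form_cong, simp, simp add: b_def)
  have Tnn: "T n n = of_real t"
  proof -
    have "2 * T n n = 2 * of_real t"
      using herm[of n n] add_conjugate[of "T n n"] by (simp add: t_def)
    then show ?thesis by simp
  qed
  have t: "t \<ge> 0"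
    using Suc.prems(2)[of "\<lambda>i. if i = n then 1 else 0"] unfolding Q
    by (simp add: quad_form_def b_def re_part_def)
  show ?case
  proof (cases "t = 0")
    case True
    have b0: "b v = 0" for v
    proof (rule ccontr)
      assume "b v \<noteq> 0"
      \<comment> \<open>a multiple of \<open>b v\<close> as last entry makes the form equal to \<open>- 1\<close>\<close>
      define c where "c = (quad_form n T v + 1) / (2 * (norm (b v))\<^sup>2)"
      have "0 \<le> quad_form (Suc n) T (v(n := - (of_real c * b v)))"
        by (rule Suc.prems(2))
      also have "\<dots> = quad_form n T v - 2 * c * (norm (b v))\<^sup>2"
      proof -
        have "conjugate (of_real c * b v) * b v = of_real (c * (norm (b v))\<^sup>2)"
          by (simp add: conjugate_dist_mul conjugate_mult_self mult.assoc)
             (simp add: conjugate_conv re_part_of_real)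
        then show ?thesis
          unfolding Q upd using True
          by (simp add: conjugate_neg re_part_minus re_part_of_real del: of_real_mult of_real_power)
      qed
      also have "\<dots> = - 1" using \<open>b v \<noteq> 0\<close> by (simp add: c_def field_simps)
      finally show False by simp
    qed
    have QQ: "quad_form (Suc n) T v = quad_form n T v" for v
      unfolding Q b0 True by (simp add: re_part_def)
    then have "0 \<le> quad_form n T v" for v
      using Suc.prems(2)[of v] by simp
    with Suc.IH[of T, OF herm] obtain w
      where w: "\<forall>v. quad_form n T v = (\<Sum>k<n. (norm (\<Sum>j<n. w k j * v j))\<^sup>2)"
      by auto
    show ?thesis
      by (rule exI[of _ "\<lambda>k j. if k < n \<and> j < n then w k j else 0"]) (simp add: QQ w)
  next
    case False
    with t have t0: "t > 0" by simp
    define S where "S i j = T i j - T i n * T n j / of_real t" for i j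
    have S: "quad_form n S v = quad_form n T v - (norm (b v))\<^sup>2 / t" for v
    proof -
      have "(\<Sum>i<n. \<Sum>j<n. conjugate (v i) * (T i n * T n j / of_real t) * v j)
        = of_real (inverse t) * ((\<Sum>i<n. conjugate (v i) * T i n) * (\<Sum>j<n. T n j * v j))"
        by (simp add: sum_product sum_distrib_left divide_inverse mult_ac)
      also have "(\<Sum>i<n. conjugate (v i) * T i n) = conjugate (b v)"
        unfolding b_def sum_conjugate[OF finite_lessThan]
        by (intro sum.cong refl) (simp add: herm[of n] conjugate_dist_mul mult.commute)
      also have "of_real (inverse t) * (conjugate (b v) * (\<Sum>j<n. T n j * v j)) = of_real ((norm (b v))\<^sup>2 / t)"
        unfolding b_def[symmetric] conjugate_mult_self by (simp add: divide_inverse mult.commute)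
      finally have "re_part (\<Sum>i<n. \<Sum>j<n. conjugate (v i) * (T i n * T n j / of_real t) * v j) = (norm (b v))\<^sup>2 / t"
        by (simp only: re_part_of_real)
      then show ?thesis
        unfolding quad_form_def S_def
        by (simp only: right_diff_distrib left_diff_distrib sum_subtractf re_part_diff)
    qed
    \<comment> \<open>completing the square\<close>
    have square: "quad_form (Suc n) T v = quad_form n S v + (norm (b v + of_real t * v n))\<^sup>2 / t" for v
    proof -
      have "re_part (conjugate (b v) * (of_real t * v n)) = t * re_part (conjugate (v n) * b v)"
      proof -
        have "conjugate (b v) * (of_real t * v n) = of_real t * conjugate (conjugate (v n) * b v)"
          by (simp add: conjugate_dist_mul mult_ac)
        then show ?thesis by (simp only: re_part_of_real_mult re_part_conjugate)
      qed
      then have "(norm (b v + of_real t * v n))\<^sup>2 = (norm (b v))\<^sup>2 + t\<^sup>2 * (norm (v n))\<^sup>2 + 2 * (t * re_part (conjugate (v n) * b v))"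
        by (simp add: norm_add_square norm_mult power_mult_distrib)
      then show ?thesis
        unfolding Q S using t0 by (simp add: field_simps power2_eq_square)
    qed
    have "0 \<le> quad_form n S v" for v
    proof -
      \<comment> \<open>the last entry is chosen to make the square vanish\<close>
      have "0 \<le> quad_form (Suc n) T (v(n := - (b v / of_real t)))" by (rule Suc.prems(2))
      also have "\<dots> = quad_form n S v"
      proof -
        have "quad_form n S (v(n := - (b v / of_real t))) = quad_form n S v"
          by (rule quad_form_cong) simp
        then show ?thesis unfolding square upd using t0 by simp
      qed
      finally show ?thesis .
    qed
    moreover have "S j i = conjugate (S i j)" if "i < n" "j < n" for i j
    proof -
      have "conjugate (of_real t :: 'a) = of_real t" by (simp add: conjugate_conv re_part_of_real)
      then have "conjugate (inverse (of_real t) :: 'a) = inverse (of_real t)"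
        by (simp add: conjugate_conv re_part_of_real flip: of_real_inverse)
      then show ?thesis
        using that by (simp add: S_def divide_inverse diff_conv_add_uminus conjugate_dist_add conjugate_neg
            conjugate_dist_mul herm[of i j] herm[of n j] herm[of i n] mult_ac del: add_uminus_conv_diff)
    qed
    ultimately obtain w where w: "\<forall>v. quad_form n S v = (\<Sum>k<n. (norm (\<Sum>j<n. w k j * v j))\<^sup>2)"
      using Suc.IH[of S] by blast
    define w' where "w' k j = (if k < n then if j < n then w k j else 0 else of_real (1 / sqrt t) * T n j)" for k j
    have "quad_form (Suc n) T v = (\<Sum>k<Suc n. (norm (\<Sum>j<Suc n. w' k j * v j))\<^sup>2)" for v
    proof -
      have "(\<Sum>j<Suc n. w' n j * v j) = of_real (1 / sqrt t) * (b v + of_real t * v n)"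
        by (simp add: w'_def b_def sum_distrib_left distrib_left Tnn mult.assoc)
      then have "(norm (\<Sum>j<Suc n. w' n j * v j))\<^sup>2 = (norm (b v + of_real t * v n))\<^sup>2 / t"
        using t0 by (simp only: norm_mult) (simp add: norm_divide power_divide power_mult_distrib)
      moreover have "(\<Sum>j<Suc n. w' k j * v j) = (\<Sum>j<n. w k j * v j)" if "k < n" for k
        using that by (simp add: w'_def)
      ultimately show ?thesis
        unfolding square w[rule_format] by simp
    qed
    then show ?thesis by blast
  qed
qed

section \<open>The Laplace order for cofactor columns\<close>

lemma mat_adjoint_index:
  fixes A :: "'a::conjugatable_field mat"
  assumes "A \<in> carrier_mat m n"
  shows "mat_adjoint A \<in> carrier_mat n m"
    and "i < n \<Longrightarrow> j < m \<Longrightarrow> mat_adjoint A $$ (i, j) = conjugate (A $$ (j, i))"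
  using assms by (auto simp: mat_adjoint_def mat_of_rows_def)

lemma outer_index:
  fixes v :: "'a::conjugatable_field Matrix.vec"
  assumes "v \<in> carrier_vec n"
  shows "outer v \<in> carrier_mat n n"
    and "i < n \<Longrightarrow> j < n \<Longrightarrow> outer v $$ (i, j) = v $ i * conjugate (v $ j)"
proof -
  have c: "mat_of_cols n [v] \<in> carrier_mat n 1" by auto
  have d: "dim_vec v = n" using assms by simp
  note adj = mat_adjoint_index[OF c]
  show "outer v \<in> carrier_mat n n"
    unfolding outer_def d using c adj(1) by auto
  show "outer v $$ (i, j) = v $ i * conjugate (v $ j)" if "i < n" "j < n"
    unfolding outer_def d using that adj(1) adj(2)[of 0 j] c
    by (auto simp: scalar_prod_def mat_of_cols_index)
qed

lemma sesquilinear_expand: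
  fixes A :: "'a::conjugatable_field mat"
  assumes "A \<in> carrier_mat n n" "v \<in> carrier_vec n"
  shows "(A *\<^sub>v v) \<bullet>c v = (\<Sum>i<n. \<Sum>j<n. conjugate (v $ i) * A $$ (i, j) * v $ j)"
  using assms by (auto simp: scalar_prod_def atLeast0LessThan sum_distrib_left sum_distrib_right mult_ac intro!: sum.cong)

lemma psd_mat_outer:
  fixes v :: "'a::real_or_complex Matrix.vec"
  assumes v: "v \<in> carrier_vec n"
  shows "psd_mat n (outer v)"
  unfolding psd_mat_def
proof (intro conjI ballI)
  note out = outer_index[OF v]
  show "outer v \<in> carrier_mat n n" by (rule out)
  show "mat_adjoint (outer v) = outer v"
    using mat_adjoint_index[OF out(1)] out by (intro eq_matI) (auto simp: conjugate_dist_mul mult.commute)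
  fix u :: "'a Matrix.vec" assume u: "u \<in> carrier_vec n"
  let ?x = "\<Sum>i<n. conjugate (u $ i) * v $ i"
  have "(outer v *\<^sub>v u) \<bullet>c u = (\<Sum>i<n. \<Sum>j<n. (conjugate (u $ i) * v $ i) * conjugate (conjugate (u $ j) * v $ j))"
    unfolding sesquilinear_expand[OF out(1) u]
    by (intro sum.cong refl) (simp add: out conjugate_dist_mul mult_ac)
  also have "\<dots> = ?x * conjugate ?x"
    by (simp add: sum_product sum_conjugate)
  finally show "0 \<le> (outer v *\<^sub>v u) \<bullet>c u"
    using conjugate_square_positive[of ?x] by simp
qed

lemma psd_mat_sum_of_squares:
  fixes T :: "'a::real_or_complex mat"
  assumes T: "psd_mat n T"
  shows "\<exists>w. \<forall>v\<in>carrier_vec n.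
    re_part (mat_trace (T * outer v)) = (\<Sum>k<n. (norm (\<Sum>j<n. w k j * v $ j))\<^sup>2)"
proof -
  have carrier: "T \<in> carrier_mat n n" and adj: "mat_adjoint T = T"
    and pos: "\<And>v. v \<in> carrier_vec n \<Longrightarrow> 0 \<le> (T *\<^sub>v v) \<bullet>c v"
    using T by (auto simp: psd_mat_def)
  let ?T = "\<lambda>i j. T $$ (i, j)"
  have "0 \<le> quad_form n ?T v" for v
  proof -
    have "0 \<le> re_part ((T *\<^sub>v Matrix.vec n v) \<bullet>c Matrix.vec n v)"
      by (intro re_part_nonneg pos) simp
    then show ?thesis
      by (simp add: sesquilinear_expand[OF carrier] quad_form_def)
  qed
  moreover have "T $$ (j, i) = conjugate (T $$ (i, j))" if "i < n" "j < n" for i j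
    using mat_adjoint_index(2)[OF carrier that(2,1)] adj by simp
  ultimately obtain w where w: "\<forall>v. quad_form n ?T v = (\<Sum>k<n. (norm (\<Sum>j<n. w k j * v j))\<^sup>2)"
    using quad_form_sum_of_squares[of n ?T] by blast
  show ?thesis
  proof (intro exI[of _ w] ballI)
    fix v :: "'a Matrix.vec" assume v: "v \<in> carrier_vec n"
    note out = outer_index[OF v]
    have "mat_trace (T * outer v) = (\<Sum>i<n. \<Sum>j<n. conjugate (v $ i) * T $$ (i, j) * v $ j)"
      unfolding mat_trace_def using carrier out
      by (auto simp: scalar_prod_def atLeast0LessThan mult_ac intro!: sum.cong)
    then show "re_part (mat_trace (T * outer v)) = (\<Sum>k<n. (norm (\<Sum>j<n. w k j * v $ j))\<^sup>2)"
      using w[rule_format, of "\<lambda>j. v $ j"] by (simp add: quad_form_def)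
  qed
qed

theorem Lt_le_mat_cofactor:
  fixes B :: "'w \<Rightarrow> 'a::real_or_complex mat"
  assumes M: "prob_space M" and n: "n \<ge> 1" and B: "std_gaussian_matrix M (n - 1) n B"
  shows "Lt_le_mat M n (\<lambda>\<omega>. outer (cofactor_det (B \<omega>))) (\<lambda>\<omega>. outer (cofactor_per (B \<omega>)))"
proof -
  obtain m where m: "n = Suc m" using n by (cases n) auto
  have B': "std_gaussian_matrix M m (Suc m) B" using B by (simp add: m)
  note carrier = std_gaussian_matrix_carrier[OF B']
  have cof: "cofactor_per (B \<omega>) \<in> carrier_vec n" "cofactor_det (B \<omega>) \<in> carrier_vec n" if "\<omega> \<in> space M" for \<omega>
    using cofactor_carrier[OF carrier[OF that]] by (auto simp: m)
  have dims: "dim_row (B \<omega>) = m" "dim_col (B \<omega>) = Suc m" if "\<omega> \<in> space M" for \<omega>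
    using carrier[OF that] by auto
  have minor: "(\<lambda>\<omega>. signed_per \<epsilon> m (\<lambda>i k. delete_col (B \<omega>) j $$ (i, k))) \<in> borel_measurable M" if "j < n" for j \<epsilon>
  proof (rule borel_measurable_signed_per)
    fix i k assume ik: "i < m" "k < m"
    have "(\<lambda>\<omega>. B \<omega> $$ (i, if k < j then k else Suc k)) \<in> borel_measurable M"
      using ik by (intro std_gaussian_matrix_entry_measurable[OF M B']) auto
    then show "(\<lambda>\<omega>. delete_col (B \<omega>) j $$ (i, k)) \<in> borel_measurable M"
      by (rule measurable_cong[THEN iffD1, rotated]) (use ik in \<open>auto simp: delete_col_def dims\<close>)
  qed
  have minor_eq: "per (delete_col (B \<omega>) j) = signed_per 1 m (\<lambda>i k. delete_col (B \<omega>) j $$ (i, k))"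
      "Determinant.det (delete_col (B \<omega>) j) = signed_per (- 1) m (\<lambda>i k. delete_col (B \<omega>) j $$ (i, k))"
    if "\<omega> \<in> space M" for \<omega> j
    using per_eq_signed_per det_eq_signed_per delete_col_carrier[OF carrier[OF that]] by blast+
  have per_meas: "(\<lambda>\<omega>. cofactor_per (B \<omega>) $ j) \<in> borel_measurable M" if "j < n" for j
    by (rule measurable_cong[THEN iffD1, OF _ minor[OF that, of 1]])
       (use that in \<open>auto simp: cofactor_per_def m dims minor_eq\<close>)
  have det_meas: "(\<lambda>\<omega>. cofactor_det (B \<omega>) $ j) \<in> borel_measurable M" if "j < n" for j
    by (rule measurable_cong[THEN iffD1, OF _ borel_measurable_times[OF borel_measurable_const[of "(- 1) ^ j"] minor[OF that, of "- 1"]]])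
       (use that in \<open>auto simp: cofactor_det_def m dims minor_eq\<close>)
  have random: "random_psd_mat M n (\<lambda>\<omega>. outer (C \<omega>))"
    if C: "\<And>\<omega>. \<omega> \<in> space M \<Longrightarrow> C \<omega> \<in> carrier_vec n" and meas: "\<And>j. j < n \<Longrightarrow> (\<lambda>\<omega>. C \<omega> $ j) \<in> borel_measurable M"
    for C :: "'w \<Rightarrow> 'a Matrix.vec"
    unfolding random_psd_mat_def
  proof (intro conjI ballI allI impI)
    show "psd_mat n (outer (C \<omega>))" if "\<omega> \<in> space M" for \<omega>
      by (rule psd_mat_outer[OF C[OF that]])
    fix i j assume ij: "i < n" "j < n"
    have "(\<lambda>\<omega>. C \<omega> $ i * conjugate (C \<omega> $ j)) \<in> borel_measurable M"
      using meas[OF ij(1)] measurable_compose[OF meas[OF ij(2)] borel_measurable_conjugate]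
      by (rule borel_measurable_times)
    then show "(\<lambda>\<omega>. outer (C \<omega>) $$ (i, j)) \<in> borel_measurable M"
      by (rule measurable_cong[THEN iffD1, rotated]) (use ij in \<open>simp add: outer_index[OF C]\<close>)
  qed
  have "(\<integral>\<omega>. exp (- re_part (mat_trace (T * outer (cofactor_per (B \<omega>))))) \<partial>M)
      \<le> (\<integral>\<omega>. exp (- re_part (mat_trace (T * outer (cofactor_det (B \<omega>))))) \<partial>M)" if T: "psd_mat n T" for T
  proof -
    obtain w where w: "\<forall>v\<in>carrier_vec n.
        re_part (mat_trace (T * outer v)) = (\<Sum>k<n. (norm (\<Sum>j<n. w k j * v $ j))\<^sup>2)"
      using psd_mat_sum_of_squares[OF T] by blast
    have "(\<integral>\<omega>. exp (- (\<Sum>k<n. (norm (\<Sum>j<n. w k j * cofactor_per (B \<omega>) $ j))\<^sup>2)) \<partial>M)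
      \<le> (\<integral>\<omega>. exp (- (\<Sum>k<n. (norm (\<Sum>j<n. w k j * cofactor_det (B \<omega>) $ j))\<^sup>2)) \<partial>M)"
    proof (rule laplace_le_if_char_le[OF M det_meas per_meas])
      fix u :: "nat \<Rightarrow> 'a"
      show "Re (\<integral>\<omega>. exp (\<i> * of_real (re_part (\<Sum>j<n. u j * cofactor_per (B \<omega>) $ j))) \<partial>M)
        \<le> Re (\<integral>\<omega>. exp (\<i> * of_real (re_part (\<Sum>j<n. u j * cofactor_det (B \<omega>) $ j))) \<partial>M)"
        unfolding m lessThan_Suc_atMost char_cofactor_per[OF M B'] char_cofactor_det[OF M B']
        by (rule Re_border_char_per_le_det)
    qed
    then show ?thesis
      by (simp add: w cof cong: Bochner_Integration.integral_cong)
  qed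
  then show ?thesis
    unfolding Lt_le_mat_def using random[OF cof(1) per_meas] random[OF cof(2) det_meas] by blast
qed

theorem theorem1p5:
  fixes M :: "'w measure" and n :: nat
  assumes "prob_space M" and "n \<ge> 1"
  shows
    "(\<forall>B :: 'w \<Rightarrow> real mat. std_gaussian_matrix M (n - 1) n B \<longrightarrow>
        Lt_le_mat M n (\<lambda>\<omega>. outer (cofactor_det (B \<omega>))) (\<lambda>\<omega>. outer (cofactor_per (B \<omega>)))) \<and>
     (\<forall>B :: 'w \<Rightarrow> complex mat. std_gaussian_matrix M (n - 1) n B \<longrightarrow>
        Lt_le_mat M n (\<lambda>\<omega>. outer (cofactor_det (B \<omega>))) (\<lambda>\<omega>. outer (cofactor_per (B \<omega>)))) \<and>
     (\<forall>G :: 'w \<Rightarrow> real mat. std_gaussian_matrix M n n G \<longrightarrow>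
        Lt_le M (\<lambda>\<omega>. (norm (Determinant.det (G \<omega>)))\<^sup>2) (\<lambda>\<omega>. (norm (per (G \<omega>)))\<^sup>2)) \<and>
     (\<forall>G :: 'w \<Rightarrow> complex mat. std_gaussian_matrix M n n G \<longrightarrow>
        Lt_le M (\<lambda>\<omega>. (norm (Determinant.det (G \<omega>)))\<^sup>2) (\<lambda>\<omega>. (norm (per (G \<omega>)))\<^sup>2)) \<and>
     (\<forall>(B :: 'w \<Rightarrow> real mat) z. std_gaussian_matrix M n (n + 1) B \<longrightarrow> z \<in> carrier_vec (n + 1) \<longrightarrow>
        0 \<le> vec_char M (\<lambda>\<omega>. cofactor_per (B \<omega>)) z \<and>
        vec_char M (\<lambda>\<omega>. cofactor_per (B \<omega>)) z \<le> vec_char M (\<lambda>\<omega>. cofactor_det (B \<omega>)) z) \<and>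
     (\<forall>(B :: 'w \<Rightarrow> complex mat) z. std_gaussian_matrix M n (n + 1) B \<longrightarrow> z \<in> carrier_vec (n + 1) \<longrightarrow>
        0 \<le> vec_char M (\<lambda>\<omega>. cofactor_per (B \<omega>)) z \<and>
        vec_char M (\<lambda>\<omega>. cofactor_per (B \<omega>)) z \<le> vec_char M (\<lambda>\<omega>. cofactor_det (B \<omega>)) z)"
  by (intro conjI allI impI Lt_le_mat_cofactor[OF assms] Lt_le_det_per[OF assms(1)]
      vec_char_cofactor_le[OF assms, THEN conjunct1] vec_char_cofactor_le[OF assms, THEN conjunct2])

end
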